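(* Let $(G,\omega_1)$ and $(H,\omega_2)$ be weighted locally compact groups, $1\le p<\infty$, with $L^p(G,\omega_1)$ and $L^p(H,\omega_2)$ convolution Banach algebras. Let $T:L^p(G,\omega_1)\to L^p(H,\omega_2)$ be a bicontinuous biseparating algebra isomorphism. Then there exists a standard isomorphism $(\gamma,\phi)$ from $(G,\omega_1)$ to $(H,\omega_2)$ such that $T=T_{\gamma,\phi}$.
   Context: A weighted locally compact group is a pair $(G,\omega)$ with $G$ locally compact and $\omega:G\to\mathbb{R}^+$ positive continuous, $\omega(xy)\le\omega(x)\omega(y)$, $\omega(e_G)=1$. $L^p(G,\omega)$ is the space of measurable $f$ with $\|f\|_{p,\omega}=\left(\int_G|f|^p\omega^p\,d\lambda\right)^{1/p}<\infty$. An operator $T$ is disjointness preserving if $f\cdot g=0$ implies $Tf\cdot Tg=0$; biseparating if it is a bijection and $T,T^{-1}$ are disjointness preserving; bicontinuous if $T,T^{-1}$ are bounded. A standard isomorphism $(\gamma,\phi)$ from $(G,\omega_1)$ onto $(H,\omega_2)$ consists of a topological group isomorphism $\phi:G\to H$ and a continuous character $\gamma:G\to\mathbb{C}\setminus\{0\}$ with $0<\inf_{x\in G}|\gamma(x)|\frac{\omega_2(\phi(x))}{\omega_1(x)}$ and $\sup_{x\in G}|\gamma(x)|\frac{\omega_2(\phi(x))}{\omega_1(x)}<\infty$. For such a pair, with Haar measures $\lambda_1,\lambda_2$ on $G,H$, let $c$ be the constant with $c=\lambda_1(E)/\lambda_2(\phi(E))$ for every non-null measurable $E\subset G$, and define $T_{\gamma,\phi}:L^p(G,\omega_1)\to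 L^p(H,\omega_2)$ by $T_{\gamma,\phi}(f)=c\,(\gamma\circ\phi^{-1})\cdot(f\circ\phi^{-1})$. *)

theory Defs
  imports "HOL-Analysis.Analysis"
begin

text \<open>Conventions. A locally compact group is modelled as a type of class
  topological_group_add (a possibly non-abelian group, written additively:
  x + y is the product, - x the inverse, 0 the identity) which is Hausdorff
  and locally compact.  Functions on groups are complex valued; elements of
  the weighted L^p spaces are represented by Borel measurable functions, and
  all identities between such elements are understood almost everywhere.\<close>

definition lc_group :: "'g::{topological_group_add,t2_space} itself \<Rightarrow> bool" where
  "lc_group _ \<longleftrightarrow> locally_compact_space (euclidean :: 'g topology)"

definition weight :: "('g::topological_group_add \<Rightarrow> real) \<Rightarrow> bool" where
  "weight \<omega> \<longleftrightarrow> continuous_on UNIV \<omega> \<and> (\<forall>x. 0 < \<omega> x) \<and>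
     (\<forall>x y. \<omega> (x + y) \<le> \<omega> x * \<omega> y) \<and> \<omega> 0 = 1"

definition haar_measure :: "'g::{topological_group_add,t2_space} measure \<Rightarrow> bool" where
  "haar_measure M \<longleftrightarrow>
     sets M = sets borel \<and>
     (\<forall>x. \<forall>A\<in>sets borel. emeasure M ((+) x ` A) = emeasure M A) \<and>
     (\<forall>K. compact K \<longrightarrow> emeasure M K < \<infinity>) \<and>
     (\<forall>U. open U \<and> U \<noteq> {} \<longrightarrow> 0 < emeasure M U) \<and>
     (\<forall>A\<in>sets borel. emeasure M A = (INF U\<in>{U. open U \<and> A \<subseteq> U}. emeasure M U)) \<and>
     (\<forall>U. open U \<longrightarrow> emeasure M U = (SUP K\<in>{K. compact K \<and> K \<subseteq> U}. emeasure M K))"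

definition Lp_w :: "'g measure \<Rightarrow> ('g \<Rightarrow> real) \<Rightarrow> real \<Rightarrow> ('g \<Rightarrow> complex) set" where
  "Lp_w M \<omega> p = {f. f \<in> borel_measurable M \<and>
       integrable M (\<lambda>x. norm (f x) powr p * \<omega> x powr p)}"

definition Lp_norm :: "'g measure \<Rightarrow> ('g \<Rightarrow> real) \<Rightarrow> real \<Rightarrow> ('g \<Rightarrow> complex) \<Rightarrow> real" where
  "Lp_norm M \<omega> p f = (\<integral>x. norm (f x) powr p * \<omega> x powr p \<partial>M) powr (1 / p)"

definition conv :: "'g::group_add measure \<Rightarrow> ('g \<Rightarrow> complex) \<Rightarrow> ('g \<Rightarrow> complex) \<Rightarrow> 'g \<Rightarrow> complex" where
  "conv M f g x = (\<integral>y. f y * g (- y + x) \<partial>M)"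

definition conv_algebra :: "'g::group_add measure \<Rightarrow> ('g \<Rightarrow> real) \<Rightarrow> real \<Rightarrow> bool" where
  "conv_algebra M \<omega> p \<longleftrightarrow>
     (\<forall>f\<in>Lp_w M \<omega> p. \<forall>g\<in>Lp_w M \<omega> p.
        (AE x in M. integrable M (\<lambda>y. f y * g (- y + x))) \<and> conv M f g \<in> Lp_w M \<omega> p)"

definition ae_eq :: "'a measure \<Rightarrow> ('a \<Rightarrow> complex) \<Rightarrow> ('a \<Rightarrow> complex) \<Rightarrow> bool" where
  "ae_eq M f g \<longleftrightarrow> (AE x in M. f x = g x)"

definition alg_iso :: "'g::group_add measure \<Rightarrow> ('g \<Rightarrow> real) \<Rightarrow> 'h::group_add measure \<Rightarrow> ('h \<Rightarrow> real)
     \<Rightarrow> real \<Rightarrow> (('g \<Rightarrow> complex) \<Rightarrow> ('h \<Rightarrow> complex)) \<Rightarrow> bool" where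
  "alg_iso M1 \<omega>1 M2 \<omega>2 p T \<longleftrightarrow>
     (\<forall>f\<in>Lp_w M1 \<omega>1 p. T f \<in> Lp_w M2 \<omega>2 p) \<and>
     (\<forall>f\<in>Lp_w M1 \<omega>1 p. \<forall>g\<in>Lp_w M1 \<omega>1 p. ae_eq M1 f g \<longrightarrow> ae_eq M2 (T f) (T g)) \<and>
     (\<forall>f\<in>Lp_w M1 \<omega>1 p. \<forall>g\<in>Lp_w M1 \<omega>1 p.
        ae_eq M2 (T (\<lambda>x. f x + g x)) (\<lambda>y. T f y + T g y)) \<and>
     (\<forall>f\<in>Lp_w M1 \<omega>1 p. \<forall>a::complex. ae_eq M2 (T (\<lambda>x. a * f x)) (\<lambda>y. a * T f y)) \<and>
     (\<forall>f\<in>Lp_w M1 \<omega>1 p. \<forall>g\<in>Lp_w M1 \<omega>1 p. ae_eq M2 (T f) (T g) \<longrightarrow> ae_eq M1 f g) \<and>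
     (\<forall>h\<in>Lp_w M2 \<omega>2 p. \<exists>f\<in>Lp_w M1 \<omega>1 p. ae_eq M2 (T f) h) \<and>
     (\<forall>f\<in>Lp_w M1 \<omega>1 p. \<forall>g\<in>Lp_w M1 \<omega>1 p.
        ae_eq M2 (T (conv M1 f g)) (conv M2 (T f) (T g)))"

definition bicontinuous :: "'g measure \<Rightarrow> ('g \<Rightarrow> real) \<Rightarrow> 'h measure \<Rightarrow> ('h \<Rightarrow> real)
     \<Rightarrow> real \<Rightarrow> (('g \<Rightarrow> complex) \<Rightarrow> ('h \<Rightarrow> complex)) \<Rightarrow> bool" where
  "bicontinuous M1 \<omega>1 M2 \<omega>2 p T \<longleftrightarrow>
     (\<exists>C. \<forall>f\<in>Lp_w M1 \<omega>1 p. Lp_norm M2 \<omega>2 p (T f) \<le> C * Lp_norm M1 \<omega>1 p f) \<and>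
     (\<exists>C. \<forall>f\<in>Lp_w M1 \<omega>1 p. Lp_norm M1 \<omega>1 p f \<le> C * Lp_norm M2 \<omega>2 p (T f))"

definition biseparating :: "'g measure \<Rightarrow> ('g \<Rightarrow> real) \<Rightarrow> 'h measure \<Rightarrow> ('h \<Rightarrow> real)
     \<Rightarrow> real \<Rightarrow> (('g \<Rightarrow> complex) \<Rightarrow> ('h \<Rightarrow> complex)) \<Rightarrow> bool" where
  "biseparating M1 \<omega>1 M2 \<omega>2 p T \<longleftrightarrow>
     (\<forall>f\<in>Lp_w M1 \<omega>1 p. \<forall>g\<in>Lp_w M1 \<omega>1 p.
        ae_eq M1 (\<lambda>x. f x * g x) (\<lambda>_. 0) \<longrightarrow> ae_eq M2 (\<lambda>y. T f y * T g y) (\<lambda>_. 0)) \<and>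
     (\<forall>f\<in>Lp_w M1 \<omega>1 p. \<forall>g\<in>Lp_w M1 \<omega>1 p.
        ae_eq M2 (\<lambda>y. T f y * T g y) (\<lambda>_. 0) \<longrightarrow> ae_eq M1 (\<lambda>x. f x * g x) (\<lambda>_. 0))"

definition standard_iso :: "('g::topological_group_add \<Rightarrow> real) \<Rightarrow> ('h::topological_group_add \<Rightarrow> real)
     \<Rightarrow> ('g \<Rightarrow> complex) \<Rightarrow> ('g \<Rightarrow> 'h) \<Rightarrow> bool" where
  "standard_iso \<omega>1 \<omega>2 \<gamma> \<phi> \<longleftrightarrow>
     bij \<phi> \<and> continuous_on UNIV \<phi> \<and> continuous_on UNIV (inv \<phi>) \<and>
     (\<forall>x y. \<phi> (x + y) = \<phi> x + \<phi> y) \<and>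
     continuous_on UNIV \<gamma> \<and> (\<forall>x. \<gamma> x \<noteq> 0) \<and> (\<forall>x y. \<gamma> (x + y) = \<gamma> x * \<gamma> y) \<and>
     0 < (INF x. norm (\<gamma> x) * \<omega>2 (\<phi> x) / \<omega>1 x) \<and>
     bdd_above (range (\<lambda>x. norm (\<gamma> x) * \<omega>2 (\<phi> x) / \<omega>1 x))"

definition haar_const :: "'g measure \<Rightarrow> 'h measure \<Rightarrow> ('g \<Rightarrow> 'h) \<Rightarrow> real \<Rightarrow> bool" where
  "haar_const M1 M2 \<phi> c \<longleftrightarrow>
     (\<forall>E\<in>sets M1. emeasure M1 E \<noteq> 0 \<longrightarrow> emeasure M1 E = ennreal c * emeasure M2 (\<phi> ` E))"

definition T_std :: "real \<Rightarrow> ('g \<Rightarrow> complex) \<Rightarrow> ('g \<Rightarrow> 'h) \<Rightarrow> ('g \<Rightarrow> complex) \<Rightarrow> 'h \<Rightarrow> complex" where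
  "T_std c \<gamma> \<phi> f y = complex_of_real c * \<gamma> (inv \<phi> y) * f (inv \<phi> y)"

end

theory Submission
  imports Defs
begin

text \<open>
  Write $L_a$ for left translation. For $a \<in> G$ the operator $S = T L_a T^{-1}$ on $L^p(H,\omega_2)$ is
  bounded, biseparating and commutes with right convolutions. Convolving $|Sf|$ and $|Sg|$ on the right with bump
  functions and using that $S$ preserves disjointness shows that the essential supports of $Sf$ and $Sg$ lie in the
  same relative position as those of $f$ and $g$; by compactness there is a point $b$ such that $L_b^{-1} S$ does not
  enlarge supports. A bounded operator with this property is a multiplication operator, and commuting with
  convolutions makes its symbol constant. Hence $T L_a = \gamma(a) L_{\phi(a)} T$. Uniqueness of the pair
  $(\gamma(a), \phi(a))$, the same statement for $T^{-1}$, the continuity of translation in $L^p$ and the fact that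
  $L_a$ has norm $\omega(a)$ show that $(\gamma,\phi)$ is a standard isomorphism.

  Finally, for $k$ continuous with compact support, $f * T^{-1}k$ is a limit of Riemann sums
  $\sum_i c_i L_{x_i} T^{-1} k$. Applying $T$ gives
  $Tf * k = \int f(x)\, \gamma(x)\, L_{\phi(x)} k \, d\lambda_1(x)$, which is $T_{\gamma,\phi} f * k$ by
  uniqueness of Haar measure; as $k$ is arbitrary, $T = T_{\gamma,\phi}$.
\<close>

subsection \<open>Topological preliminaries\<close>

text \<open>Neither group is assumed sigma-compact or second countable. Haar measure may fail to be
  sigma-finite, and Borel sets of the product need not lie in the product sigma-algebra. So
  integrals are interchanged only for continuous functions of compact support, and null-set
  arguments run along countably many compact sets carrying a given function of \<open>Lp\<close>.
  Inversion is controlled by one-sided bounds on compact sets, enough to make convolution well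
  defined on classes in its right factor.

  Absolute values are taken before convolving with bumps so that nothing cancels; biseparation
  supplies a preimage of |Sf| that vanishes wherever f does. The multiplication operator U gets no
  global symbol: the relation g * U f = f * U g, used for convolutions (which are continuous) and
  evaluated at 0, already yields the scalar.

  \<open>conv_algebra\<close> asserts membership only. The bound needed to approximate f * T^{-1}k,
  where T^{-1}k is merely in \<open>Lp\<close>, is derived for bounded compactly supported f from
  Riemann sums and Fatou's lemma.\<close>

lemma Hausdorff_space_t2_euclidean: "Hausdorff_space (euclidean :: 'a::t2_space topology)"
  unfolding Hausdorff_space_def by (metis disjnt_def hausdorff open_openin)

lemma compact_nbhd_base:
  fixes x :: "'g::{topological_group_add,t2_space}"
  assumes "lc_group TYPE('g)" "open U" "x \<in> U"
  obtains V K where "open V" "compact K" "x \<in> V" "V \<subseteq> K" "K \<subseteq> U"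
proof -
  have "neighbourhood_base_of (compactin (euclidean::'g topology)) euclidean"
    using assms(1) locally_compact_space_neighbourhood_base[of "euclidean::'g topology"]
    unfolding lc_group_def by (simp add: Hausdorff_space_t2_euclidean)
  then show thesis
    using that assms unfolding neighbourhood_base_of by (metis open_openin compactin_euclidean_iff)
qed

lemma compact_nbhd_base_compact:
  fixes K :: "'g::{topological_group_add,t2_space} set"
  assumes lc: "lc_group TYPE('g)" and "compact K" "open U" "K \<subseteq> U"
  obtains V L where "open V" "compact L" "K \<subseteq> V" "V \<subseteq> L" "L \<subseteq> U"
proof -
  have "\<forall>x\<in>K. \<exists>V L. open V \<and> compact L \<and> x \<in> V \<and> V \<subseteq> L \<and> L \<subseteq> U"
    using compact_nbhd_base[OF lc assms(3)] assms(4) by (metis subsetD)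
  then obtain V L where VL: "\<And>x. x \<in> K \<Longrightarrow> open (V x) \<and> compact (L x) \<and> x \<in> V x \<and> V x \<subseteq> L x \<and> L x \<subseteq> U"
    by metis
  obtain X where X: "X \<subseteq> K" "finite X" "K \<subseteq> (\<Union>x\<in>X. V x)"
    by (rule compactE_image[OF assms(2), of K V]) (use VL in auto)
  show thesis
  proof (rule that[of "\<Union>x\<in>X. V x" "\<Union>x\<in>X. L x"])
    show "open (\<Union>x\<in>X. V x)" using X VL by (intro open_UN) blast
    show "compact (\<Union>x\<in>X. L x)" using X VL by (intro compact_UN) blast+
    show "K \<subseteq> (\<Union>x\<in>X. V x)" by (fact X)
    show "(\<Union>x\<in>X. V x) \<subseteq> (\<Union>x\<in>X. L x)" "(\<Union>x\<in>X. L x) \<subseteq> U"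
      using X VL by (meson UN_mono order_refl subsetD, meson UN_least subsetD)
  qed
qed

lemma urysohn_bump:
  fixes K :: "'g::{topological_group_add,t2_space} set"
  assumes lc: "lc_group TYPE('g)" and "compact K" "open U" "K \<subseteq> U"
  shows "\<exists>(k :: 'g \<Rightarrow> real) L. continuous_on UNIV k \<and> (\<forall>x. 0 \<le> k x) \<and> (\<forall>x. k x \<le> 1) \<and>
    (\<forall>x\<in>K. k x = 1) \<and> compact L \<and> L \<subseteq> U \<and> (\<forall>x. x \<notin> L \<longrightarrow> k x = 0)"
proof -
  obtain V L where VL: "open V" "compact L" "K \<subseteq> V" "V \<subseteq> L" "L \<subseteq> U"
    using compact_nbhd_base_compact[OF assms] .
  have cr: "completely_regular_space (euclidean :: 'g topology)"
    using lc locally_compact_regular_imp_completely_regular_space Hausdorff_space_t2_euclidean unfolding lc_group_def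
    by blast
  obtain k where k: "continuous_map (euclidean :: 'g topology) (top_of_set {0..1::real}) k"
      "k ` (- V) \<subseteq> {0}" "k ` K \<subseteq> {1}"
    by (rule Urysohn_completely_regular_compact_closed[OF _ cr, of 0 1 K "- V"])
      (use VL assms in \<open>auto simp: disjnt_def closed_Compl\<close>)
  have "continuous_on UNIV k" "\<And>x. k x \<in> {0..1}"
    using k(1) by (auto simp: continuous_map_in_subtopology)
  moreover have "k x = 0" if "x \<notin> L" for x using k(2) VL(4) that by blast
  ultimately show ?thesis
    using k(3) VL by (intro exI[of _ k] exI[of _ L]) (auto simp: image_subset_iff)
qed

text \<open>The tube lemma gives uniformity over L without a metric or uniform structure on the
  first factor. It is the source of every uniform estimate below.\<close>

lemma tube_dist:
  fixes F :: "'a::topological_space \<times> 'b::topological_space \<Rightarrow> 'c::metric_space"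
  assumes F: "continuous_on UNIV F" and L: "compact L" and e: "0 < e"
  shows "\<exists>V. open V \<and> x \<in> V \<and> (\<forall>x'\<in>V. \<forall>y\<in>L. dist (F (x', y)) (F (x, y)) < e)"
proof -
  have "\<exists>V W. open V \<and> open W \<and> x \<in> V \<and> y \<in> W \<and> (\<forall>x'\<in>V. \<forall>y'\<in>W. dist (F (x', y')) (F (x, y')) < e)" for y
  proof -
    define O' where "O' = F -` ball (F (x, y)) (e/2)"
    have "open O'" unfolding O'_def by (rule open_vimage[OF _ F]) simp
    moreover have "(x, y) \<in> O'" using e by (simp add: O'_def)
    ultimately obtain V W where VW: "open V" "open W" "(x, y) \<in> V \<times> W" "V \<times> W \<subseteq> O'"
      by (rule open_prod_elim)
    have "dist (F (x', y')) (F (x, y')) < e" if "x' \<in> V" "y' \<in> W" for x' y'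
    proof -
      have "(x', y') \<in> O'" "(x, y') \<in> O'" using VW that by auto
      then show ?thesis
        unfolding O'_def vimage_eq mem_ball by (rule dist_triangle_half_r)
    qed
    then show ?thesis using VW by blast
  qed
  then obtain V W where VW: "\<And>y. open (V y) \<and> open (W y) \<and> x \<in> V y \<and> y \<in> W y \<and>
      (\<forall>x'\<in>V y. \<forall>y'\<in>W y. dist (F (x', y')) (F (x, y')) < e)"
    by metis
  obtain Y where Y: "Y \<subseteq> L" "finite Y" "L \<subseteq> (\<Union>y\<in>Y. W y)"
    by (rule compactE_image[OF L, of L W]) (use VW in auto)
  show ?thesis
  proof (intro exI[of _ "\<Inter>y\<in>Y. V y"] conjI ballI)
    show "open (\<Inter>y\<in>Y. V y)" using Y VW by (intro open_INT) blast+
    show "x \<in> (\<Inter>y\<in>Y. V y)" using VW by blast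
    fix x' y assume "x' \<in> (\<Inter>y\<in>Y. V y)" "y \<in> L"
    moreover from this obtain z where "z \<in> Y" "y \<in> W z" using Y by blast
    ultimately show "dist (F (x', y)) (F (x, y)) < e" using VW by blast
  qed
qed

text \<open>A finite subcover made disjoint, with each piece still attached to the point whose
  neighbourhood contains it, as tagged Riemann sums require.\<close>

lemma compact_borel_partition:
  fixes K :: "'a::t2_space set"
  assumes K: "compact K" and V: "\<And>x. x \<in> K \<Longrightarrow> open (V x) \<and> x \<in> V x"
  obtains X A where "finite X" "X \<subseteq> K" "\<And>x. x \<in> X \<Longrightarrow> A x \<in> sets borel" "\<And>x. x \<in> X \<Longrightarrow> A x \<subseteq> V x"
    "disjoint_family_on A X" "(\<Union>x\<in>X. A x) = K"
proof -
  obtain X where X: "X \<subseteq> K" "finite X" "K \<subseteq> (\<Union>x\<in>X. V x)"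
    by (rule compactE_image[OF K, of K V]) (use V in auto)
  have "\<exists>A. (\<forall>x\<in>X. A x \<in> sets borel \<and> A x \<subseteq> V x) \<and> disjoint_family_on A X \<and> (\<Union>x\<in>X. A x) = K \<inter> (\<Union>x\<in>X. V x)"
    using X(2) X(1)
  proof (induction X rule: finite_induct)
    case empty
    then show ?case by (auto simp: disjoint_family_on_def)
  next
    case (insert y X)
    then obtain A where A: "\<forall>x\<in>X. A x \<in> sets borel \<and> A x \<subseteq> V x" "disjoint_family_on A X"
      "(\<Union>x\<in>X. A x) = K \<inter> (\<Union>x\<in>X. V x)" by auto
    let ?A = "A(y := K \<inter> V y - (\<Union>x\<in>X. V x))"
    have "K \<in> sets borel" using K by (simp add: borel_compact)
    moreover have "V x \<in> sets borel" if "x \<in> insert y X" for x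
      using V insert.prems that by (intro borel_open) auto
    ultimately have "K \<inter> V y - (\<Union>x\<in>X. V x) \<in> sets borel"
      using insert.hyps by (intro sets.Diff sets.Int sets.finite_UN) auto
    moreover have "disjoint_family_on ?A (insert y X)"
    proof -
      have "A x \<inter> (K \<inter> V y - (\<Union>x\<in>X. V x)) = {}" if "x \<in> X" for x
        using A(1) that by blast
      moreover have "(K \<inter> V y - (\<Union>x\<in>X. V x)) \<inter> A x = {}" if "x \<in> X" for x
        using A(1) that by blast
      ultimately show ?thesis
        using A(2) insert.hyps unfolding disjoint_family_on_def by simp
    qed
    moreover have "(\<Union>x\<in>insert y X. ?A x) = K \<inter> (\<Union>x\<in>insert y X. V x)"
    proof -
      have "(\<Union>x\<in>insert y X. ?A x) = (K \<inter> V y - (\<Union>x\<in>X. V x)) \<union> (\<Union>x\<in>X. A x)"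
        using insert.hyps by auto
      then show ?thesis using A(3) by auto
    qed
    moreover have "\<forall>x\<in>insert y X. ?A x \<in> sets borel \<and> ?A x \<subseteq> V x"
      using A(1) calculation(1) by auto
    ultimately show ?case
      by blast
  qed
  then show thesis using X that by (metis inf.absorb1)
qed

lemma compact_plus:
  fixes K L :: "'g::topological_group_add set"
  assumes "compact K" "compact L"
  shows "compact ((\<lambda>(x, y). x + y) ` (K \<times> L))"
  by (intro compact_continuous_image compact_Times assms) (auto simp: case_prod_beta intro!: continuous_intros)

lemma compact_uminus:
  fixes K :: "'g::topological_group_add set"
  assumes "compact K"
  shows "compact (uminus ` K)"
  by (intro compact_continuous_image assms) (auto intro!: continuous_intros)

lemma add_nbhd:
  fixes x y :: "'g::topological_group_add"
  assumes "open W" "x + y \<in> W"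
  obtains U V where "open U" "open V" "x \<in> U" "y \<in> V" "\<And>u v. u \<in> U \<Longrightarrow> v \<in> V \<Longrightarrow> u + v \<in> W"
proof -
  have "open ((\<lambda>z::'g\<times>'g. fst z + snd z) -` W)"
    by (rule open_vimage[OF assms(1)]) (auto intro!: continuous_intros)
  moreover have "(x, y) \<in> ((\<lambda>z::'g\<times>'g. fst z + snd z) -` W)" using assms by simp
  ultimately obtain U V where "open U" "open V" "(x, y) \<in> U \<times> V" "U \<times> V \<subseteq> ((\<lambda>z::'g\<times>'g. fst z + snd z) -` W)"
    by (rule open_prod_elim)
  then show thesis using that[of U V] by (auto simp: subset_iff)
qed

lemma diff_nbhd:
  fixes W :: "'g::topological_group_add set"
  assumes "open W" "0 \<in> W"
  obtains V where "open V" "0 \<in> V" "\<And>u v. u \<in> V \<Longrightarrow> v \<in> V \<Longrightarrow> u - v \<in> W"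
proof -
  have "0 + 0 \<in> W" using assms by simp
  then obtain U V where UV: "open U" "open V" "0 \<in> U" "0 \<in> V" "\<And>u v. u \<in> U \<Longrightarrow> v \<in> V \<Longrightarrow> u + v \<in> W"
    using add_nbhd[OF assms(1)] by metis
  have "open (uminus -` V)" by (rule open_vimage[OF UV(2)]) (auto intro!: continuous_intros)
  then show thesis
    using UV that[of "U \<inter> uminus -` V"] by (auto simp: open_Int diff_conv_add_uminus simp del: add_uminus_conv_diff)
qed

subsection \<open>Integration of compactly supported functions\<close>

definition Cc :: "('a::topological_space \<Rightarrow> complex) set" where
  "Cc = {k. continuous_on UNIV k \<and> (\<exists>K. compact K \<and> (\<forall>x. x \<notin> K \<longrightarrow> k x = 0))}"

text \<open>Isolates what the integration theory of this section uses, so that it applies to two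
  different Haar measures at once.\<close>

definition finite_on_compacts :: "'a::topological_space measure \<Rightarrow> bool" where
  "finite_on_compacts N \<longleftrightarrow> sets N = sets borel \<and> (\<forall>K. compact K \<longrightarrow> emeasure N K < \<infinity>)"

lemma Cc_bounded:
  fixes k :: "'a::topological_space \<Rightarrow> complex"
  assumes "k \<in> Cc"
  obtains B where "0 < B" "\<And>x. norm (k x) \<le> B"
proof -
  obtain K where K: "continuous_on UNIV k" "compact K" "\<And>x. x \<notin> K \<Longrightarrow> k x = 0"
    using assms by (auto simp: Cc_def)
  have "bounded (k ` K)"
    using K by (intro compact_imp_bounded compact_continuous_image continuous_on_subset[OF K(1)]) auto
  then obtain B where B: "0 < B" "\<And>x. x \<in> K \<Longrightarrow> norm (k x) \<le> B"
    unfolding bounded_pos by auto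
  then show thesis using that[of B] K(3) by (metis less_imp_le norm_zero)
qed

lemma Cc_measurable: "k \<in> Cc \<Longrightarrow> k \<in> borel_measurable borel"
  by (auto simp: Cc_def intro: borel_measurable_continuous_onI)

lemma Cc_of_real:
  fixes k :: "'a::topological_space \<Rightarrow> real"
  assumes "continuous_on UNIV k" "compact K" "\<And>x. x \<notin> K \<Longrightarrow> k x = 0"
  shows "(\<lambda>x. complex_of_real (k x)) \<in> Cc"
  using assms by (auto simp: Cc_def intro!: continuous_intros)

lemma Cc_mult:
  assumes "k \<in> Cc" "continuous_on UNIV g" shows "(\<lambda>x. k x * g x) \<in> Cc"
  using assms by (auto simp: Cc_def intro!: continuous_intros)

lemma Cc_add:
  fixes k g :: "'a::topological_space \<Rightarrow> complex"
  assumes "k \<in> Cc" "g \<in> Cc" shows "(\<lambda>x. k x + g x) \<in> Cc"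
proof -
  obtain K L where "continuous_on UNIV k" "continuous_on UNIV g" "compact K" "compact L"
    "\<And>x. x \<notin> K \<Longrightarrow> k x = 0" "\<And>x. x \<notin> L \<Longrightarrow> g x = 0"
    using assms by (auto simp: Cc_def)
  then show ?thesis unfolding Cc_def
    by (intro CollectI conjI exI[of _ "K \<union> L"]) (auto intro!: continuous_intros)
qed

lemma Cc_homeo:
  fixes k :: "'b::t2_space \<Rightarrow> complex" and f :: "'a::topological_space \<Rightarrow> 'b"
  assumes k: "k \<in> Cc" and f: "continuous_on UNIV f" and g: "continuous_on UNIV g" and gf: "\<And>x. g (f x) = x"
  shows "(\<lambda>x. k (f x)) \<in> Cc"
proof -
  obtain K where K: "continuous_on UNIV k" "compact K" "\<And>x. x \<notin> K \<Longrightarrow> k x = 0"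
    using k by (auto simp: Cc_def)
  have "compact (g ` K)" by (intro compact_continuous_image continuous_on_subset[OF g] K) auto
  moreover have "k (f x) = 0" if "x \<notin> g ` K" for x using that K(3) gf by (metis imageI)
  moreover have "continuous_on UNIV (\<lambda>x. k (f x))"
    by (rule continuous_on_compose2[OF K(1) f]) auto
  ultimately show ?thesis unfolding Cc_def by auto
qed

lemma Cc_translate_left:
  fixes k :: "'g::{topological_group_add,t2_space} \<Rightarrow> complex"
  shows "k \<in> Cc \<Longrightarrow> (\<lambda>y. k (t + y)) \<in> Cc"
  by (rule Cc_homeo[where g = "\<lambda>y. - t + y"]) (auto intro!: continuous_intros simp: add.assoc[symmetric])

lemma Cc_uminus:
  fixes k :: "'g::{topological_group_add,t2_space} \<Rightarrow> complex"
  shows "k \<in> Cc \<Longrightarrow> (\<lambda>y. k (- y)) \<in> Cc"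
  by (rule Cc_homeo[where g = uminus]) (auto intro!: continuous_intros)

lemma borel_measurable_continuous_compose:
  assumes "f \<in> borel_measurable borel" "continuous_on UNIV g"
  shows "(\<lambda>x. f (g x)) \<in> borel_measurable borel"
  using measurable_compose[OF borel_measurable_continuous_onI[OF assms(2)] assms(1)] .

lemma integrable_compact_support:
  fixes f :: "'a::t2_space \<Rightarrow> 'b::{banach,second_countable_topology}"
  assumes N: "finite_on_compacts N" and f: "f \<in> borel_measurable borel" and K: "compact K"
    and B: "\<And>x. x \<in> K \<Longrightarrow> norm (f x) \<le> B" and z: "\<And>x. x \<notin> K \<Longrightarrow> f x = 0"
  shows "integrable N f"
proof (rule integrableI_bounded_set[where A = K and B = B])
  have s: "sets N = sets borel" using N by (simp add: finite_on_compacts_def)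
  show "K \<in> sets N" using K s by (simp add: borel_compact)
  show "f \<in> borel_measurable N" using f s by (simp cong: measurable_cong_sets)
  show "emeasure N K < \<infinity>" using N K by (simp add: finite_on_compacts_def)
qed (use B z in auto)

lemma Cc_integrable:
  fixes k :: "'a::t2_space \<Rightarrow> complex"
  assumes "finite_on_compacts N" "k \<in> Cc" shows "integrable N k"
proof -
  obtain K where "compact K" "\<And>x. x \<notin> K \<Longrightarrow> k x = 0"
    using assms by (auto simp: Cc_def)
  then show ?thesis
    using integrable_compact_support[OF assms(1) Cc_measurable[OF assms(2)]] Cc_bounded[OF assms(2)]
    by metis
qed

lemma norm_lebesgue_integral_le:
  fixes f :: "'a \<Rightarrow> 'b::{banach,second_countable_topology}"
  assumes "integrable M f" "integrable M g" "\<And>x. norm (f x) \<le> g x"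
  shows "norm (\<integral>x. f x \<partial>M) \<le> (\<integral>x. g x \<partial>M)"
  by (rule order_trans[OF integral_norm_bound integral_mono]) (use assms in auto)

lemma norm_indicator_complex: "norm (indicator A x :: complex) = indicator A x"
  by (simp add: indicator_def)

lemma integrable_indicator_mult:
  fixes f :: "'a \<Rightarrow> complex"
  assumes "A \<in> sets N" "integrable N f"
  shows "integrable N (\<lambda>x. indicator A x * f x)"
proof -
  have "(\<lambda>x. indicator A x *\<^sub>R f x) = (\<lambda>x. indicator A x * f x)" by (auto simp: indicator_def)
  then show ?thesis using integrable_mult_indicator[OF assms] by simp
qed

text \<open>The pieces are disjoint, so on \<open>A x\<close> the integrand of the sum collapses to
  f x' * G x, and the pointwise error is at most d * norm (f x').\<close>

lemma riemann_sum_bound: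
  fixes f F :: "'a::t2_space \<Rightarrow> complex"
  assumes s: "sets N = sets borel" and f: "integrable N f" and fF: "integrable N (\<lambda>x. f x * F x)"
    and z: "\<And>x. x \<notin> K \<Longrightarrow> f x = 0"
    and X: "finite X" and A: "\<And>x. x \<in> X \<Longrightarrow> A x \<in> sets borel"
    and dj: "disjoint_family_on A X" and U: "(\<Union>x\<in>X. A x) = K"
    and d: "\<And>x x'. x \<in> X \<Longrightarrow> x' \<in> A x \<Longrightarrow> norm (F x' - G x) \<le> d"
  shows "norm ((\<integral>x. f x * F x \<partial>N) - (\<Sum>x\<in>X. (\<integral>x'. indicator (A x) x' * f x' \<partial>N) * G x)) \<le> d * (\<integral>x. norm (f x) \<partial>N)"
proof -
  have int: "integrable N (\<lambda>x'. indicator (A x) x' * f x' * G x)" if "x \<in> X" for x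
    using f A[OF that] s by (intro integrable_mult_left integrable_indicator_mult) auto
  have eq: "(\<Sum>x\<in>X. (\<integral>x'. indicator (A x) x' * f x' \<partial>N) * G x) = (\<integral>x'. (\<Sum>x\<in>X. indicator (A x) x' * f x' * G x) \<partial>N)"
  proof (subst Bochner_Integration.integral_sum)
    show "integrable N (\<lambda>x'. indicator (A x) x' * f x' * G x)" if "x \<in> X" for x by (rule int[OF that])
    show "(\<Sum>x\<in>X. (\<integral>x'. indicator (A x) x' * f x' \<partial>N) * G x) = (\<Sum>x\<in>X. (\<integral>x'. indicator (A x) x' * f x' * G x \<partial>N))"
      by (intro sum.cong refl integral_mult_left_zero[symmetric])
  qed
  have le: "norm (f x' * F x' - (\<Sum>x\<in>X. indicator (A x) x' * f x' * G x)) \<le> d * norm (f x')" for x'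
  proof (cases "x' \<in> K")
    case True
    then obtain y where y: "y \<in> X" "x' \<in> A y" using U by blast
    have "indicator (A x) x' = (if x = y then 1 else 0 :: complex)" if "x \<in> X" for x
      using dj y that by (auto simp: disjoint_family_on_def indicator_def)
    then have "(\<Sum>x\<in>X. indicator (A x) x' * f x' * G x) = (\<Sum>x\<in>X. if x = y then f x' * G y else 0)"
      by (intro sum.cong) auto
    also have "\<dots> = f x' * G y" using X y by simp
    finally have "norm (f x' * F x' - (\<Sum>x\<in>X. indicator (A x) x' * f x' * G x)) = norm (f x') * norm (F x' - G y)"
      by (simp add: norm_mult[symmetric] right_diff_distrib)
    also have "\<dots> \<le> norm (f x') * d" using d[OF y] by (intro mult_left_mono) auto
    finally show ?thesis by (simp add: mult.commute)
  qed (simp add: z)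
  have "norm ((\<integral>x. f x * F x \<partial>N) - (\<Sum>x\<in>X. (\<integral>x'. indicator (A x) x' * f x' \<partial>N) * G x))
    = norm (\<integral>x'. f x' * F x' - (\<Sum>x\<in>X. indicator (A x) x' * f x' * G x) \<partial>N)"
    unfolding eq by (subst Bochner_Integration.integral_diff) (auto intro!: fF Bochner_Integration.integrable_sum int)
  also have "\<dots> \<le> (\<integral>x. d * norm (f x) \<partial>N)"
    by (intro norm_lebesgue_integral_le le integrable_mult_right integrable_norm f Bochner_Integration.integrable_diff fF
        Bochner_Integration.integrable_sum int)
  finally show ?thesis by simp
qed

lemma integrable_mult_continuous:
  fixes h g :: "'a::t2_space \<Rightarrow> complex"
  assumes N: "finite_on_compacts N" and L: "compact L" and h: "integrable N (\<lambda>y. indicator L y * h y)"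
    and g: "continuous_on UNIV g" and z: "\<And>y. y \<notin> L \<Longrightarrow> g y = 0"
  shows "integrable N (\<lambda>y. h y * g y)"
proof -
  obtain B where B: "0 < B" "\<And>x. norm (g x) \<le> B"
    using Cc_bounded[of g] g z L unfolding Cc_def by blast
  have "g \<in> borel_measurable N"
    using borel_measurable_continuous_onI[OF g] N by (simp add: finite_on_compacts_def cong: measurable_cong_sets)
  then have "integrable N (\<lambda>y. (indicator L y * h y) * g y)"
    using h B by (intro Bochner_Integration.integrable_bound[OF integrable_mult_left[OF integrable_norm[OF h], of B]])
      (auto simp: norm_mult intro!: mult_left_mono AE_I2)
  moreover have "(indicator L y * h y) * g y = h y * g y" for y using z by (auto simp: indicator_def)
  ultimately show ?thesis by simp
qed

text \<open>The compact set L has to serve only for x in the open set V, because the support of a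
  convolution kernel moves with x. Closeness on L comes from \<open>tube_dist\<close>; B + 1 in the
  tolerance avoids a division by zero.\<close>

lemma continuous_param_integral:
  fixes F :: "'a::t2_space \<times> 'b::t2_space \<Rightarrow> complex" and h :: "'b \<Rightarrow> complex"
  assumes N: "finite_on_compacts N" and F: "continuous_on UNIV F" and L: "compact L"
    and V: "open V" and z: "\<And>x y. x \<in> V \<Longrightarrow> y \<notin> L \<Longrightarrow> F (x, y) = 0"
    and h: "integrable N (\<lambda>y. indicator L y * h y)"
  shows "continuous_on V (\<lambda>x. \<integral>y. h y * F (x, y) \<partial>N)"
proof -
  define B where "B = (\<integral>y. norm (indicator L y * h y) \<partial>N)"
  have B: "0 \<le> B" by (simp add: B_def)
  have Fx: "continuous_on UNIV (\<lambda>y. F (x, y))" for x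
    by (rule continuous_on_compose2[OF F]) (auto intro!: continuous_intros)
  have int: "integrable N (\<lambda>y. h y * F (x, y))" if "x \<in> V" for x
    by (rule integrable_mult_continuous[OF N L h Fx]) (use z that in auto)
  have "isCont (\<lambda>x. \<integral>y. h y * F (x, y) \<partial>N) x" if x: "x \<in> V" for x
    unfolding isCont_def
  proof (rule tendstoI)
    fix e :: real assume e: "0 < e"
    then have "0 < e / (B + 1)" using B by simp
    then obtain W where W: "open W" "x \<in> W" "\<And>x' y. x' \<in> W \<Longrightarrow> y \<in> L \<Longrightarrow> dist (F (x', y)) (F (x, y)) < e / (B+1)"
      using tube_dist[OF F L, of _ x] by metis
    have "dist (\<integral>y. h y * F (x', y) \<partial>N) (\<integral>y. h y * F (x, y) \<partial>N) < e" if x': "x' \<in> W \<inter> V" for x'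
    proof -
      have "norm ((\<integral>y. h y * F (x', y) \<partial>N) - (\<integral>y. h y * F (x, y) \<partial>N)) = norm (\<integral>y. h y * F (x', y) - h y * F (x, y) \<partial>N)"
        using int x x' by (subst Bochner_Integration.integral_diff) auto
      also have "\<dots> \<le> (\<integral>y. norm (indicator L y * h y) * (e/(B+1)) \<partial>N)"
      proof (intro norm_lebesgue_integral_le Bochner_Integration.integrable_diff integrable_mult_left integrable_norm h)
        fix y
        show "norm (h y * F (x', y) - h y * F (x, y)) \<le> norm (indicator L y * h y) * (e/(B+1))"
        proof (cases "y \<in> L")
          case True
          then have "norm (h y) * norm (F (x', y) - F (x, y)) \<le> norm (h y) * (e/(B+1))"
            using W(3)[of x' y] x' by (intro mult_left_mono) (auto simp: dist_norm)
          then show ?thesis using True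
            by (simp add: right_diff_distrib[symmetric] norm_mult)
        qed (use z x x' in auto)
      qed (use int x x' in auto)
      also have "\<dots> = B * (e/(B+1))" by (simp add: B_def)
      also have "\<dots> < e" using B e by (simp add: field_simps)
      finally show ?thesis by (simp add: dist_norm)
    qed
    then show "\<forall>\<^sub>F x' in at x. dist (\<integral>y. h y * F (x', y) \<partial>N) (\<integral>y. h y * F (x, y) \<partial>N) < e"
      unfolding eventually_at_topological using W V x by (intro exI[of _ "W \<inter> V"]) auto
  qed
  then show ?thesis by (simp add: continuous_at_imp_continuous_on)
qed

lemma Fubini_Cc:
  fixes F :: "'a::t2_space \<times> 'b::t2_space \<Rightarrow> complex"
  assumes M: "finite_on_compacts M" and N: "finite_on_compacts N" and F: "continuous_on UNIV F"
    and K: "compact K" and L: "compact L" and zK: "\<And>x y. x \<notin> K \<Longrightarrow> F (x, y) = 0"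
    and zL: "\<And>x y. y \<notin> L \<Longrightarrow> F (x, y) = 0"
  shows "(\<integral>x. \<integral>y. F (x, y) \<partial>N \<partial>M) = (\<integral>y. \<integral>x. F (x, y) \<partial>M \<partial>N)"
proof -
  have sM: "sets M = sets borel" and sN: "sets N = sets borel" using M N by (auto simp: finite_on_compacts_def)
  have KM: "K \<in> sets M" "L \<in> sets N" using K L sM sN by (auto simp: borel_compact)
  have fin: "emeasure M K < \<infinity>" "emeasure N L < \<infinity>" using M N K L by (auto simp: finite_on_compacts_def)
  have i1: "integrable M (indicator K :: 'a \<Rightarrow> complex)" "integrable N (indicator L :: 'b \<Rightarrow> complex)"
    using KM sM sN by (auto intro!: integrable_compact_support[OF M _ K, of _ 1] integrable_compact_support[OF N _ L, of _ 1])
  have "continuous_on UNIV (\<lambda>z. F (snd z, fst z))"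
    by (rule continuous_on_compose2[OF F]) (auto intro!: continuous_intros)
  then have F': "continuous_on UNIV (\<lambda>(y, x). F (x, y))" by (simp add: case_prod_beta)
  have i1': "integrable M (\<lambda>y. indicator K y * (1::complex))" "integrable N (\<lambda>y. indicator L y * (1::complex))"
    using i1 by auto
  have c1: "continuous_on UNIV (\<lambda>x. \<integral>y. F (x, y) \<partial>N)"
    using continuous_param_integral[OF N F L open_UNIV zL i1'(2)] by simp
  have c2: "continuous_on UNIV (\<lambda>y. \<integral>x. F (x, y) \<partial>M)"
    using continuous_param_integral[OF M F' K open_UNIV _ i1'(1)] zK by simp
  have Cx: "(\<lambda>y. F (x, y)) \<in> Cc" for x
  proof -
    have "continuous_on UNIV (\<lambda>y. F (x, y))"
      by (rule continuous_on_compose2[OF F]) (auto intro!: continuous_intros)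
    then show ?thesis using L zL unfolding Cc_def by blast
  qed
  have Cy: "(\<lambda>x. F (x, y)) \<in> Cc" for y
  proof -
    have "continuous_on UNIV (\<lambda>x. F (x, y))"
      by (rule continuous_on_compose2[OF F]) (auto intro!: continuous_intros)
    then show ?thesis using K zK unfolding Cc_def by blast
  qed
  have C1: "(\<lambda>x. \<integral>y. F (x, y) \<partial>N) \<in> Cc" using c1 K zK unfolding Cc_def by (auto intro!: exI[of _ K])
  have C2: "(\<lambda>y. \<integral>x. F (x, y) \<partial>M) \<in> Cc" using c2 L zL unfolding Cc_def by (auto intro!: exI[of _ L])
  define m n where "m = measure M K" and "n = measure N L"
  have ind: "(\<integral>x. norm (indicator K x :: complex) \<partial>M) = m" "(\<integral>x. norm (indicator L x :: complex) \<partial>N) = n"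
    using KM fin sM sN by (simp_all add: m_def n_def norm_indicator_complex sets_eq_imp_space_eq[OF sM] sets_eq_imp_space_eq[OF sN])
  have mn: "0 \<le> m" "0 \<le> n" by (auto simp: m_def n_def)
  have "dist (\<integral>x. \<integral>y. F (x, y) \<partial>N \<partial>M) (\<integral>y. \<integral>x. F (x, y) \<partial>M \<partial>N) \<le> e * (2 * m * n)" if e: "0 < e" for e
  proof -
    have "\<exists>V. open V \<and> x \<in> V \<and> (\<forall>x'\<in>V. \<forall>y\<in>L. dist (F (x', y)) (F (x, y)) < e)" for x
      using tube_dist[OF F L e, of x] .
    then obtain V where V: "\<And>x. open (V x) \<and> x \<in> V x" "\<And>x x' y. x' \<in> V x \<Longrightarrow> y \<in> L \<Longrightarrow> dist (F (x', y)) (F (x, y)) < e"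
      by metis
    obtain X A where XA: "finite X" "X \<subseteq> K" "\<And>x. x \<in> X \<Longrightarrow> A x \<in> sets borel" "\<And>x. x \<in> X \<Longrightarrow> A x \<subseteq> V x"
      "disjoint_family_on A X" "(\<Union>x\<in>X. A x) = K"
      using compact_borel_partition[OF K, of V] V(1) by metis
    define c where "c x = (\<integral>x'. indicator (A x) x' * indicator K x' \<partial>M :: complex)" for x
    have e1: "norm (F (x', y) - F (x, y)) \<le> e" if "x \<in> X" "x' \<in> A x" for x x' y
    proof (cases "y \<in> L")
      case True then show ?thesis using V(2)[of x' x y] XA(4)[OF that(1)] that by (auto simp: dist_norm)
    qed (use zL e in auto)
    have r1: "norm ((\<integral>x. F (x, y) \<partial>M) - (\<Sum>x\<in>X. c x * F (x, y))) \<le> e * m * norm (indicator L y :: complex)" for y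
    proof (cases "y \<in> L")
      case True
      have "(\<lambda>x. indicator K x * F (x, y)) = (\<lambda>x. F (x, y))"
        using zK by (auto simp: indicator_def fun_eq_iff)
      then show ?thesis
        using riemann_sum_bound[OF sM i1(1) _ _ XA(1,3,5,6), of "\<lambda>x. F (x, y)" "\<lambda>x. F (x, y)" e] e1 True
          Cc_integrable[OF M Cy[of y]] by (simp add: c_def ind)
    qed (use zL in auto)
    have e2: "norm ((\<integral>y. F (x', y) \<partial>N) - (\<integral>y. F (x, y) \<partial>N)) \<le> e * n" if "x \<in> X" "x' \<in> A x" for x x'
    proof -
      have "norm ((\<integral>y. F (x', y) \<partial>N) - (\<integral>y. F (x, y) \<partial>N)) = norm (\<integral>y. F (x', y) - F (x, y) \<partial>N)"
        using Cc_integrable[OF N Cx] by (subst Bochner_Integration.integral_diff) auto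
      also have "\<dots> \<le> (\<integral>y. e * norm (indicator L y :: complex) \<partial>N)"
      proof (intro norm_lebesgue_integral_le Bochner_Integration.integrable_diff integrable_mult_right integrable_norm i1 Cc_integrable[OF N Cx])
        show "norm (F (x', y) - F (x, y)) \<le> e * norm (indicator L y :: complex)" for y
          using e1[OF that, of y] zL by (cases "y \<in> L") auto
      qed
      also have "\<dots> = e * n" using ind by simp
      finally show ?thesis .
    qed
    have r2: "norm ((\<integral>x. \<integral>y. F (x, y) \<partial>N \<partial>M) - (\<Sum>x\<in>X. c x * (\<integral>y. F (x, y) \<partial>N))) \<le> e * n * m"
    proof -
      have "(\<lambda>x. indicator K x * (\<integral>y. F (x, y) \<partial>N)) = (\<lambda>x. \<integral>y. F (x, y) \<partial>N)"
        using zK by (auto simp: indicator_def fun_eq_iff)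
      then show ?thesis
        using riemann_sum_bound[OF sM i1(1) _ _ XA(1,3,5,6), of "\<lambda>x. \<integral>y. F (x, y) \<partial>N" "\<lambda>x. \<integral>y. F (x, y) \<partial>N" "e*n"] e2
          Cc_integrable[OF M C1] by (simp add: c_def ind)
    qed
    have "(\<Sum>x\<in>X. c x * (\<integral>y. F (x, y) \<partial>N)) = (\<integral>y. (\<Sum>x\<in>X. c x * F (x, y)) \<partial>N)"
      by (subst Bochner_Integration.integral_sum) (auto intro!: integrable_mult_right Cc_integrable[OF N Cx])
    then have "norm ((\<integral>y. \<integral>x. F (x, y) \<partial>M \<partial>N) - (\<Sum>x\<in>X. c x * (\<integral>y. F (x, y) \<partial>N)))
       = norm (\<integral>y. (\<integral>x. F (x, y) \<partial>M) - (\<Sum>x\<in>X. c x * F (x, y)) \<partial>N)"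
      by (simp, subst Bochner_Integration.integral_diff)
        (auto intro!: Bochner_Integration.integrable_sum integrable_mult_right Cc_integrable[OF N Cx] Cc_integrable[OF N C2])
    also have "\<dots> \<le> (\<integral>y. e * m * norm (indicator L y :: complex) \<partial>N)"
      by (intro norm_lebesgue_integral_le Bochner_Integration.integrable_diff Bochner_Integration.integrable_sum
          integrable_mult_right integrable_norm i1 Cc_integrable[OF N Cx] Cc_integrable[OF N C2] r1)
    also have "\<dots> = e * m * n" using ind by simp
    finally have r3: "norm ((\<integral>y. \<integral>x. F (x, y) \<partial>M \<partial>N) - (\<Sum>x\<in>X. c x * (\<integral>y. F (x, y) \<partial>N))) \<le> e * m * n" .
    have "dist (\<integral>x. \<integral>y. F (x, y) \<partial>N \<partial>M) (\<integral>y. \<integral>x. F (x, y) \<partial>M \<partial>N) \<le> e * n * m + e * m * n"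
      using dist_triangle2[of _ _ "\<Sum>x\<in>X. c x * (\<integral>y. F (x, y) \<partial>N)"] r2 r3
      unfolding dist_norm by (meson add_mono order_trans)
    then show ?thesis by (simp add: algebra_simps)
  qed
  then have le: "dist (\<integral>x. \<integral>y. F (x, y) \<partial>N \<partial>M) (\<integral>y. \<integral>x. F (x, y) \<partial>M \<partial>N) \<le> e" if "0 < e" for e
  proof -
    have q: "0 \<le> 2 * m * n" using mn by simp
    then have "0 < e / (2 * m * n + 1)" using that by (intro divide_pos_pos) auto
    moreover have "e / (2 * m * n + 1) * (2 * m * n) \<le> e"
      using that q mult_left_mono[of "2*m*n" "2*m*n+1" e] by (simp add: divide_le_eq)
    ultimately show ?thesis
      using \<open>\<And>e. 0 < e \<Longrightarrow> dist _ _ \<le> e * (2 * m * n)\<close> by (meson order_trans)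
  qed
  have "dist (\<integral>x. \<integral>y. F (x, y) \<partial>N \<partial>M) (\<integral>y. \<integral>x. F (x, y) \<partial>M \<partial>N) \<le> 0"
    by (rule field_le_epsilon) (use le in simp)
  then show ?thesis by simp
qed

lemma Cc_prod_supports:
  fixes F :: "'a::topological_space \<times> 'b::topological_space \<Rightarrow> complex"
  assumes "F \<in> Cc"
  shows "\<exists>K L. compact K \<and> compact L \<and> (\<forall>x y. x \<notin> K \<longrightarrow> F (x, y) = 0) \<and> (\<forall>x y. y \<notin> L \<longrightarrow> F (x, y) = 0)"
proof -
  obtain Q where Q: "compact Q" "\<And>z. z \<notin> Q \<Longrightarrow> F z = 0" using assms by (auto simp: Cc_def)
  have "compact (fst ` Q)" "compact (snd ` Q)"
    by (auto intro!: compact_continuous_image Q continuous_intros)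
  moreover have "F (x, y) = 0" if "x \<notin> fst ` Q" for x y using that Q(2) by force
  moreover have "F (x, y) = 0" if "y \<notin> snd ` Q" for x y using that Q(2) by force
  ultimately show ?thesis by meson
qed

lemma Fubini_Cc_prod:
  fixes F :: "'a::t2_space \<times> 'b::t2_space \<Rightarrow> complex"
  assumes "finite_on_compacts M" "finite_on_compacts N" "F \<in> Cc"
  shows "(\<integral>x. \<integral>y. F (x, y) \<partial>N \<partial>M) = (\<integral>y. \<integral>x. F (x, y) \<partial>M \<partial>N)"
proof -
  obtain K L where KL: "compact K" "compact L" "\<And>x y. x \<notin> K \<Longrightarrow> F (x, y) = 0" "\<And>x y. y \<notin> L \<Longrightarrow> F (x, y) = 0"
    using Cc_prod_supports[OF assms(3)] by metis
  have F: "continuous_on UNIV F" using assms by (auto simp: Cc_def)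
  show ?thesis by (rule Fubini_Cc[OF assms(1,2) F KL(1,2)]) (use KL(3,4) in auto)
qed

lemma Cc_section:
  fixes F :: "'a::topological_space \<times> 'b::topological_space \<Rightarrow> complex"
  assumes "F \<in> Cc" shows "(\<lambda>x. F (x, y)) \<in> Cc"
proof -
  obtain K where "compact K" "\<And>x y. x \<notin> K \<Longrightarrow> F (x, y) = 0"
    using Cc_prod_supports[OF assms] by metis
  moreover have "continuous_on UNIV (\<lambda>x. F (x, y))"
    by (rule continuous_on_compose2[of UNIV F]) (use assms in \<open>auto simp: Cc_def intro!: continuous_intros\<close>)
  ultimately show ?thesis by (auto simp: Cc_def)
qed

lemma Cc_integral_section:
  fixes F :: "'a::t2_space \<times> 'b::t2_space \<Rightarrow> complex"
  assumes M: "finite_on_compacts M" and F: "F \<in> Cc" shows "(\<lambda>y. \<integral>x. F (x, y) \<partial>M) \<in> Cc"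
proof -
  obtain K L where KL: "compact K" "compact L" "\<And>x y. x \<notin> K \<Longrightarrow> F (x, y) = 0" "\<And>x y. y \<notin> L \<Longrightarrow> F (x, y) = 0"
    using Cc_prod_supports[OF F] by metis
  have "continuous_on UNIV (\<lambda>z. F (snd z, fst z))"
    by (rule continuous_on_compose2[of UNIV F]) (use F in \<open>auto simp: Cc_def intro!: continuous_intros\<close>)
  then have "continuous_on UNIV (\<lambda>y. \<integral>x. 1 * F (snd (y, x), fst (y, x)) \<partial>M)"
    by (rule continuous_param_integral[OF M _ KL(1)])
      (use KL in \<open>auto intro!: integrable_compact_support[OF M _ KL(1), of _ 1] borel_measurable_indicator simp: borel_compact\<close>)
  then show ?thesis using KL by (auto simp: Cc_def intro!: exI[of _ L])
qed

lemma Cc_tensor: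
  fixes f :: "'a::topological_space \<Rightarrow> complex" and g :: "'b::topological_space \<Rightarrow> complex"
  assumes "f \<in> Cc" "g \<in> Cc" shows "(\<lambda>z. f (fst z) * g (snd z)) \<in> Cc"
proof -
  obtain K L where KL: "continuous_on UNIV f" "continuous_on UNIV g" "compact K" "compact L"
    "\<And>x. x \<notin> K \<Longrightarrow> f x = 0" "\<And>x. x \<notin> L \<Longrightarrow> g x = 0"
    using assms by (auto simp: Cc_def)
  have "continuous_on UNIV (\<lambda>z::'a\<times>'b. f (fst z))" "continuous_on UNIV (\<lambda>z::'a\<times>'b. g (snd z))"
    by (auto intro!: continuous_on_compose2[OF KL(1)] continuous_on_compose2[OF KL(2)] continuous_intros)
  then have "continuous_on UNIV (\<lambda>z::'a\<times>'b. f (fst z) * g (snd z))" by (intro continuous_intros)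
  moreover have "compact (K \<times> L)" using KL by (intro compact_Times)
  moreover have "f (fst z) * g (snd z) = 0" if "z \<notin> K \<times> L" for z using that KL by (cases z) auto
  ultimately show ?thesis unfolding Cc_def by blast
qed

lemma Fubini_Cc_real:
  fixes F :: "'a::t2_space \<times> 'b::t2_space \<Rightarrow> real"
  assumes "finite_on_compacts M" "finite_on_compacts N" "(\<lambda>z. complex_of_real (F z)) \<in> Cc"
  shows "(\<integral>x. \<integral>y. F (x, y) \<partial>N \<partial>M) = (\<integral>y. \<integral>x. F (x, y) \<partial>M \<partial>N)"
proof -
  have "complex_of_real (\<integral>x. \<integral>y. F (x, y) \<partial>N \<partial>M) = complex_of_real (\<integral>y. \<integral>x. F (x, y) \<partial>M \<partial>N)"
    using Fubini_Cc_prod[OF assms] by simp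
  then show ?thesis using of_real_eq_iff by blast
qed

subsection \<open>Haar measure\<close>

lemma ennreal_diff_less:
  fixes a b e :: ennreal
  assumes "a < b + e" "b \<le> a" "a < top" shows "a - b < e"
  using assms by (cases a; cases b; cases e) (auto simp: ennreal_minus ennreal_less_iff top_unique simp flip: ennreal_plus)

lemma ennreal_less_add_of_diff:
  fixes a b e :: ennreal
  assumes "a - e < b" "e \<le> a" "a < top" shows "a < b + e"
  using assms by (cases a; cases b; cases e) (auto simp: ennreal_minus ennreal_less_iff simp flip: ennreal_plus)

lemma ennreal_less_add:
  fixes a e :: ennreal
  assumes "a < top" "0 < e" shows "a < a + e"
  using assms by (cases a; cases e) (auto simp: ennreal_less_iff simp flip: ennreal_plus)

lemma ennreal_le_mult_INF:
  assumes c: "0 < c" and le: "\<And>U. U \<in> S \<Longrightarrow> a \<le> ennreal c * f U"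
  shows "a \<le> ennreal c * (INF U\<in>S. f U)"
proof -
  have cc: "ennreal (1/c) * ennreal c = 1" using c by (simp flip: ennreal_mult'')
  have "ennreal (1/c) * a \<le> (INF U\<in>S. f U)"
  proof (rule INF_greatest)
    fix U assume "U \<in> S"
    then have "ennreal (1/c) * a \<le> ennreal (1/c) * (ennreal c * f U)"
      by (intro mult_left_mono le) auto
    then show "ennreal (1/c) * a \<le> f U"
      by (simp add: mult.assoc[symmetric] cc)
  qed
  then have "ennreal c * (ennreal (1/c) * a) \<le> ennreal c * (INF U\<in>S. f U)"
    by (rule mult_left_mono) simp
  then show ?thesis using cc by (simp add: mult.assoc[symmetric] mult.commute[of "ennreal c"])
qed

locale haar_group =
  fixes M :: "'g::{topological_group_add,t2_space} measure"
  assumes lc: "lc_group TYPE('g)" and haar: "haar_measure M"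
begin

lemma sets_M [simp, measurable_cong]: "sets M = sets borel"
  using haar[unfolded haar_measure_def, THEN conjunct1] .

lemma space_M [simp]: "space M = UNIV"
  using sets_eq_imp_space_eq[OF sets_M] by simp

lemma emeasure_image_plus: "A \<in> sets borel \<Longrightarrow> emeasure M ((+) x ` A) = emeasure M A"
  using haar[unfolded haar_measure_def, THEN conjunct2, THEN conjunct1] by simp

lemma finite_compact: "compact K \<Longrightarrow> emeasure M K < \<infinity>"
  using haar[unfolded haar_measure_def, THEN conjunct2, THEN conjunct2, THEN conjunct1] by simp

lemma foc: "finite_on_compacts M"
  unfolding finite_on_compacts_def using finite_compact by simp

lemma open_pos: "open U \<Longrightarrow> U \<noteq> {} \<Longrightarrow> 0 < emeasure M U"
  using haar[unfolded haar_measure_def, THEN conjunct2, THEN conjunct2, THEN conjunct2, THEN conjunct1] by simp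

lemma outer: "A \<in> sets borel \<Longrightarrow> emeasure M A = (INF U\<in>{U. open U \<and> A \<subseteq> U}. emeasure M U)"
  using haar[unfolded haar_measure_def, THEN conjunct2, THEN conjunct2, THEN conjunct2, THEN conjunct2, THEN conjunct1] by (rule bspec)

lemma inner: "open U \<Longrightarrow> emeasure M U = (SUP K\<in>{K. compact K \<and> K \<subseteq> U}. emeasure M K)"
  using haar[unfolded haar_measure_def, THEN conjunct2, THEN conjunct2, THEN conjunct2, THEN conjunct2, THEN conjunct2] by (elim allE impE)

lemma compact_sets: "compact K \<Longrightarrow> K \<in> sets M"
  by (simp add: borel_compact)

lemma measurable_plus [measurable]: "(+) x \<in> M \<rightarrow>\<^sub>M M"
  using borel_measurable_continuous_onI[of "(+) x"] by (simp cong: measurable_cong_sets add: continuous_intros)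

lemma distr_plus: "distr M M ((+) x) = M"
proof (rule measure_eqI)
  fix A assume "A \<in> sets (distr M M ((+) x))"
  then have A: "A \<in> sets borel" by simp
  have "(+) x -` A = (+) (- x) ` A"
  proof (intro set_eqI iffI)
    fix y assume "y \<in> (+) x -` A"
    then show "y \<in> (+) (- x) ` A" by (intro image_eqI[of _ _ "x + y"]) (auto simp: add.assoc[symmetric])
  qed (auto simp: add.assoc[symmetric])
  then show "emeasure (distr M M ((+) x)) A = emeasure M A"
    using A emeasure_image_plus[of A "- x"] by (simp add: emeasure_distr)
qed simp

lemma integral_plus:
  fixes f :: "'g \<Rightarrow> 'b::{banach,second_countable_topology}"
  assumes "f \<in> borel_measurable borel"
  shows "(\<integral>y. f (x + y) \<partial>M) = (\<integral>y. f y \<partial>M)"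
  using integral_distr[OF measurable_plus, of f x] assms by (simp add: distr_plus cong: measurable_cong_sets)

lemma integrable_plus:
  fixes f :: "'g \<Rightarrow> 'b::{banach,second_countable_topology}"
  assumes "integrable M f"
  shows "integrable M (\<lambda>y. f (x + y))"
  using integrable_distr[OF measurable_plus, unfolded distr_plus, OF assms] .

lemma AE_plus: "(AE y in M. P y) \<Longrightarrow> (AE y in M. P (x + y))"
  using AE_distrD[OF measurable_plus, unfolded distr_plus] .

text \<open>Inner regularity is given for open sets only. Take an open U around A with small excess,
  an open V of small measure around U - A, and a compact K nearly filling U; then K - V is compact,
  lies in A, and misses little of it.\<close>

lemma inner_regular:
  assumes A: "A \<in> sets borel" and fin: "emeasure M A < \<infinity>" and e: "0 < (e::real)"
  obtains K where "compact K" "K \<subseteq> A" "emeasure M (A - K) < e"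
proof -
  let ?e = "ennreal (e/2)"
  have e2: "0 < ?e" "?e < top" using e by auto
  have "emeasure M A < emeasure M A + ?e" using fin e2
    by (intro ennreal_less_add) auto
  then have "(INF U\<in>{U. open U \<and> A \<subseteq> U}. emeasure M U) < emeasure M A + ?e"
    using outer[OF A] by simp
  then obtain U where U: "open U" "A \<subseteq> U" "emeasure M U < emeasure M A + ?e"
    unfolding INF_less_iff by auto
  have "emeasure M A + ?e < top" using fin e2 by (simp add: less_top)
  then have Ufin: "emeasure M U < top" using U(3) by (rule less_trans[rotated])
  have "emeasure M (U - A) = emeasure M U - emeasure M A"
    using U A fin by (intro emeasure_Diff) auto
  also have "\<dots> < ?e" using U A Ufin by (intro ennreal_diff_less emeasure_mono) auto
  finally have "(INF V\<in>{V. open V \<and> U - A \<subseteq> V}. emeasure M V) < ?e"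
    using outer[of "U - A"] U A by simp
  then obtain V where V: "open V" "U - A \<subseteq> V" "emeasure M V < ?e"
    unfolding INF_less_iff by auto
  \<comment> \<open>If U itself has measure below the tolerance, subtraction in ennreal would
    truncate; the empty set serves in that case.\<close>
  obtain K where K: "compact K" "K \<subseteq> U" "emeasure M U < emeasure M K + ?e"
  proof (cases "emeasure M U < ?e")
    case True
    then show thesis using that[of "{}"] by simp
  next
    case False
    then have "emeasure M U - ?e < emeasure M U"
      using e2 Ufin order_less_le_trans[of 0 ?e "emeasure M U"] by (intro ennreal_between(1)) (auto simp: not_less)
    then have "emeasure M U - ?e < (SUP K\<in>{K. compact K \<and> K \<subseteq> U}. emeasure M K)"
      using inner[OF U(1)] by simp
    then obtain K where "compact K" "K \<subseteq> U" "emeasure M U - ?e < emeasure M K"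
      unfolding less_SUP_iff by auto
    then show thesis using that[of K] False Ufin ennreal_less_add_of_diff by simp
  qed
  show thesis
  proof (rule that[of "K - V"])
    show "compact (K - V)" using K V by (simp add: compact_diff)
    show "K - V \<subseteq> A" using K V by auto
    have "emeasure M (A - (K - V)) \<le> emeasure M ((U - K) \<union> V)"
      using U K V by (intro emeasure_mono) (auto intro!: sets.Un sets.Diff simp: borel_compact)
    also have "\<dots> \<le> emeasure M (U - K) + emeasure M V"
      using U K V by (intro emeasure_subadditive) (auto intro!: sets.Diff simp: borel_compact)
    also have "\<dots> < ?e + ?e"
    proof (rule add_strict_mono[OF _ V(3)])
      have "emeasure M (U - K) = emeasure M U - emeasure M K"
        using U K finite_compact[OF K(1)] by (intro emeasure_Diff) (auto simp: borel_compact)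
      also have "\<dots> < ?e" using K U Ufin by (intro ennreal_diff_less emeasure_mono) auto
      finally show "emeasure M (U - K) < ?e" .
    qed
    also have "\<dots> = e" using e by (simp flip: ennreal_plus)
    finally show "emeasure M (A - (K - V)) < e" .
  qed
qed

lemma outer_regular_compact:
  assumes A: "compact A" and W: "open W" "A \<subseteq> W" and e: "0 < (e::real)"
  shows "\<exists>U. open U \<and> A \<subseteq> U \<and> U \<subseteq> W \<and> emeasure M (U - A) < ennreal e"
proof -
  have As: "A \<in> sets borel" by (rule borel_compact[OF A])
  have "emeasure M A < emeasure M A + ennreal e" using finite_compact[OF A] e by (intro ennreal_less_add) auto
  then have "(INF U\<in>{U. open U \<and> A \<subseteq> U}. emeasure M U) < emeasure M A + ennreal e"
    using outer[OF As] by simp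
  then obtain U where U: "open U" "A \<subseteq> U" "emeasure M U < emeasure M A + ennreal e"
    unfolding INF_less_iff by auto
  have "emeasure M A + ennreal e < top" using finite_compact[OF A] by (simp add: less_top)
  then have Ufin: "emeasure M U < top" using U(3) by (rule less_trans[rotated])
  have "emeasure M (U \<inter> W - A) \<le> emeasure M (U - A)" using U As by (intro emeasure_mono) auto
  also have "\<dots> = emeasure M U - emeasure M A"
    using U As finite_compact[OF A] by (intro emeasure_Diff) auto
  also have "\<dots> < ennreal e" using U As Ufin by (intro ennreal_diff_less emeasure_mono) auto
  finally show ?thesis using U W by (intro exI[of _ "U \<inter> W"]) auto
qed

lemma open_AE_notin: "open W \<Longrightarrow> AE x in M. x \<notin> W \<Longrightarrow> W = {}"
  using open_pos[of W] by (subst (asm) AE_iff_measurable[where N = W]) auto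

text \<open>Substitute for sigma-finiteness: a countable union of sets of finite measure is, up to a
  null set, exhausted by countably many compact sets.\<close>

lemma compact_exhaustion:
  assumes A: "\<And>n::nat. A n \<in> sets borel" "\<And>n. emeasure M (A n) < \<infinity>"
  shows "\<exists>L. (\<forall>j::nat. compact (L j)) \<and> (\<forall>j. L j \<subseteq> (\<Union>n. A n)) \<and>
    (AE x in M. x \<in> (\<Union>n. A n) \<longrightarrow> (\<exists>j0. \<forall>j\<ge>j0. x \<in> L j))"
proof -
  have ex: "\<exists>K. compact K \<and> K \<subseteq> A n \<and> emeasure M (A n - K) < 1 / real (Suc m)" for n m
  proof -
    have "0 < 1 / real (Suc m)" by simp
    then show ?thesis using inner_regular[OF A(1)[of n] A(2)] by blast
  qed
  then obtain K where K: "\<And>n m. compact (K n m)" "\<And>n m. K n m \<subseteq> A n"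
    "\<And>n m. emeasure M (A n - K n m) < 1 / real (Suc m)"
    by metis
  define Z where "Z n = A n - (\<Union>m. K n m)" for n
  have "Z n \<in> null_sets M" for n
  proof -
    have Zs: "Z n \<in> sets M" using A K unfolding Z_def by (intro sets.Diff sets.countable_UN) (auto simp: borel_compact)
    have "emeasure M (Z n) \<le> 1 / real (Suc m)" for m
    proof -
      have "emeasure M (Z n) \<le> emeasure M (A n - K n m)"
        using A K by (intro emeasure_mono) (auto simp: Z_def borel_compact)
      then show ?thesis using K(3)[of n m] by simp
    qed
    then have "emeasure M (Z n) \<le> ennreal 0"
      by (intro LIMSEQ_le_const[OF tendsto_ennrealI[OF lim_inverse_n', THEN LIMSEQ_Suc]]) auto
    then show ?thesis using Zs by auto
  qed
  then have "AE x in M. \<forall>n. x \<notin> Z n" unfolding AE_all_countable using AE_not_in by blast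
  \<comment> \<open>Finite unions over both indices make L increasing, so a point once reached stays
    in all later sets.\<close>
  define L where "L j = (\<Union>n\<in>{..j}. \<Union>m\<in>{..j}. K n m)" for j
  show ?thesis
  proof (intro exI[of _ L] conjI allI)
    show "compact (L j)" for j unfolding L_def using K by (intro compact_UN) auto
    show "L j \<subseteq> (\<Union>n. A n)" for j unfolding L_def using K(2) by blast
    show "AE x in M. x \<in> (\<Union>n. A n) \<longrightarrow> (\<exists>j0. \<forall>j\<ge>j0. x \<in> L j)"
      using \<open>AE x in M. \<forall>n. x \<notin> Z n\<close>
    proof eventually_elim
      case (elim x)
      show ?case
      proof
        assume "x \<in> (\<Union>n. A n)"
        then obtain n where "x \<in> A n" by blast
        then obtain m where m: "x \<in> K n m" using elim by (auto simp: Z_def)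
        have "x \<in> L j" if "max n m \<le> j" for j
          unfolding L_def using m that by auto
        then show "\<exists>j0. \<forall>j\<ge>j0. x \<in> L j" by blast
      qed
    qed
  qed
qed

lemma bump_at:
  assumes U: "open U" "x \<in> U"
  shows "\<exists>(k :: 'g \<Rightarrow> real) L. continuous_on UNIV k \<and> (\<forall>x. 0 \<le> k x) \<and> (\<forall>x. k x \<le> 1) \<and>
    k x = 1 \<and> compact L \<and> L \<subseteq> U \<and> (\<forall>y. y \<notin> L \<longrightarrow> k y = 0)"
  using urysohn_bump[OF lc, of "{x}" U] U by simp

text \<open>Agreement on each compact set suffices: the open set where f and g differ, if nonempty,
  contains a nonempty open subset of a compact set, and that subset has positive measure.
  \<open>conv_T_Cc_AE\<close> provides agreement in exactly this local form.\<close>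

lemma AE_eq_continuous:
  fixes f g :: "'g \<Rightarrow> 'b::t2_space"
  assumes "continuous_on UNIV f" "continuous_on UNIV g" "\<And>K. compact K \<Longrightarrow> AE x in M. x \<in> K \<longrightarrow> f x = g x"
  shows "f = g"
proof (rule ccontr)
  assume "f \<noteq> g"
  then obtain x where x: "f x \<noteq> g x" by auto
  have op: "open {x. f x \<noteq> g x}" by (rule open_Collect_neq[OF assms(1,2)])
  then obtain V K where VK: "open V" "compact K" "x \<in> V" "V \<subseteq> K" "K \<subseteq> {x. f x \<noteq> g x}"
    using compact_nbhd_base[OF lc op, of x] x by auto
  have "AE x in M. x \<notin> V" using assms(3)[OF VK(2)] by eventually_elim (use VK in auto)
  then show False using open_AE_notin[OF VK(1)] VK(3) by blast
qed

lemma integral_bump_pos: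
  fixes k :: "'g \<Rightarrow> real"
  assumes "continuous_on UNIV k" "\<And>x. 0 \<le> k x" "0 < k x0" "integrable M k"
  shows "0 < (\<integral>x. k x \<partial>M)"
proof -
  have "\<not> (AE x in M. k x = 0)"
  proof
    assume "AE x in M. k x = 0"
    then have "k = (\<lambda>_. 0)" by (intro AE_eq_continuous) (use assms in auto)
    then show False using assms(3) by simp
  qed
  then show ?thesis
    using integral_nonneg_eq_0_iff_AE[OF assms(4)] assms(2) Bochner_Integration.integral_nonneg[of M k]
    by (simp add: less_le)
qed

text \<open>A bump between the indicators of a compact K and an open U compares N on K with M on U.
  Inner regularity of N then handles open sets and outer regularity all Borel sets. The opposite
  inequality follows by exchanging the measures.\<close>

lemma haar_le_of_Cc:
  assumes N: "haar_measure N" and c: "0 \<le> c" and eq: "\<And>f. f \<in> Cc \<Longrightarrow> (\<integral>x. f x \<partial>N) = complex_of_real c * (\<integral>x. f x \<partial>M)"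
    and A: "A \<in> sets borel"
  shows "emeasure N A \<le> ennreal c * emeasure M A"
proof -
  interpret N: haar_group N using lc N by unfold_locales
  have op: "emeasure N U \<le> ennreal c * emeasure M U" if U: "open U" for U
  proof -
    have "emeasure N K \<le> ennreal c * emeasure M U" if K: "compact K" "K \<subseteq> U" for K
    proof -
      obtain k L where k: "continuous_on UNIV k" "\<And>x. 0 \<le> k x" "\<And>x. k x \<le> 1"
        "\<And>x. x \<in> K \<Longrightarrow> k x = 1" "compact L" "L \<subseteq> U" "\<And>x. x \<notin> L \<Longrightarrow> k x = (0::real)"
        using urysohn_bump[OF lc K(1) U K(2)] by metis
      have km: "k \<in> borel_measurable borel" using k by (intro borel_measurable_continuous_onI)
      have kiN: "integrable N k" using k km by (intro integrable_compact_support[OF N.foc _ k(5), of _ 1]) auto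
      have kiM: "integrable M k" using k km by (intro integrable_compact_support[OF foc _ k(5), of _ 1]) auto
      have "complex_of_real (\<integral>x. k x \<partial>N) = complex_of_real (c * (\<integral>x. k x \<partial>M))"
        using eq[OF Cc_of_real[OF k(1,5,7)]] by simp
      then have kk: "(\<integral>x. k x \<partial>N) = c * (\<integral>x. k x \<partial>M)" using of_real_eq_iff by blast
      have "emeasure N K = (\<integral>\<^sup>+x. indicator K x \<partial>N)" using K by (simp add: borel_compact)
      also have "\<dots> \<le> (\<integral>\<^sup>+x. ennreal (k x) \<partial>N)"
        using k by (intro nn_integral_mono) (auto simp: indicator_def)
      also have "\<dots> = ennreal (\<integral>x. k x \<partial>N)" using kiN k by (intro nn_integral_eq_integral) auto
      also have "\<dots> = ennreal c * ennreal (\<integral>x. k x \<partial>M)" unfolding kk using c by (simp add: ennreal_mult')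
      also have "ennreal (\<integral>x. k x \<partial>M) = (\<integral>\<^sup>+x. ennreal (k x) \<partial>M)" using kiM k by (intro nn_integral_eq_integral[symmetric]) auto
      also have "\<dots> \<le> (\<integral>\<^sup>+x. indicator U x \<partial>M)"
        using k(3,6,7) by (intro nn_integral_mono) (auto simp: indicator_def subset_iff; metis ennreal_0 order_refl)
      also have "\<dots> = emeasure M U" using U by simp
      finally show ?thesis by (simp add: mult_left_mono)
    qed
    then show ?thesis unfolding N.inner[OF U] by (intro SUP_least) auto
  qed
  \<comment> \<open>The passage to the infimum divides by c, so c = 0 is separated; then N vanishes
    on the whole space by the case of open sets.\<close>
  show ?thesis
  proof (cases "c = 0")
    case True
    have "emeasure N A \<le> emeasure N UNIV" using A by (intro emeasure_mono) auto
    also have "\<dots> \<le> 0" using op[of UNIV] True by simp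
    finally show ?thesis by simp
  next
    case False
    then show ?thesis
      unfolding outer[OF A]
      using c op A by (intro ennreal_le_mult_INF) (auto intro: order_trans[OF emeasure_mono])
  qed
qed

end

subsection \<open>Uniqueness of Haar measure, and inversion\<close>

text \<open>The error is measured relative to the N-integral of h, so it survives division by that
  integral as the support of h shrinks.\<close>

definition exchange_bound ::
  "'g::topological_group_add measure \<Rightarrow> 'g measure \<Rightarrow> ('g \<Rightarrow> complex) \<Rightarrow> real \<Rightarrow> 'g set \<Rightarrow> bool" where
  "exchange_bound M N f d V \<longleftrightarrow> (\<forall>h::'g \<Rightarrow> real. continuous_on UNIV h \<longrightarrow> (\<forall>x. 0 \<le> h x) \<longrightarrow>
     (\<forall>x. h (- x) = h x) \<longrightarrow> (\<forall>x. x \<notin> V \<longrightarrow> h x = 0) \<longrightarrow>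
     norm (complex_of_real (\<integral>x. h x \<partial>N) * (\<integral>x. f x \<partial>M) - complex_of_real (\<integral>x. h x \<partial>M) * (\<integral>x. f x \<partial>N)) \<le> d * (\<integral>x. h x \<partial>N))"

context haar_group
begin

lemma Cc_integrable_M: "k \<in> Cc \<Longrightarrow> integrable M k"
  by (rule Cc_integrable[OF foc])

text \<open>With a symmetric bump $h$ near the identity one can exchange the roles of the two measures up to the
  non-commutativity error $f(xy) - f(yx)$, which is uniformly small for $y$ near the identity.\<close>

lemma haar_exchange:
  assumes N: "haar_measure N" and f: "f \<in> Cc"
  shows "\<exists>C\<ge>0. \<forall>e>0. \<exists>V. open V \<and> 0 \<in> V \<and> exchange_bound M N f (e * C) V"
proof -
  interpret N: haar_group N using lc N by unfold_locales
  obtain K where K: "continuous_on UNIV f" "compact K" "\<And>x. x \<notin> K \<Longrightarrow> f x = 0"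
    using f by (auto simp: Cc_def)
  obtain V0 K0 where V0: "open V0" "compact K0" "(0::'g) \<in> V0" "V0 \<subseteq> K0"
    using compact_nbhd_base[OF lc open_UNIV, of 0] by auto
  \<comment> \<open>K' contains the supports of x |-> f (x + y) and x |-> f (y + x) for every y in
    V0. Its measure is the constant C, which therefore does not depend on e.\<close>
  define K' where "K' = (\<lambda>(x, y). x + y) ` (K \<times> uminus ` K0) \<union> (\<lambda>(x, y). x + y) ` (uminus ` K0 \<times> K)"
  have K': "compact K'" unfolding K'_def using K V0 by (intro compact_Un compact_plus compact_uminus)
  have z1: "f (x + y) = 0" if "y \<in> V0" "x \<notin> K'" for x y
  proof (rule K(3), rule notI)
    assume "x + y \<in> K"
    then have "(x + y) + (- y) \<in> K'" using that V0 unfolding K'_def by force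
    then show False using that by (simp add: add.assoc)
  qed
  have z2: "f (y + x) = 0" if "y \<in> V0" "x \<notin> K'" for x y
  proof (rule K(3), rule notI)
    assume "y + x \<in> K"
    then have "(- y) + (y + x) \<in> K'" using that V0 unfolding K'_def by force
    then show False using that by (simp add: add.assoc[symmetric])
  qed
  define C where "C = measure M K'"
  show ?thesis
  proof (intro exI[of _ C] conjI allI impI)
    show "0 \<le> C" by (simp add: C_def)
    fix e :: real assume e: "0 < e"
    have c: "continuous_on UNIV (\<lambda>z. f (snd z + fst z) - f (fst z + snd z))"
      by (auto intro!: continuous_intros continuous_on_compose2[OF K(1)])
    have "\<exists>V1. open V1 \<and> 0 \<in> V1 \<and> (\<forall>y\<in>V1. \<forall>x\<in>K'. norm (f (x + y) - f (y + x)) < e)"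
      using tube_dist[OF c K' e, of 0] by simp
    then obtain V1 where V1: "open V1" "0 \<in> V1" "\<forall>y\<in>V1. \<forall>x\<in>K'. norm (f (x + y) - f (y + x)) < e"
      by blast
    define V where "V = V0 \<inter> V1"
    have V: "open V" "0 \<in> V" using V0 V1 by (auto simp: V_def)
    have small: "norm (f (y + x) - f (x + y)) \<le> e * indicator K' x" if "y \<in> V" for x y
      using V1(3) z1[of y x] z2[of y x] that
      by (cases "x \<in> K'") (auto simp: V_def norm_minus_commute less_imp_le)
    show "\<exists>V. open V \<and> 0 \<in> V \<and> exchange_bound M N f (e * C) V"
      unfolding exchange_bound_def
    proof (intro exI[of _ V] conjI V allI impI)
      fix h :: "'g \<Rightarrow> real"
      assume h: "continuous_on UNIV h" "\<forall>x. 0 \<le> h x" "\<forall>x. h (- x) = h x" "\<forall>x. x \<notin> V \<longrightarrow> h x = 0"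
      define k where "k = (\<lambda>x. complex_of_real (h x))"
      have hK0: "h x = 0" if "x \<notin> K0" for x using h(4) V0 that by (auto simp: V_def)
      have k: "k \<in> Cc" unfolding k_def by (rule Cc_of_real[OF h(1) V0(2) hK0])
      have km: "k \<in> borel_measurable borel" and fm: "f \<in> borel_measurable borel" using k f by (auto intro: Cc_measurable)
      have ks: "k (- x + y) = k (- y + x)" for x y
        using h(3)[rule_format, of "- y + x"] by (simp add: k_def minus_add)
      \<comment> \<open>At (x, y) these are f y * k (- y + x), f (x + y) * k y and k y * f (y + x).
        They are written as a tensor composed with a shear so that \<open>Cc_homeo\<close>
        applies.\<close>
      let ?F2 = "\<lambda>z. f (fst (snd z, - snd z + fst z)) * k (snd (snd z, - snd z + fst z))"
      let ?F3 = "\<lambda>z. f (fst (fst z + snd z, snd z)) * k (snd (fst z + snd z, snd z))"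
      let ?F4 = "\<lambda>z. k (fst (snd z, snd z + fst z)) * f (snd (snd z, snd z + fst z))"
      have F2: "?F2 \<in> Cc"
        by (rule Cc_homeo[OF Cc_tensor[OF f k], where g = "\<lambda>z. (fst z + snd z, fst z)"])
          (auto intro!: continuous_intros simp: add.assoc[symmetric])
      have F3: "?F3 \<in> Cc"
        by (rule Cc_homeo[OF Cc_tensor[OF f k], where g = "\<lambda>z. (fst z - snd z, snd z)"])
          (auto intro!: continuous_intros)
      have F4: "?F4 \<in> Cc"
        by (rule Cc_homeo[OF Cc_tensor[OF k f], where g = "\<lambda>z. (- fst z + snd z, fst z)"])
          (auto intro!: continuous_intros simp: add.assoc[symmetric])
      have "complex_of_real (\<integral>x. h x \<partial>N) * (\<integral>x. f x \<partial>M) = (\<integral>y. k y \<partial>N) * (\<integral>x. f x \<partial>M)"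
        by (simp add: k_def)
      also have "\<dots> = (\<integral>y. k y * (\<integral>x. f (y + x) \<partial>M) \<partial>N)" by (simp add: integral_plus[OF fm])
      also have "\<dots> = (\<integral>y. \<integral>x. ?F4 (x, y) \<partial>M \<partial>N)" by simp
      finally have a: "complex_of_real (\<integral>x. h x \<partial>N) * (\<integral>x. f x \<partial>M) = (\<integral>y. \<integral>x. ?F4 (x, y) \<partial>M \<partial>N)" .
      have "complex_of_real (\<integral>x. h x \<partial>M) * (\<integral>x. f x \<partial>N) = (\<integral>y. f y \<partial>N) * (\<integral>x. k x \<partial>M)"
        by (simp add: k_def mult.commute)
      also have "\<dots> = (\<integral>y. f y * (\<integral>x. k (- y + x) \<partial>M) \<partial>N)" by (simp add: integral_plus[OF km])
      also have "\<dots> = (\<integral>y. \<integral>x. ?F2 (x, y) \<partial>M \<partial>N)" by simp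
      also have "\<dots> = (\<integral>x. \<integral>y. ?F2 (x, y) \<partial>N \<partial>M)"
        using Fubini_Cc_prod[OF foc N.foc F2] by simp
      also have "\<dots> = (\<integral>x. \<integral>y. f y * k (- x + y) \<partial>N \<partial>M)" by (simp add: ks[of _ "_"] cong: Bochner_Integration.integral_cong)
      also have "\<dots> = (\<integral>x. \<integral>y. f (x + y) * k (- x + (x + y)) \<partial>N \<partial>M)"
      proof -
        have "(\<lambda>y. f y * k (- x + y)) \<in> borel_measurable borel" for x
          by (intro borel_measurable_times fm borel_measurable_continuous_compose[OF km] continuous_intros)
        then have "(\<integral>y. f (x + y) * k (- x + (x + y)) \<partial>N) = (\<integral>y. f y * k (- x + y) \<partial>N)" for x
          by (rule N.integral_plus)
        then show ?thesis by (simp only:)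
      qed
      also have "\<dots> = (\<integral>x. \<integral>y. ?F3 (x, y) \<partial>N \<partial>M)" by (simp add: add.assoc[symmetric])
      also have "\<dots> = (\<integral>y. \<integral>x. ?F3 (x, y) \<partial>M \<partial>N)"
        using Fubini_Cc_prod[OF foc N.foc F3] by simp
      finally have b: "complex_of_real (\<integral>x. h x \<partial>M) * (\<integral>x. f x \<partial>N) = (\<integral>y. \<integral>x. ?F3 (x, y) \<partial>M \<partial>N)" .
      have i4: "integrable M (\<lambda>x. ?F4 (x, y))" and i3: "integrable M (\<lambda>x. ?F3 (x, y))" for y
        using Cc_integrable_M[OF Cc_section[OF F4]] Cc_integrable_M[OF Cc_section[OF F3]] by simp_all
      have j4: "integrable N (\<lambda>y. \<integral>x. ?F4 (x, y) \<partial>M)" and j3: "integrable N (\<lambda>y. \<integral>x. ?F3 (x, y) \<partial>M)"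
        using N.Cc_integrable_M[OF Cc_integral_section[OF foc F4]] N.Cc_integrable_M[OF Cc_integral_section[OF foc F3]] by simp_all
      have iK: "integrable M (indicator K' :: 'g \<Rightarrow> real)"
        using K' finite_compact[OF K'] by (simp add: borel_compact less_top)
      have hN: "integrable N h"
      proof -
        obtain B where B: "\<And>x. norm (k x) \<le> B" using Cc_bounded[OF k] by metis
        show ?thesis
          by (rule integrable_compact_support[OF N.foc borel_measurable_continuous_onI[OF h(1)] V0(2), of B])
            (use hK0 B in \<open>auto simp: k_def\<close>)
      qed
      have inner: "norm ((\<integral>x. ?F4 (x, y) \<partial>M) - (\<integral>x. ?F3 (x, y) \<partial>M)) \<le> h y * (e * C)" for y
      proof -
        have "norm ((\<integral>x. ?F4 (x, y) \<partial>M) - (\<integral>x. ?F3 (x, y) \<partial>M)) = norm (\<integral>x. ?F4 (x, y) - ?F3 (x, y) \<partial>M)"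
          by (subst Bochner_Integration.integral_diff[OF i4 i3]) simp
        also have "\<dots> \<le> (\<integral>x. h y * (e * indicator K' x) \<partial>M)"
        proof (intro norm_lebesgue_integral_le Bochner_Integration.integrable_diff i4 i3 integrable_mult_right iK)
          fix x
          have "?F4 (x, y) - ?F3 (x, y) = k y * (f (y + x) - f (x + y))" by (simp add: algebra_simps)
          then have "norm (?F4 (x, y) - ?F3 (x, y)) = h y * norm (f (y + x) - f (x + y))"
            using h(2) by (simp add: norm_mult k_def)
          also have "\<dots> \<le> h y * (e * indicator K' x)"
            using small[of y x] h(2,4) by (cases "y \<in> V") (auto intro: mult_left_mono)
          finally show "norm (?F4 (x, y) - ?F3 (x, y)) \<le> h y * (e * indicator K' x)" .
        qed
        also have "\<dots> = h y * (e * C)" using K' by (simp add: C_def)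
        finally show ?thesis .
      qed
      have "norm (complex_of_real (\<integral>x. h x \<partial>N) * (\<integral>x. f x \<partial>M) - complex_of_real (\<integral>x. h x \<partial>M) * (\<integral>x. f x \<partial>N))
        = norm (\<integral>y. (\<integral>x. ?F4 (x, y) \<partial>M) - (\<integral>x. ?F3 (x, y) \<partial>M) \<partial>N)"
        unfolding a b by (subst Bochner_Integration.integral_diff[OF j4 j3]) simp
      also have "\<dots> \<le> (\<integral>y. h y * (e * C) \<partial>N)"
        by (intro norm_lebesgue_integral_le Bochner_Integration.integrable_diff j4 j3 integrable_mult_left hN inner)
      finally show "norm (complex_of_real (\<integral>x. h x \<partial>N) * (\<integral>x. f x \<partial>M) - complex_of_real (\<integral>x. h x \<partial>M) * (\<integral>x. f x \<partial>N)) \<le> e * C * (\<integral>x. h x \<partial>N)"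
        by (simp add: mult.commute)
    qed
  qed
qed

text \<open>One bump h serves for f and g simultaneously. Eliminating the M-integral of h between
  the two exchange bounds leaves the required identity up to e * Q, after division by the positive
  N-integral of h.\<close>

lemma haar_proportional:
  assumes N: "haar_measure N" and f: "f \<in> Cc" and g: "g \<in> Cc"
  shows "(\<integral>x. f x \<partial>M) * (\<integral>x. g x \<partial>N) = (\<integral>x. g x \<partial>M) * (\<integral>x. f x \<partial>N)"
proof -
  interpret N: haar_group N using lc N by unfold_locales
  obtain C where C: "0 \<le> C" "\<forall>e>0. \<exists>V. open V \<and> 0 \<in> V \<and> exchange_bound M N f (e * C) V"
    using haar_exchange[OF N f] by blast
  obtain D where D: "0 \<le> D" "\<forall>e>0. \<exists>V. open V \<and> 0 \<in> V \<and> exchange_bound M N g (e * D) V"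
    using haar_exchange[OF N g] by blast
  define a a' b b' where "a = (\<integral>x. f x \<partial>M)" and "a' = (\<integral>x. g x \<partial>M)" and "b = (\<integral>x. f x \<partial>N)" and "b' = (\<integral>x. g x \<partial>N)"
  define Q where "Q = C * norm b' + D * norm b"
  have Q: "0 \<le> Q" using C D by (simp add: Q_def)
  have est: "norm (a * b' - a' * b) \<le> e * Q" if e: "0 < e" for e
  proof -
    obtain V where V: "open V" "0 \<in> V" "exchange_bound M N f (e * C) V"
      using C(2) e by blast
    obtain W where W: "open W" "0 \<in> W" "exchange_bound M N g (e * D) W"
      using D(2) e by blast
    have "open (V \<inter> W)" "0 \<in> V \<inter> W" using V W by auto
    from bump_at[OF this] obtain k :: "'g \<Rightarrow> real" and L where k: "continuous_on UNIV k" "\<And>x. 0 \<le> k x" "\<And>x. k x \<le> (1::real)"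
      "k 0 = 1" "compact L" "L \<subseteq> V \<inter> W" "\<And>y. y \<notin> L \<Longrightarrow> k y = 0"
      by metis
    \<comment> \<open>The product symmetrises the bump without enlarging its support beyond
      L.\<close>
    define h where "h x = k x * k (- x)" for x
    have kc: "continuous_on UNIV (\<lambda>x. k (- x))"
      by (rule continuous_on_compose2[OF k(1)]) (auto intro!: continuous_intros)
    have h: "continuous_on UNIV h" "\<forall>x. 0 \<le> h x" "\<forall>x. h (- x) = h x" "\<forall>x. x \<notin> L \<longrightarrow> h x = 0" "h 0 = 1"
      unfolding h_def using k by (auto intro!: continuous_intros kc simp: mult.commute)
    have hle: "norm (h x) \<le> 1" for x
      using k(2,3)[of x] k(2,3)[of "-x"] mult_mono[of "k x" 1 "k (-x)" 1] by (simp add: h_def)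
    have "integrable N h"
      by (rule integrable_compact_support[OF N.foc borel_measurable_continuous_onI[OF h(1)] k(5), of 1])
        (use h hle in auto)
    then have pos: "0 < (\<integral>x. h x \<partial>N)"
      by (intro N.integral_bump_pos[OF h(1), of 0]) (use h in auto)
    define s t where "s = (\<integral>x. h x \<partial>N)" and "t = (\<integral>x. h x \<partial>M)"
    have hVW: "\<forall>x. x \<notin> V \<longrightarrow> h x = 0" "\<forall>x. x \<notin> W \<longrightarrow> h x = 0" using h(4) k(6) by blast+
    have e1: "norm (complex_of_real s * a - complex_of_real t * b) \<le> e * C * s"
      using V(3) h(1-3) hVW unfolding exchange_bound_def s_def t_def a_def b_def by simp
    have e2: "norm (complex_of_real s * a' - complex_of_real t * b') \<le> e * D * s"
      using W(3) h(1-3) hVW unfolding exchange_bound_def s_def t_def a'_def b'_def by simp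
    have "complex_of_real s * (a * b' - a' * b) = (complex_of_real s * a - complex_of_real t * b) * b' - (complex_of_real s * a' - complex_of_real t * b') * b"
      by (simp add: algebra_simps)
    then have "norm (complex_of_real s * (a * b' - a' * b)) \<le> norm (complex_of_real s * a - complex_of_real t * b) * norm b' + norm (complex_of_real s * a' - complex_of_real t * b') * norm b"
      by (metis norm_mult norm_triangle_ineq4)
    also have "\<dots> \<le> e * C * s * norm b' + e * D * s * norm b"
      by (intro add_mono mult_right_mono e1 e2) auto
    also have "\<dots> = s * (e * Q)" by (simp add: Q_def algebra_simps)
    also have "norm (complex_of_real s * (a * b' - a' * b)) = s * norm (a * b' - a' * b)"
      using pos unfolding norm_mult by (simp add: s_def)
    finally have "s * norm (a * b' - a' * b) \<le> s * (e * Q)" .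
    then show ?thesis using pos by (simp add: s_def)
  qed
  have "norm (a * b' - a' * b) \<le> 0"
  proof (rule field_le_epsilon)
    fix e :: real assume e: "0 < e"
    have "norm (a * b' - a' * b) \<le> e / (Q + 1) * Q" using Q e by (intro est divide_pos_pos) auto
    also have "\<dots> \<le> e" using Q e mult_left_mono[of Q "Q+1" e] by (simp add: divide_le_eq)
    finally show "norm (a * b' - a' * b) \<le> 0 + e" by simp
  qed
  then show ?thesis by (simp add: a_def a'_def b_def b'_def)
qed

lemma haar_unique:
  assumes N: "haar_measure N"
  obtains c where "0 < c" "\<And>A. A \<in> sets borel \<Longrightarrow> emeasure N A = ennreal c * emeasure M A"
    "\<And>f. f \<in> Cc \<Longrightarrow> (\<integral>x. f x \<partial>N) = complex_of_real c * (\<integral>x. f x \<partial>M)"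
proof -
  interpret N: haar_group N using lc N by unfold_locales
  obtain k :: "'g \<Rightarrow> real" and L where k: "continuous_on UNIV k" "\<And>x. 0 \<le> k x" "\<And>x. k x \<le> (1::real)"
    "k 0 = 1" "compact L" "\<And>y. y \<notin> L \<Longrightarrow> k y = 0"
    using bump_at[OF open_UNIV UNIV_I, of 0] by metis
  have km: "k \<in> borel_measurable borel" using k by (intro borel_measurable_continuous_onI)
  have "integrable N k" "integrable M k"
    using k by (auto intro!: integrable_compact_support[OF N.foc km k(5), of 1] integrable_compact_support[OF foc km k(5), of 1])
  then have pos: "0 < (\<integral>x. k x \<partial>N)" "0 < (\<integral>x. k x \<partial>M)"
    using N.integral_bump_pos[OF k(1,2), of 0] integral_bump_pos[OF k(1,2), of 0] k(4) by auto
  define c where "c = (\<integral>x. k x \<partial>N) / (\<integral>x. k x \<partial>M)"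
  have c: "0 < c" using pos by (simp add: c_def)
  have eq: "(\<integral>x. f x \<partial>N) = complex_of_real c * (\<integral>x. f x \<partial>M)" if f: "f \<in> Cc" for f
    using haar_proportional[OF N f Cc_of_real[OF k(1,5,6)]] pos
    by (simp add: c_def field_simps)
  have eq': "(\<integral>x. f x \<partial>M) = complex_of_real (1/c) * (\<integral>x. f x \<partial>N)" if f: "f \<in> Cc" for f
    using eq[OF f] c by (simp add: field_simps)
  have "emeasure N A = ennreal c * emeasure M A" if A: "A \<in> sets borel" for A
  proof (rule antisym)
    show "emeasure N A \<le> ennreal c * emeasure M A" using haar_le_of_Cc[OF N _ eq A] c by simp
    have "emeasure M A \<le> ennreal (1/c) * emeasure N A" using N.haar_le_of_Cc[OF haar _ eq' A] c by simp
    then have "ennreal c * emeasure M A \<le> ennreal c * (ennreal (1/c) * emeasure N A)" by (rule mult_left_mono) simp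
    also have "\<dots> = emeasure N A" using c by (simp add: mult.assoc[symmetric] flip: ennreal_mult'')
    finally show "ennreal c * emeasure M A \<le> emeasure N A" .
  qed
  then show thesis using that[OF c _ eq] by blast
qed

text \<open>Integrating $f(y)\,v(y^{-1}s)\,h(s)$ in both orders removes the inversion on one side only; $f$ is $1$
  on the product of the support of $h$ with $K$.\<close>

lemma inversion_bound_Cc:
  assumes K: "compact K"
  shows "\<exists>C>0. \<forall>v::'g \<Rightarrow> real. continuous_on UNIV v \<longrightarrow> (\<forall>x. 0 \<le> v x) \<longrightarrow> (\<lambda>x. complex_of_real (v x)) \<in> Cc \<longrightarrow>
     (\<integral>y. indicator K y * v (- y) \<partial>M) \<le> C * (\<integral>y. v y \<partial>M)"
proof -
  obtain h :: "'g \<Rightarrow> real" and L where h: "continuous_on UNIV h" "\<And>x. 0 \<le> h x" "\<And>x. h x \<le> (1::real)"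
    "h 0 = 1" "compact L" "\<And>y. y \<notin> L \<Longrightarrow> h y = 0"
    using bump_at[OF open_UNIV UNIV_I, of 0] by metis
  have LK: "compact ((\<lambda>(x, y). x + y) ` (L \<times> K))" using h K by (intro compact_plus)
  obtain f :: "'g \<Rightarrow> real" and Q where f: "continuous_on UNIV f" "\<And>x. 0 \<le> f x" "\<And>x. f x \<le> (1::real)"
    "\<forall>x\<in>((\<lambda>(x, y). x + y) ` (L \<times> K)). f x = 1" "compact Q" "\<And>y. y \<notin> Q \<Longrightarrow> f y = 0"
    using urysohn_bump[OF lc LK open_UNIV subset_UNIV] by metis
  have hm: "h \<in> borel_measurable borel" "f \<in> borel_measurable borel"
    using h f by (auto intro: borel_measurable_continuous_onI)
  have hi: "integrable M h" "integrable M f"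
    using h f by (auto intro!: integrable_compact_support[OF foc hm(1) h(5), of 1] integrable_compact_support[OF foc hm(2) f(5), of 1])
  define H where "H = (\<integral>x. h x \<partial>M)"
  define D where "D = (\<integral>x. f x \<partial>M)"
  have H: "0 < H" unfolding H_def using h by (intro integral_bump_pos[OF h(1,2) _ hi(1), of 0]) auto
  have D: "0 \<le> D" unfolding D_def using f by (intro Bochner_Integration.integral_nonneg) auto
  let ?c = complex_of_real
  have hC: "(\<lambda>x. ?c (h x)) \<in> Cc" and fC: "(\<lambda>x. ?c (f x)) \<in> Cc"
    using Cc_of_real[OF h(1,5,6)] Cc_of_real[OF f(1,5,6)] by auto
  show ?thesis
  \<comment> \<open>Below, v * G and v (- y) * J y have the same integral; G is bounded by D because
    h is at most 1, and J equals H on K because f is 1 on L + K. The added 1 keeps the constant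
    positive.\<close>
  proof (intro exI[of _ "(D + 1) / H"] conjI allI impI)
    show "0 < (D + 1) / H" using H D by simp
    fix v :: "'g \<Rightarrow> real" assume v: "continuous_on UNIV v" "\<forall>x. 0 \<le> v x" and vC: "(\<lambda>x. ?c (v x)) \<in> Cc"
    have vm: "v \<in> borel_measurable borel" using v by (intro borel_measurable_continuous_onI)
    have vi: "integrable M v" using Cc_integrable_M[OF vC] by (simp add: complex_of_real_integrable_eq)
    have vuC: "(\<lambda>x. ?c (v (- x))) \<in> Cc" using Cc_uminus[OF vC] by simp
    have vui: "integrable M (\<lambda>y. v (- y))" using Cc_integrable_M[OF vuC] by (simp add: complex_of_real_integrable_eq)
    have fc': "continuous_on UNIV (\<lambda>y. f (s + y))" for s by (rule continuous_on_compose2[OF f(1)]) (auto intro!: continuous_intros)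
    define G where "G s = (\<integral>y. f y * h (y + s) \<partial>M)" for s
    define J where "J y = (\<integral>s. h s * f (s + y) \<partial>M)" for y
    let ?F1 = "\<lambda>z. ?c (f (snd z) * v (- snd z + fst z) * h (fst z))"
    have F1: "?F1 \<in> Cc"
    proof -
      have "(\<lambda>z. (?c (f (fst (snd z, - snd z + fst z))) * ?c (v (snd (snd z, - snd z + fst z)))) * ?c (h (fst z))) \<in> Cc"
        by (intro Cc_mult Cc_homeo[OF Cc_tensor[OF fC vC], where g = "\<lambda>z. (fst z + snd z, fst z)"])
          (auto intro!: continuous_intros continuous_on_compose2[OF h(1)] simp: add.assoc[symmetric])
      then show ?thesis by simp
    qed
    have "(\<lambda>z. (?c (f (fst (snd z, fst z))) * ?c (v (snd (snd z, fst z)))) * ?c (h (snd z + fst z))) \<in> Cc"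
      by (intro Cc_mult Cc_homeo[OF Cc_tensor[OF fC vC], where g = "\<lambda>z. (snd z, fst z)"])
        (auto intro!: continuous_intros continuous_on_compose2[OF h(1)])
    then have F2: "(\<lambda>z. ?c (f (snd z) * v (fst z) * h (snd z + fst z))) \<in> Cc" by simp
    have "(\<lambda>z. (?c (h (fst z)) * ?c (v (- snd z))) * ?c (f (fst z + snd z))) \<in> Cc"
      by (intro Cc_mult Cc_tensor[OF hC vuC]) (auto intro!: continuous_intros continuous_on_compose2[OF f(1)])
    then have F3: "(\<lambda>z. ?c (h (fst z) * v (- snd z) * f (fst z + snd z))) \<in> Cc" by simp
    have hr: "(\<lambda>s. f y * v (- y + s) * h s) \<in> borel_measurable borel" for y
      by (intro borel_measurable_times hm borel_measurable_const borel_measurable_continuous_compose[OF vm] continuous_intros)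
    have "(\<integral>s. \<integral>y. f y * v (- y + s) * h s \<partial>M \<partial>M) = (\<integral>y. \<integral>s. f y * v (- y + s) * h s \<partial>M \<partial>M)"
      using Fubini_Cc_real[OF foc foc F1] by simp
    also have "\<dots> = (\<integral>y. \<integral>s. f y * v s * h (y + s) \<partial>M \<partial>M)"
    proof -
      have "(\<integral>s. f y * v (- y + (y + s)) * h (y + s) \<partial>M) = (\<integral>s. f y * v (- y + s) * h s \<partial>M)" for y
        by (rule integral_plus[OF hr])
      then show ?thesis by (simp add: add.assoc[symmetric])
    qed
    also have "\<dots> = (\<integral>s. \<integral>y. f y * v s * h (y + s) \<partial>M \<partial>M)"
      using Fubini_Cc_real[OF foc foc F2] by simp
    also have "\<dots> = (\<integral>s. v s * G s \<partial>M)"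
      unfolding G_def by (simp flip: integral_mult_right_zero add: mult.assoc mult.left_commute)
    finally have e1: "(\<integral>s. \<integral>y. f y * v (- y + s) * h s \<partial>M \<partial>M) = (\<integral>s. v s * G s \<partial>M)" .
    have hr': "(\<lambda>y. f y * v (- y + s) * h s) \<in> borel_measurable borel" for s
      by (intro borel_measurable_times hm borel_measurable_const borel_measurable_continuous_compose[OF vm] continuous_intros)
    have "(\<integral>s. \<integral>y. f y * v (- y + s) * h s \<partial>M \<partial>M) = (\<integral>s. \<integral>y. h s * v (- y) * f (s + y) \<partial>M \<partial>M)"
    proof -
      have "(\<integral>y. f (s + y) * v (- (s + y) + s) * h s \<partial>M) = (\<integral>y. f y * v (- y + s) * h s \<partial>M)" for s
        by (rule integral_plus[OF hr'])
      then show ?thesis by (simp add: minus_add add.assoc algebra_simps)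
    qed
    also have "\<dots> = (\<integral>y. \<integral>s. h s * v (- y) * f (s + y) \<partial>M \<partial>M)"
      using Fubini_Cc_real[OF foc foc F3] by simp
    also have "\<dots> = (\<integral>y. v (- y) * J y \<partial>M)"
      unfolding J_def by (simp flip: integral_mult_right_zero add: mult.assoc mult.left_commute)
    finally have e2: "(\<integral>s. v s * G s \<partial>M) = (\<integral>y. v (- y) * J y \<partial>M)" using e1 by simp
    have "(\<lambda>y. \<integral>s. ?c (h s * v (- y) * f (s + y)) \<partial>M) \<in> Cc"
      using Cc_integral_section[OF foc F3] by simp
    then have "integrable M (\<lambda>y. \<integral>s. ?c (h s * v (- y) * f (s + y)) \<partial>M)" by (rule Cc_integrable_M)
    then have iJ: "integrable M (\<lambda>y. v (- y) * J y)"
      unfolding J_def by (simp flip: integral_mult_right_zero of_real_mult add: integral_complex_of_real complex_of_real_integrable_eq mult.assoc mult.left_commute del: of_real_mult)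
    have JH: "J y = H" if "y \<in> K" for y
    proof -
      have "h s * f (s + y) = h s" for s
        using f(4) h(6)[of s] that by (cases "s \<in> L") auto
      then show ?thesis unfolding J_def H_def by (simp only:)
    qed
    have J0: "0 \<le> J y" for y unfolding J_def using h f by (intro Bochner_Integration.integral_nonneg) auto
    have G0: "norm (G s) \<le> D" for s unfolding G_def D_def
    proof (rule norm_lebesgue_integral_le[OF _ hi(2)])
      have "(\<lambda>y. ?c (f y) * ?c (h (y + s))) \<in> Cc"
        by (intro Cc_mult fC) (auto intro!: continuous_intros continuous_on_compose2[OF h(1)])
      from Cc_integrable_M[OF this] show "integrable M (\<lambda>y. f y * h (y + s))"
        by (simp add: complex_of_real_integrable_eq flip: of_real_mult)
      show "norm (f y * h (y + s)) \<le> f y" for y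
        using f(2)[of y] h(2,3)[of "y + s"] by (simp add: abs_mult mult_left_le)
    qed
    have Gi: "integrable M (\<lambda>s. v s * G s)"
    proof -
      have "(\<lambda>s. \<integral>y. ?c (f y * v s * h (y + s)) \<partial>M) \<in> Cc"
        using Cc_integral_section[OF foc Cc_homeo[OF F2, of "\<lambda>z. (snd z, fst z)" "\<lambda>z. (snd z, fst z)"]]
        by (simp add: continuous_intros)
      then have "integrable M (\<lambda>s. \<integral>y. ?c (f y * v s * h (y + s)) \<partial>M)" by (rule Cc_integrable_M)
      then show ?thesis
        unfolding G_def by (simp flip: integral_mult_right_zero of_real_mult add: integral_complex_of_real complex_of_real_integrable_eq mult.assoc mult.left_commute del: of_real_mult)
    qed
    have iK: "integrable M (\<lambda>y. indicator K y * v (- y))"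
      using integrable_real_mult_indicator[OF compact_sets[OF K] vui] by (simp add: mult.commute)
    have "H * (\<integral>y. indicator K y * v (- y) \<partial>M) = (\<integral>y. H * (indicator K y * v (- y)) \<partial>M)" by simp
    also have "\<dots> \<le> (\<integral>y. v (- y) * J y \<partial>M)"
      by (intro integral_mono iJ integrable_mult_right iK) (use JH J0 v in \<open>auto simp: indicator_def\<close>)
    also have "\<dots> = (\<integral>s. v s * G s \<partial>M)" using e2 by simp
    also have "\<dots> \<le> (\<integral>s. v s * (D + 1) \<partial>M)"
    proof (intro integral_mono Gi integrable_mult_left vi)
      show "v s * G s \<le> v s * (D + 1)" for s using G0[of s] v by (intro mult_left_mono) auto
    qed
    also have "\<dots> = (D + 1) * (\<integral>s. v s \<partial>M)" by simp
    finally show "(\<integral>y. indicator K y * v (- y) \<partial>M) \<le> (D + 1) / H * (\<integral>y. v y \<partial>M)"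
      using H by (simp add: field_simps)
  qed
qed

text \<open>Local control of inversion, in the role of the modular function. Regularity works
  through open sets, so K is first enlarged to an open W inside a compact K', making the
  intersection of W with - U open and still covered by the estimate for K'.\<close>

lemma inversion_bound:
  assumes K: "compact K"
  shows "\<exists>C>0. \<forall>B\<in>sets borel. emeasure M {y\<in>K. - y \<in> B} \<le> ennreal C * emeasure M B"
proof -
  obtain W K' where W: "open W" "compact K'" "K \<subseteq> W" "W \<subseteq> K'"
    using compact_nbhd_base_compact[OF lc K open_UNIV] by auto
  obtain C where C: "0 < C" "\<And>v::'g \<Rightarrow> real. continuous_on UNIV v \<Longrightarrow> (\<forall>x. 0 \<le> v x) \<Longrightarrow> (\<lambda>x. complex_of_real (v x)) \<in> Cc \<Longrightarrow>
     (\<integral>y. indicator K' y * v (- y) \<partial>M) \<le> C * (\<integral>y. v y \<partial>M)"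
    using inversion_bound_Cc[OF W(2)] by blast
  have um: "uminus -` B \<in> sets borel" if "B \<in> sets borel" for B :: "'g set"
    using measurable_sets[OF borel_measurable_continuous_onI[of "uminus :: 'g \<Rightarrow> 'g"] that] by (simp add: continuous_intros)
  have op: "emeasure M (W \<inter> uminus -` U) \<le> ennreal C * emeasure M U" if U: "open U" for U
  proof -
    have oW: "open (W \<inter> uminus -` U)"
      by (intro open_Int W open_vimage U) (auto intro!: continuous_intros)
    have "emeasure M L \<le> ennreal C * emeasure M U" if L: "compact L" "L \<subseteq> W \<inter> uminus -` U" for L
    proof -
      have "compact (uminus ` L)" "uminus ` L \<subseteq> U" using L by (auto intro: compact_uminus)
      then obtain v :: "'g \<Rightarrow> real" and Q where v: "continuous_on UNIV v" "\<And>x. 0 \<le> v x" "\<And>x. v x \<le> (1::real)"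
        "\<forall>x\<in>uminus ` L. v x = 1" "compact Q" "Q \<subseteq> U" "\<And>x. x \<notin> Q \<Longrightarrow> v x = 0"
        using urysohn_bump[OF lc _ U] by metis
      have vC: "(\<lambda>x. complex_of_real (v x)) \<in> Cc" by (rule Cc_of_real[OF v(1,5,7)])
      have vi: "integrable M v" using Cc_integrable_M[OF vC] by (simp add: complex_of_real_integrable_eq)
      have vui: "integrable M (\<lambda>y. v (- y))"
        using Cc_integrable_M[OF Cc_uminus[OF vC]] by (simp add: complex_of_real_integrable_eq)
      have iK: "integrable M (\<lambda>y. indicator K' y * v (- y))"
        using integrable_real_mult_indicator[OF compact_sets[OF W(2)] vui] by (simp add: mult.commute)
      have "emeasure M L = (\<integral>\<^sup>+x. indicator L x \<partial>M)" using L by (simp add: borel_compact)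
      also have "\<dots> \<le> (\<integral>\<^sup>+y. ennreal (indicator K' y * v (- y)) \<partial>M)"
        using v L W by (intro nn_integral_mono) (auto simp: indicator_def)
      also have "\<dots> = ennreal (\<integral>y. indicator K' y * v (- y) \<partial>M)"
        using v by (intro nn_integral_eq_integral iK) auto
      also have "\<dots> \<le> ennreal (C * (\<integral>y. v y \<partial>M))" by (intro ennreal_leI C(2)) (use v vC in auto)
      also have "\<dots> = ennreal C * (\<integral>\<^sup>+y. ennreal (v y) \<partial>M)"
        using C v by (subst nn_integral_eq_integral[OF vi]) (auto simp: ennreal_mult')
      also have "(\<integral>\<^sup>+y. ennreal (v y) \<partial>M) \<le> (\<integral>\<^sup>+y. indicator U y \<partial>M)"
      proof (intro nn_integral_mono)
        show "ennreal (v y) \<le> indicator U y" for y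
        proof (cases "y \<in> U")
          case False
          then have "v y = 0" using v(6) by (intro v(7)) blast
          then show ?thesis by simp
        qed (use v(3)[of y] in simp)
      qed
      also have "\<dots> = emeasure M U" using U by simp
      finally show ?thesis by (simp add: mult_left_mono)
    qed
    then show ?thesis unfolding inner[OF oW] by (intro SUP_least) auto
  qed
  have "emeasure M {y\<in>K. - y \<in> B} \<le> ennreal C * emeasure M B" if B: "B \<in> sets borel" for B
    unfolding outer[OF B]
  proof (rule ennreal_le_mult_INF[OF C(1)])
    fix U assume "U \<in> {U. open U \<and> B \<subseteq> U}"
    then have U: "open U" "B \<subseteq> U" by auto
    have "emeasure M {y\<in>K. - y \<in> B} \<le> emeasure M (W \<inter> uminus -` U)"
      using U W um[of U] by (intro emeasure_mono) auto
    then show "emeasure M {y\<in>K. - y \<in> B} \<le> ennreal C * emeasure M U" using op[OF U(1)] by simp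
  qed
  then show ?thesis using C(1) by blast
qed

lemma measurable_uminus: "(uminus :: 'g \<Rightarrow> 'g) \<in> M \<rightarrow>\<^sub>M M"
  using borel_measurable_continuous_onI[of "uminus :: 'g \<Rightarrow> 'g"] by (simp cong: measurable_cong_sets add: continuous_intros)

lemma AE_uminus_compact:
  assumes K: "compact K" and P: "AE y in M. P y"
  shows "AE y in M. y \<in> K \<longrightarrow> P (- y)"
proof -
  obtain Z where Z: "Z \<in> null_sets M" "{y. \<not> P y} \<subseteq> Z"
    using P by (auto simp: eventually_ae_filter)
  have "Z \<in> sets borel" using Z by auto
  then obtain C where "emeasure M {y\<in>K. - y \<in> Z} \<le> ennreal C * emeasure M Z"
    using inversion_bound[OF K] by blast
  moreover have "K \<inter> uminus -` Z \<in> sets M"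
    using measurable_sets[OF measurable_uminus, of Z] Z K by (intro sets.Int) (auto simp: borel_compact null_setsD2)
  moreover have "{y\<in>K. - y \<in> Z} = K \<inter> uminus -` Z" by auto
  moreover have "emeasure M Z = 0" using Z(1) by (rule null_setsD1)
  ultimately have "K \<inter> uminus -` Z \<in> null_sets M" by (intro null_setsI) auto
  then have "AE y in M. y \<notin> K \<inter> uminus -` Z" by (rule AE_not_in)
  then show ?thesis by eventually_elim (use Z in auto)
qed

text \<open>\<open>inversion_bound\<close> says that the image under inversion of M restricted to K
  is at most C times M, as measures; integrating u against both sides gives the claim.\<close>

lemma nn_integral_uminus_compact:
  assumes K: "compact K"
  shows "\<exists>C>0. \<forall>u\<in>borel_measurable borel. (\<integral>\<^sup>+y. indicator K y * u (- y) \<partial>M) \<le> ennreal C * (\<integral>\<^sup>+y. u y \<partial>M)"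
proof -
  obtain C where C: "0 < C" "\<forall>B\<in>sets borel. emeasure M {y\<in>K. - y \<in> B} \<le> ennreal C * emeasure M B"
    using inversion_bound[OF K] by blast
  have Ks: "K \<in> sets M" by (rule compact_sets[OF K])
  define N where "N = distr (density M (indicator K)) M uminus"
  have sN: "sets N = sets M" by (simp add: N_def)
  have mu: "uminus \<in> measurable (density M (indicator K)) M" using measurable_uminus by (simp cong: measurable_cong_sets)
  have "emeasure N B \<le> emeasure (scale_measure (ennreal C) M) B" if B: "B \<in> sets M" for B
  proof -
    have "emeasure N B = emeasure (density M (indicator K)) (uminus -` B)"
      using B by (simp add: N_def emeasure_distr[OF mu])
    also have "\<dots> = emeasure M (K \<inter> uminus -` B)"
      using measurable_sets[OF measurable_uminus B] Ks by (subst emeasure_density) (auto simp: nn_integral_indicator[symmetric] indicator_inter_arith[symmetric] simp del: nn_integral_indicator)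
    also have "K \<inter> uminus -` B = {y\<in>K. - y \<in> B}" by auto
    finally show ?thesis using C(2) B by simp
  qed
  then have le: "N \<le> scale_measure (ennreal C) M"
    by (subst le_measure) (auto simp: sN)
  have "(\<integral>\<^sup>+y. indicator K y * u (- y) \<partial>M) \<le> ennreal C * (\<integral>\<^sup>+y. u y \<partial>M)" if u: "u \<in> borel_measurable borel" for u
  proof -
    have uM: "u \<in> borel_measurable M" using u by simp
    have "(\<integral>\<^sup>+y. indicator K y * u (- y) \<partial>M) = (\<integral>\<^sup>+y. u (- y) \<partial>density M (indicator K))"
      using Ks measurable_compose[OF measurable_uminus uM] by (subst nn_integral_density) auto
    also have "\<dots> = (\<integral>\<^sup>+y. u y \<partial>N)" unfolding N_def using uM by (subst nn_integral_distr[OF mu]) auto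
    also have "\<dots> \<le> (\<integral>\<^sup>+y. u y \<partial>scale_measure (ennreal C) M)"
      by (rule nn_integral_mono_measure[OF _ le]) (simp add: sN)
    also have "\<dots> = ennreal C * (\<integral>\<^sup>+y. u y \<partial>M)" using uM by (rule nn_integral_scale_measure)
    finally show ?thesis .
  qed
  then show ?thesis using C(1) by blast
qed

end

subsection \<open>Weighted Lebesgue spaces\<close>

definition ltrans :: "'g::group_add \<Rightarrow> ('g \<Rightarrow> 'b) \<Rightarrow> 'g \<Rightarrow> 'b" where
  "ltrans a f = (\<lambda>z. f (- a + z))"

text \<open>The $p$-th power of the norm; it satisfies the triangle inequality only up to the factor $2^p$, which
  suffices throughout and makes Minkowski's inequality unnecessary.\<close>

definition pnorm :: "'g measure \<Rightarrow> ('g \<Rightarrow> real) \<Rightarrow> real \<Rightarrow> ('g \<Rightarrow> complex) \<Rightarrow> real" where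
  "pnorm M \<omega> p f = (\<integral>x. norm (f x) powr p * \<omega> x powr p \<partial>M)"

lemma ltrans_ltrans: "ltrans a (ltrans b f) = ltrans (a + b) f"
  by (simp add: ltrans_def minus_add add.assoc diff_conv_add_uminus del: add_uminus_conv_diff)

lemma ltrans_0 [simp]: "ltrans 0 f = f"
  by (simp add: ltrans_def)

lemma powr_add_le:
  fixes a b p :: real
  assumes "0 \<le> a" "0 \<le> b" "0 \<le> p"
  shows "(a + b) powr p \<le> 2 powr p * (a powr p + b powr p)"
proof -
  have "(a + b) powr p \<le> (2 * max a b) powr p" using assms by (intro powr_mono2) auto
  also have "\<dots> = 2 powr p * (max a b) powr p" using assms by (simp add: powr_mult)
  also have "\<dots> \<le> 2 powr p * (a powr p + b powr p)"
    by (intro mult_left_mono) (auto simp: max_def)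
  finally show ?thesis .
qed

text \<open>Convexity is known on the open half-line; when one of the points is 0 it reduces to t^p
  <= t for 0 < t < 1.\<close>

lemma powr_convex_nonneg:
  assumes "1 \<le> p" shows "convex_on {0..} (\<lambda>x::real. x powr p)"
proof (rule convex_onI)
  fix t x y :: real assume t: "0 < t" "t < 1" and xy: "x \<in> {0..}" "y \<in> {0..}"
  have pw: "s powr p \<le> s" if "0 < s" "s < 1" for s :: real
    using that assms powr_mono'[of 1 p s] by simp
  show "((1 - t) *\<^sub>R x + t *\<^sub>R y) powr p \<le> (1 - t) * x powr p + t * y powr p"
  proof (cases "x = 0 \<or> y = 0")
    case True
    then show ?thesis
      using pw[of t] pw[of "1 - t"] t xy
      by (auto simp: powr_mult intro!: mult_right_mono)
  next
    case False
    then have "x \<in> {0<..}" "y \<in> {0<..}" using xy by auto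
    then show ?thesis using convex_onD[OF powr_convex[OF assms], of t x y] t by auto
  qed
qed (rule convex_real_interval)

text \<open>Jensen's inequality for the weights c x divided by their sum s, followed by s powr (p -
  1) <= B powr (p - 1). Iterating \<open>powr_add_le\<close> instead would give a constant growing
  with the number of terms, useless for Riemann sums.\<close>

lemma powr_sum_le:
  fixes c g :: "'i \<Rightarrow> real"
  assumes X: "finite X" and c: "\<And>x. x \<in> X \<Longrightarrow> 0 \<le> c x" and g: "\<And>x. x \<in> X \<Longrightarrow> 0 \<le> g x" and p: "1 \<le> p"
    and B: "(\<Sum>x\<in>X. c x) \<le> B" "0 < B"
  shows "(\<Sum>x\<in>X. c x * g x) powr p \<le> B powr (p - 1) * (\<Sum>x\<in>X. c x * g x powr p)"
proof (cases "(\<Sum>x\<in>X. c x) = 0")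
  case True
  then have "\<forall>x\<in>X. c x = 0" using X c by (simp add: sum_nonneg_eq_0_iff)
  then show ?thesis using p by simp
next
  case False
  define s where "s = (\<Sum>x\<in>X. c x)"
  have s: "0 < s" using False c sum_nonneg[of X c] by (auto simp: s_def less_le)
  have "(\<Sum>x\<in>X. (c x / s) *\<^sub>R g x) powr p \<le> (\<Sum>x\<in>X. (c x / s) * g x powr p)"
  proof (rule convex_on_sum[OF X _ powr_convex_nonneg[OF p]])
    show "X \<noteq> {}" using False by auto
    show "(\<Sum>x\<in>X. c x / s) = 1" using s by (simp add: s_def flip: sum_divide_distrib)
  qed (use c g s in auto)
  then have "((\<Sum>x\<in>X. c x * g x) / s) powr p \<le> (\<Sum>x\<in>X. c x * g x powr p) / s"
    by (simp add: sum_divide_distrib)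
  then have "(\<Sum>x\<in>X. c x * g x) powr p / s powr p \<le> (\<Sum>x\<in>X. c x * g x powr p) / s"
    using s c g by (subst (asm) powr_divide) (auto intro!: sum_nonneg)
  then have "(\<Sum>x\<in>X. c x * g x) powr p \<le> s powr p / s * (\<Sum>x\<in>X. c x * g x powr p)"
    using s by (simp add: field_simps)
  also have "s powr p / s = s powr (p - 1)" using s by (simp add: powr_diff)
  also have "s powr (p - 1) * (\<Sum>x\<in>X. c x * g x powr p) \<le> B powr (p - 1) * (\<Sum>x\<in>X. c x * g x powr p)"
    using s B p c by (intro mult_right_mono powr_mono2 sum_nonneg) (auto simp: s_def)
  finally show ?thesis .
qed

locale weighted_group = haar_group M for M :: "'g::{topological_group_add,t2_space} measure" +
  fixes \<omega> :: "'g \<Rightarrow> real" and p :: real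
  assumes weight: "weight \<omega>" and p: "1 \<le> p" and ca: "conv_algebra M \<omega> p"
begin

lemma borel_measurable_M [simp]: "borel_measurable M = borel_measurable borel"
  by (rule measurable_cong_sets) auto

lemma indicator_mult_meas:
  fixes f :: "'g \<Rightarrow> complex"
  shows "A \<in> sets borel \<Longrightarrow> f \<in> borel_measurable borel \<Longrightarrow> (\<lambda>x. indicator A x * f x) \<in> borel_measurable borel"
  by (intro borel_measurable_times borel_measurable_indicator) auto

abbreviation Lp where "Lp \<equiv> Lp_w M \<omega> p"
abbreviation pn where "pn \<equiv> pnorm M \<omega> p"

lemma w_pos: "0 < \<omega> x" and w_cont: "continuous_on UNIV \<omega>" and w_mult: "\<omega> (x + y) \<le> \<omega> x * \<omega> y" and w_0: "\<omega> 0 = 1"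
  using weight by (auto simp: weight_def)

lemma w_meas [measurable]: "\<omega> \<in> borel_measurable borel"
  by (rule borel_measurable_continuous_onI[OF w_cont])

lemma w_bounds:
  assumes K: "compact K"
  obtains a b where "0 < a" "0 < b" "\<And>x. x \<in> K \<Longrightarrow> a \<le> \<omega> x" "\<And>x. x \<in> K \<Longrightarrow> \<omega> x \<le> b"
proof (cases "K = {}")
  case False
  have c: "continuous_on K \<omega>" using w_cont continuous_on_subset by blast
  obtain x where x: "x \<in> K" "\<forall>y\<in>K. \<omega> x \<le> \<omega> y" using continuous_attains_inf[OF K False c] by blast
  obtain z where z: "z \<in> K" "\<forall>y\<in>K. \<omega> y \<le> \<omega> z" using continuous_attains_sup[OF K False c] by blast
  show thesis by (rule that[of "\<omega> x" "\<omega> z"]) (use x z w_pos in auto)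
qed (use that[of 1 1] in auto)

lemma Lp_meas: "f \<in> Lp \<Longrightarrow> f \<in> borel_measurable borel"
  by (simp add: Lp_w_def)

lemma Lp_int: "f \<in> Lp \<Longrightarrow> integrable M (\<lambda>x. norm (f x) powr p * \<omega> x powr p)"
  by (simp add: Lp_w_def)

lemma pn_nonneg: "0 \<le> pn f"
  unfolding pnorm_def by (intro Bochner_Integration.integral_nonneg) auto

lemma Lp_dom:
  assumes g: "g \<in> borel_measurable borel" and i: "integrable M u"
    and le: "\<And>x. norm (g x) powr p * \<omega> x powr p \<le> u x"
  shows "g \<in> Lp" "pn g \<le> (\<integral>x. u x \<partial>M)"
proof -
  have "integrable M (\<lambda>x. norm (g x) powr p * \<omega> x powr p)"
    using le g by (intro Bochner_Integration.integrable_bound[OF i]) (auto intro!: AE_I2 order_trans[OF le])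
  then show "g \<in> Lp" "pn g \<le> (\<integral>x. u x \<partial>M)"
    using g le i by (auto simp: Lp_w_def pnorm_def intro!: integral_mono)
qed

lemma Lp_mono:
  assumes f: "f \<in> Lp" and g: "g \<in> borel_measurable borel" and le: "\<And>x. norm (g x) \<le> norm (f x)"
  shows "g \<in> Lp" "pn g \<le> pn f"
proof -
  have "norm (g x) powr p * \<omega> x powr p \<le> norm (f x) powr p * \<omega> x powr p" for x
    using le p by (intro mult_right_mono powr_mono2) auto
  from Lp_dom[OF g Lp_int[OF f] this] show "g \<in> Lp" "pn g \<le> pn f"
    by (auto simp: pnorm_def)
qed

lemma Lp_add:
  assumes f: "f \<in> Lp" and g: "g \<in> Lp"
  shows "(\<lambda>x. f x + g x) \<in> Lp" "pn (\<lambda>x. f x + g x) \<le> 2 powr p * (pn f + pn g)"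
proof -
  let ?u = "\<lambda>x. 2 powr p * (norm (f x) powr p * \<omega> x powr p + norm (g x) powr p * \<omega> x powr p)"
  have i: "integrable M ?u" using Lp_int[OF f] Lp_int[OF g] by auto
  have m: "(\<lambda>x. f x + g x) \<in> borel_measurable borel" using Lp_meas[OF f] Lp_meas[OF g] by measurable
  have "norm (f x + g x) powr p * \<omega> x powr p \<le> ?u x" for x
  proof -
    have "norm (f x + g x) powr p \<le> (norm (f x) + norm (g x)) powr p"
      using p by (intro powr_mono2 norm_triangle_ineq) auto
    also have "\<dots> \<le> 2 powr p * (norm (f x) powr p + norm (g x) powr p)"
      using p by (intro powr_add_le) auto
    finally have "norm (f x + g x) powr p * \<omega> x powr p \<le> 2 powr p * (norm (f x) powr p + norm (g x) powr p) * \<omega> x powr p"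
      by (intro mult_right_mono) auto
    then show ?thesis by (simp add: algebra_simps)
  qed
  from Lp_dom[OF m i this] show "(\<lambda>x. f x + g x) \<in> Lp" "pn (\<lambda>x. f x + g x) \<le> 2 powr p * (pn f + pn g)"
    using Lp_int[OF f] Lp_int[OF g] by (auto simp: pnorm_def)
qed

lemma Lp_cmult:
  assumes f: "f \<in> Lp"
  shows "(\<lambda>x. a * f x) \<in> Lp" "pn (\<lambda>x. a * f x) = norm a powr p * pn f"
  using Lp_int[OF f] Lp_meas[OF f] by (auto simp: Lp_w_def pnorm_def norm_mult powr_mult mult.assoc)

lemma Lp_diff:
  assumes f: "f \<in> Lp" and g: "g \<in> Lp"
  shows "(\<lambda>x. f x - g x) \<in> Lp" "pn (\<lambda>x. f x - g x) \<le> 2 powr p * (pn f + pn g)"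
  using Lp_add[OF f Lp_cmult(1)[OF g, of "-1"]] Lp_cmult(2)[OF g, of "-1"] by auto

lemma pn_minus_commute: "pn (\<lambda>x. f x - g x) = pn (\<lambda>x. g x - f x)"
  by (simp add: pnorm_def norm_minus_commute)

lemma Lp_0: "(\<lambda>x. 0) \<in> Lp" "pn (\<lambda>x. 0) = 0"
  using p by (auto simp: Lp_w_def pnorm_def)

lemma Lp_sum:
  assumes "finite X" "\<And>x. x \<in> X \<Longrightarrow> f x \<in> Lp"
  shows "(\<lambda>z. \<Sum>x\<in>X. f x z) \<in> Lp"
  using assms by (induction X rule: finite_induct) (auto intro!: Lp_0 Lp_add)

lemma Lp_indicator:
  assumes f: "f \<in> Lp" and A: "A \<in> sets borel"
  shows "(\<lambda>x. indicator A x * f x) \<in> Lp" "pn (\<lambda>x. indicator A x * f x) \<le> pn f"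
  using Lp_mono[OF f, of "\<lambda>x. indicator A x * f x"] Lp_meas[OF f] A by (auto simp: norm_mult indicator_def)

lemma Lp_norm_fun: "f \<in> Lp \<Longrightarrow> (\<lambda>x. complex_of_real (norm (f x))) \<in> Lp"
  using Lp_mono(1)[of f "\<lambda>x. complex_of_real (norm (f x))"] Lp_meas[of f] by auto

lemma pn_cong_AE:
  assumes "f \<in> borel_measurable borel" "g \<in> borel_measurable borel" "AE x in M. f x = g x" shows "pn f = pn g"
  unfolding pnorm_def by (intro integral_cong_AE) (use assms in \<open>auto elim: eventually_mono\<close>)

lemma pn_eq_0_iff:
  assumes f: "f \<in> Lp" shows "pn f = 0 \<longleftrightarrow> (AE x in M. f x = 0)"
proof -
  have "pn f = 0 \<longleftrightarrow> (AE x in M. norm (f x) powr p * \<omega> x powr p = 0)"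
    unfolding pnorm_def by (intro integral_nonneg_eq_0_iff_AE Lp_int[OF f]) auto
  also have "\<dots> \<longleftrightarrow> (AE x in M. f x = 0)"
    using w_pos by (intro AE_cong) (auto simp: less_imp_neq[symmetric])
  finally show ?thesis .
qed

lemma Lp_ltrans:
  assumes f: "f \<in> Lp"
  shows "ltrans a f \<in> Lp" "pn (ltrans a f) \<le> \<omega> a powr p * pn f"
proof -
  let ?u = "\<lambda>x. \<omega> a powr p * (norm (f (- a + x)) powr p * \<omega> (- a + x) powr p)"
  have i: "integrable M ?u" using integrable_plus[OF Lp_int[OF f], of "- a"] by auto
  have um: "(\<lambda>x. norm (f x) powr p * \<omega> x powr p) \<in> borel_measurable borel" using Lp_meas[OF f] by measurable
  have m: "ltrans a f \<in> borel_measurable borel"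
    unfolding ltrans_def by (rule borel_measurable_continuous_compose[OF Lp_meas[OF f]]) (auto intro!: continuous_intros)
  have "norm (ltrans a f x) powr p * \<omega> x powr p \<le> ?u x" for x
  proof -
    have "\<omega> x = \<omega> (a + (- a + x))" by (simp add: add.assoc[symmetric])
    also have "\<dots> \<le> \<omega> a * \<omega> (- a + x)" by (rule w_mult)
    finally have "\<omega> x powr p \<le> (\<omega> a * \<omega> (- a + x)) powr p" using w_pos[of x] p by (intro powr_mono2) auto
    also have "\<dots> = \<omega> a powr p * \<omega> (- a + x) powr p" by (rule powr_mult)
    finally have "norm (f (- a + x)) powr p * \<omega> x powr p \<le> norm (f (- a + x)) powr p * (\<omega> a powr p * \<omega> (- a + x) powr p)"
      by (rule mult_left_mono) simp
    then show ?thesis by (simp add: ltrans_def mult_ac)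
  qed
  from Lp_dom[OF m i this] show "ltrans a f \<in> Lp" "pn (ltrans a f) \<le> \<omega> a powr p * pn f"
    using integral_plus[OF um, of "- a"] by (auto simp: pnorm_def)
qed

lemma Lp_compact_support:
  assumes f: "f \<in> borel_measurable borel" and K: "compact K" and z: "\<And>x. x \<notin> K \<Longrightarrow> f x = 0"
    and B: "\<And>x. x \<in> K \<Longrightarrow> norm (f x) \<le> B"
  shows "f \<in> Lp"
proof -
  obtain a b where ab: "0 < b" "\<And>x. x \<in> K \<Longrightarrow> \<omega> x \<le> b" using w_bounds[OF K] by metis
  have "integrable M (\<lambda>x. norm (f x) powr p * \<omega> x powr p)"
  proof (rule integrable_compact_support[OF foc _ K, where B = "B powr p * b powr p"])
    show "(\<lambda>x. norm (f x) powr p * \<omega> x powr p) \<in> borel_measurable borel" using f by measurable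
    show "norm (norm (f x) powr p * \<omega> x powr p) \<le> B powr p * b powr p" if "x \<in> K" for x
      using B[OF that] ab(2)[OF that] w_pos[of x] p by (auto intro!: mult_mono powr_mono2)
    show "norm (f x) powr p * \<omega> x powr p = 0" if "x \<notin> K" for x using z[OF that] by simp
  qed
  then show ?thesis using f by (simp add: Lp_w_def)
qed

lemma pn_compact_support_le:
  assumes K: "compact K"
  shows "\<exists>C\<ge>0. \<forall>f\<in>borel_measurable borel. \<forall>d\<ge>0. (\<forall>x. x \<notin> K \<longrightarrow> f x = 0) \<longrightarrow> (\<forall>x\<in>K. norm (f x) \<le> d) \<longrightarrow> pn f \<le> C * d powr p"
proof -
  obtain a b where ab: "0 < b" "\<And>x. x \<in> K \<Longrightarrow> \<omega> x \<le> b" using w_bounds[OF K] by metis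
  have iK: "integrable M (\<lambda>x. b powr p * d powr p * indicator K x)" for d
    using finite_compact[OF K] compact_sets[OF K] by (simp add: less_top)
  have "pn f \<le> b powr p * measure M K * d powr p"
    if f: "f \<in> borel_measurable borel" and d: "0 \<le> d" "\<forall>x. x \<notin> K \<longrightarrow> f x = 0" "\<forall>x\<in>K. norm (f x) \<le> d" for f d
  proof -
    have "norm (f x) powr p * \<omega> x powr p \<le> b powr p * d powr p * indicator K x" for x
    proof (cases "x \<in> K")
      case True
      then have "norm (f x) powr p * \<omega> x powr p \<le> d powr p * b powr p"
        using d ab(2) w_pos[of x] p by (intro mult_mono powr_mono2) auto
      then show ?thesis using True by (simp add: mult.commute)
    qed (use d in simp)
    from Lp_dom(2)[OF f iK this] show ?thesis using K by (simp add: mult_ac)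
  qed
  then show ?thesis by (intro exI[of _ "b powr p * measure M K"]) auto
qed

lemma Lp_Cc: assumes k: "k \<in> Cc" shows "k \<in> Lp"
proof -
  obtain K where K: "compact K" "\<And>x. x \<notin> K \<Longrightarrow> k x = 0" using k by (auto simp: Cc_def)
  obtain B where B: "\<And>x. norm (k x) \<le> B" using Cc_bounded[OF k] by metis
  show ?thesis by (rule Lp_compact_support[OF Cc_measurable[OF k] K B])
qed

lemma Lp_indicator_compact: "compact K \<Longrightarrow> A \<in> sets borel \<Longrightarrow> A \<subseteq> K \<Longrightarrow> (indicator A :: 'g \<Rightarrow> complex) \<in> Lp"
  by (rule Lp_compact_support[where K = K and B = 1]) (auto simp: indicator_def)

text \<open>The weight is bounded below on K by a, so only an unweighted estimate on a set of finite
  measure remains.\<close>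

lemma Lp_loc_integrable:
  assumes K: "compact K"
  shows "\<exists>C>0. \<forall>f\<in>Lp. integrable M (\<lambda>x. indicator K x * f x) \<and> (\<integral>x. norm (indicator K x * f x) \<partial>M) \<le> C * pn f powr (1/p)"
proof -
  obtain a b where ab: "0 < a" "\<And>x. x \<in> K \<Longrightarrow> a \<le> \<omega> x" using w_bounds[OF K] by metis
  have iK: "integrable M (indicator K :: 'g \<Rightarrow> real)"
    using finite_compact[OF K] compact_sets[OF K] by (simp add: less_top)
  text \<open>Instead of Holder's inequality: $t \<le> \varepsilon + \varepsilon^{1-p} t^p$ with $\varepsilon$ the norm of $f$.\<close>
  have ineq: "norm (indicator K x * f x) \<le> 1/a * (e * indicator K x + e powr (1 - p) * (norm (f x) powr p * \<omega> x powr p))"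
    if e: "0 < e" for e x and f :: "'g \<Rightarrow> complex"
  proof (cases "x \<in> K")
    case True
    define t where "t = norm (f x) * \<omega> x"
    have t: "0 \<le> t" using w_pos[of x] by (simp add: t_def)
    have tp: "t powr p = norm (f x) powr p * \<omega> x powr p" using w_pos[of x] by (simp add: t_def powr_mult)
    have "t \<le> e + e powr (1 - p) * t powr p"
    proof (cases "t \<le> e")
      case True then show ?thesis using e by (simp add: add_increasing2)
    next
      case False
      then have "1 * t \<le> (e powr (1 - p) * t powr (p - 1)) * t"
      proof (intro mult_right_mono)
        have "1 = e powr (1 - p) * e powr (p - 1)" using e by (simp flip: powr_add)
        also have "\<dots> \<le> e powr (1 - p) * t powr (p - 1)"
          using False e p by (intro mult_left_mono powr_mono2) auto
        finally show "1 \<le> e powr (1 - p) * t powr (p - 1)" .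
      qed (use t in auto)
      also have "\<dots> = e powr (1 - p) * t powr p"
        using False e by (simp add: powr_diff)
      finally show ?thesis using e by simp
    qed
    moreover have "a * norm (f x) \<le> t" using ab(2)[OF True] by (simp add: t_def mult.commute mult_right_mono)
    ultimately have "a * norm (f x) \<le> e + e powr (1 - p) * t powr p" by simp
    then show ?thesis using True ab(1) by (simp add: tp field_simps)
  qed (use ab e in simp)
  have "integrable M (\<lambda>x. indicator K x * f x) \<and> (\<integral>x. norm (indicator K x * f x) \<partial>M) \<le> (1/a * (measure M K + 1)) * pn f powr (1/p)" if f: "f \<in> Lp" for f
  proof
    have u: "integrable M (\<lambda>x. 1/a * (e * indicator K x + e powr (1 - p) * (norm (f x) powr p * \<omega> x powr p)))" for e
      using iK Lp_int[OF f] by auto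
    show i: "integrable M (\<lambda>x. indicator K x * f x)"
    proof (rule Bochner_Integration.integrable_bound[OF u[of 1]])
      show "(\<lambda>x. indicator K x * f x) \<in> borel_measurable M"
        using Lp_meas[OF f] K by (simp add: borel_compact indicator_mult_meas)
      show "AE x in M. norm (indicator K x * f x) \<le> norm (1/a * (1 * indicator K x + 1 powr (1 - p) * (norm (f x) powr p * \<omega> x powr p)))"
        by (intro AE_I2 order_trans[OF ineq[of 1]]) (simp_all only: zero_less_one real_norm_def abs_ge_self)
    qed
    show "(\<integral>x. norm (indicator K x * f x) \<partial>M) \<le> (1/a * (measure M K + 1)) * pn f powr (1/p)"
    proof (cases "pn f = 0")
      case True
      then have "AE x in M. f x = 0" using pn_eq_0_iff[OF f] by simp
      then have "(\<integral>x. norm (indicator K x * f x) \<partial>M) = (\<integral>x. 0 \<partial>M)"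
        using i by (intro integral_cong_AE) (auto elim: eventually_mono)
      then show ?thesis using True p by simp
    next
      case False
      define e where "e = pn f powr (1/p)"
      have e: "0 < e" using False pn_nonneg[of f] by (simp add: e_def)
      have ep: "e powr (1 - p) * pn f = e"
      proof -
        have "pn f = e powr p" using p pn_nonneg[of f] by (simp add: e_def powr_powr)
        then show ?thesis using e by (simp flip: powr_add)
      qed
      have "(\<integral>x. norm (indicator K x * f x) \<partial>M) \<le> (\<integral>x. 1/a * (e * indicator K x + e powr (1 - p) * (norm (f x) powr p * \<omega> x powr p)) \<partial>M)"
        using ineq[OF e] by (intro integral_mono integrable_norm i u)
      also have "\<dots> = 1/a * (e * measure M K + e powr (1 - p) * pn f)"
        using iK Lp_int[OF f] by (simp add: pnorm_def)
      also have "\<dots> = (1/a * (measure M K + 1)) * e" unfolding ep by (simp add: algebra_simps add_divide_distrib)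
      finally show ?thesis by (simp add: e_def)
    qed
  qed
  moreover have "0 < 1/a * (measure M K + 1)"
    using ab(1) by (intro mult_pos_pos add_nonneg_pos) auto
  ultimately show ?thesis by (intro exI[of _ "1/a * (measure M K + 1)"] conjI ballI) auto
qed

text \<open>By Chebyshev's inequality the level sets \<open>A n\<close> have finite measure, and
  they exhaust the set where f is nonzero. Hence every element of \<open>Lp\<close> lives on a
  sigma-compact set up to a null set, whatever the size of the group.\<close>

lemma Lp_exhaustion:
  assumes f: "f \<in> Lp"
  shows "\<exists>L. (\<forall>j::nat. compact (L j)) \<and> (\<forall>j. L j \<subseteq> {x. f x \<noteq> 0}) \<and>
    (AE x in M. f x \<noteq> 0 \<longrightarrow> (\<exists>j0. \<forall>j\<ge>j0. x \<in> L j))"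
proof -
  let ?u = "\<lambda>x. norm (f x) powr p * \<omega> x powr p"
  define A where "A n = {x. 1 / real (Suc n) \<le> ?u x}" for n
  have um: "?u \<in> borel_measurable borel" using Lp_meas[OF f] by measurable
  have As: "A n \<in> sets borel" for n unfolding A_def using um by measurable
  have Af: "emeasure M (A n) < \<infinity>" for n
  proof -
    have "emeasure M (A n) = (\<integral>\<^sup>+x. indicator (A n) x \<partial>M)" using As by simp
    also have "\<dots> \<le> (\<integral>\<^sup>+x. ennreal (real (Suc n) * ?u x) \<partial>M)"
    proof (intro nn_integral_mono)
      fix x
      have "1 \<le> real (Suc n) * ?u x" if "x \<in> A n"
        using that by (simp add: A_def field_simps)
      then show "indicator (A n) x \<le> ennreal (real (Suc n) * ?u x)"
        by (auto simp: indicator_def ennreal_ge_1 simp del: of_nat_Suc)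
    qed
    also have "\<dots> = ennreal (\<integral>x. real (Suc n) * ?u x \<partial>M)"
      using Lp_int[OF f] by (intro nn_integral_eq_integral integrable_mult_right) auto
    also have "\<dots> < \<infinity>" by simp
    finally show ?thesis .
  qed
  have U: "(\<Union>n. A n) = {x. f x \<noteq> 0}"
  proof (intro set_eqI iffI)
    fix x assume "x \<in> {x. f x \<noteq> 0}"
    then have "0 < ?u x" using w_pos[of x] by simp
    then obtain n where "1 / real (Suc n) < ?u x" using nat_approx_posE by metis
    then show "x \<in> (\<Union>n. A n)" by (auto simp: A_def intro: less_imp_le)
  next
    fix x assume "x \<in> (\<Union>n. A n)"
    then obtain n where "1 / real (Suc n) \<le> ?u x" by (auto simp: A_def)
    moreover have "0 < 1 / real (Suc n)" by simp
    ultimately have "?u x \<noteq> 0" by linarith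
    then show "x \<in> {x. f x \<noteq> 0}" by auto
  qed
  show ?thesis
    using compact_exhaustion[of A, OF As Af] unfolding U by simp
qed

text \<open>A property that holds almost everywhere on each compact set need not combine into a
  global one over uncountably many compact sets; on the set where some f in \<open>Lp\<close> is
  nonzero, countably many suffice.\<close>

lemma AE_support_of_compacts:
  assumes f: "f \<in> Lp" and P: "\<And>K. compact K \<Longrightarrow> AE x in M. x \<in> K \<longrightarrow> P x"
  shows "AE x in M. f x \<noteq> 0 \<longrightarrow> P x"
proof -
  obtain L where L: "\<And>j::nat. compact (L j)" "AE x in M. f x \<noteq> 0 \<longrightarrow> (\<exists>j0. \<forall>j\<ge>j0. x \<in> L j)"
    using Lp_exhaustion[OF f] by blast
  have "AE x in M. \<forall>j. x \<in> L j \<longrightarrow> P x" unfolding AE_all_countable using P L(1) by blast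
  with L(2) show ?thesis by eventually_elim blast
qed

lemma Lp_dominated:
  assumes h: "h \<in> Lp" and G: "\<And>i. G i \<in> borel_measurable borel"
    and le: "\<And>i x. norm (G i x) \<le> C * norm (h x)" and C: "0 \<le> C" and lim: "AE x in M. (\<lambda>i. G i x) \<longlonglongrightarrow> 0"
  shows "(\<lambda>i. pn (G i)) \<longlonglongrightarrow> 0"
proof -
  have "(\<lambda>i. \<integral>x. norm (G i x) powr p * \<omega> x powr p \<partial>M) \<longlonglongrightarrow> (\<integral>x. 0 \<partial>M)"
  proof (rule integral_dominated_convergence)
    show "integrable M (\<lambda>x. C powr p * (norm (h x) powr p * \<omega> x powr p))" using Lp_int[OF h] by auto
    show "(\<lambda>x. norm (G i x) powr p * \<omega> x powr p) \<in> borel_measurable M" for i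
      using G[of i] by (auto intro!: measurable)
    show "AE x in M. (\<lambda>i. norm (G i x) powr p * \<omega> x powr p) \<longlonglongrightarrow> 0" using lim
    proof eventually_elim
      case (elim x)
      have "(\<lambda>i. norm (G i x) powr p) \<longlonglongrightarrow> 0"
        using p by (intro tendsto_zero_powrI[OF _ tendsto_const] tendsto_norm_zero elim) auto
      then show ?case using tendsto_mult_left_zero by blast
    qed
    show "AE x in M. norm (norm (G i x) powr p * \<omega> x powr p) \<le> C powr p * (norm (h x) powr p * \<omega> x powr p)" for i
    proof (intro AE_I2)
      fix x
      have "norm (G i x) powr p \<le> (C * norm (h x)) powr p" using le p by (intro powr_mono2) auto
      also have "\<dots> = C powr p * norm (h x) powr p" using C by (simp add: powr_mult)
      finally show "norm (norm (G i x) powr p * \<omega> x powr p) \<le> C powr p * (norm (h x) powr p * \<omega> x powr p)"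
        by (simp add: mult_right_mono flip: mult.assoc)
    qed
  qed auto
  then show ?thesis by (simp add: pnorm_def)
qed

text \<open>The inclusion of L j in the set where f is nonzero, and not merely in its closure, is
  what \<open>local_vanish\<close> exploits.\<close>

lemma Lp_cutoff:
  assumes f: "f \<in> Lp"
  shows "\<exists>L. (\<forall>j::nat. compact (L j)) \<and> (\<forall>j. L j \<subseteq> {x. f x \<noteq> 0}) \<and>
    (\<lambda>j. pn (\<lambda>x. indicator (L j) x * f x - f x)) \<longlonglongrightarrow> 0"
proof -
  obtain L where L: "\<And>j::nat. compact (L j)" "\<And>j. L j \<subseteq> {x. f x \<noteq> 0}"
    "AE x in M. f x \<noteq> 0 \<longrightarrow> (\<exists>j0. \<forall>j\<ge>j0. x \<in> L j)"
    using Lp_exhaustion[OF f] by blast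
  have "(\<lambda>j. pn (\<lambda>x. indicator (L j) x * f x - f x)) \<longlonglongrightarrow> 0"
  proof (rule Lp_dominated[OF f, where C = 1])
    show "(\<lambda>x. indicator (L j) x * f x - f x) \<in> borel_measurable borel" for j
      using Lp_meas[OF f] L(1)[of j] by (intro borel_measurable_diff indicator_mult_meas) (auto simp: borel_compact)
    show "AE x in M. (\<lambda>j. indicator (L j) x * f x - f x) \<longlonglongrightarrow> 0" using L(3)
    proof eventually_elim
      case (elim x)
      have "\<forall>\<^sub>F j in sequentially. indicator (L j) x * f x - f x = 0"
      proof (cases "f x = 0")
        case False
        then obtain j0 where "\<forall>j\<ge>j0. x \<in> L j" using elim by blast
        then show ?thesis unfolding eventually_sequentially by (intro exI[of _ j0]) auto
      qed simp
      then show ?case by (rule tendsto_eventually)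
    qed
  qed (auto simp: indicator_def)
  then show ?thesis using L by blast
qed

end

subsection \<open>Density and continuity of translations\<close>

context weighted_group
begin

lemma pn_triangle3:
  assumes "f \<in> Lp" "g \<in> Lp" "h \<in> Lp"
  shows "pn (\<lambda>x. f x + g x + h x) \<le> 4 powr p * (pn f + pn g + pn h)"
proof -
  have "pn (\<lambda>x. f x + g x + h x) \<le> 2 powr p * (pn (\<lambda>x. f x + g x) + pn h)"
    using Lp_add[OF Lp_add(1)[OF assms(1,2)] assms(3)] by simp
  also have "\<dots> \<le> 2 powr p * (2 powr p * (pn f + pn g) + 2 powr p * pn h)"
    using Lp_add(2)[OF assms(1,2)] pn_nonneg[of h] p ge_one_powr_ge_zero[of 2 p] mult_right_mono[of 1 "2 powr p" "pn h"]
    by (intro mult_left_mono add_mono) auto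
  also have "\<dots> = 4 powr p * (pn f + pn g + pn h)"
    using powr_mult[of 2 2 p] by (simp add: algebra_simps)
  finally show ?thesis .
qed

text \<open>Membership in the closure of \<open>Cc\<close> in \<open>Lp\<close>. It is established
  in turn for compact indicators, Borel subsets of compact sets, simple functions on compact sets,
  cutoffs, and finally all of \<open>Lp\<close>.\<close>

definition approx :: "('g \<Rightarrow> complex) \<Rightarrow> bool" where
  "approx f \<longleftrightarrow> f \<in> Lp \<and> (\<forall>e>0. \<exists>k\<in>Cc. pn (\<lambda>x. f x - k x) < e)"

lemma approx_limit:
  assumes f: "f \<in> Lp" and g: "\<And>i::nat. approx (g i)" and lim: "(\<lambda>i. pn (\<lambda>x. g i x - f x)) \<longlonglongrightarrow> 0"
  shows "approx f"
  unfolding approx_def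
proof (intro conjI f allI impI)
  fix e :: real assume e: "0 < e"
  define d where "d = e / (2 * 2 powr p)"
  have d: "0 < d" using e by (simp add: d_def)
  then obtain i where i: "pn (\<lambda>x. g i x - f x) < d"
    using order_tendstoD(2)[OF lim d] by (auto simp: eventually_sequentially)
  obtain k where k: "k \<in> Cc" "pn (\<lambda>x. g i x - k x) < d" using g[of i] d unfolding approx_def by blast
  have gi: "g i \<in> Lp" using g by (simp add: approx_def)
  have "pn (\<lambda>x. (f x - g i x) + (g i x - k x)) \<le> 2 powr p * (pn (\<lambda>x. f x - g i x) + pn (\<lambda>x. g i x - k x))"
    using Lp_add(2)[OF Lp_diff(1)[OF f gi] Lp_diff(1)[OF gi Lp_Cc[OF k(1)]]] .
  also have "\<dots> < 2 powr p * (d + d)"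
    using i k pn_minus_commute[of f "g i"] by (intro mult_strict_left_mono add_strict_mono) auto
  also have "\<dots> = e" by (simp add: d_def)
  finally show "\<exists>k\<in>Cc. pn (\<lambda>x. f x - k x) < e" using k by (auto intro!: bexI[of _ k])
qed

lemma approx_0: "approx (\<lambda>_. 0)"
proof -
  have "(\<lambda>_. 0) \<in> Cc" by (auto simp: Cc_def)
  then show ?thesis unfolding approx_def using Lp_0 by (auto intro!: bexI[of _ "\<lambda>_. 0"])
qed

lemma approx_add:
  assumes f: "approx f" and g: "approx g"
  shows "approx (\<lambda>x. f x + a * g x)"
  unfolding approx_def
proof (intro conjI allI impI)
  have L: "f \<in> Lp" "g \<in> Lp" using f g by (auto simp: approx_def)
  show "(\<lambda>x. f x + a * g x) \<in> Lp" using L by (intro Lp_add Lp_cmult)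
  fix e :: real assume e: "0 < e"
  define d where "d = e / (2 powr p * (1 + (norm a powr p + 1)))"
  have d: "0 < d" unfolding d_def using e by (intro divide_pos_pos mult_pos_pos add_pos_nonneg) auto
  obtain k l where k: "k \<in> Cc" "pn (\<lambda>x. f x - k x) < d" and l: "l \<in> Cc" "pn (\<lambda>x. g x - l x) < d"
    using f g d unfolding approx_def by blast
  have kl: "(\<lambda>x. k x + a * l x) \<in> Cc"
    using Cc_add[OF k(1) Cc_mult[OF l(1), of "\<lambda>_. a"]] by (simp add: mult.commute)
  have D: "(\<lambda>x. f x - k x) \<in> Lp" "(\<lambda>x. g x - l x) \<in> Lp" using L k l by (auto intro: Lp_diff Lp_Cc)
  have "pn (\<lambda>x. (f x - k x) + a * (g x - l x)) \<le> 2 powr p * (pn (\<lambda>x. f x - k x) + pn (\<lambda>x. a * (g x - l x)))"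
    using Lp_add(2)[OF D(1) Lp_cmult(1)[OF D(2)]] .
  also have "\<dots> = 2 powr p * (pn (\<lambda>x. f x - k x) + norm a powr p * pn (\<lambda>x. g x - l x))"
    using Lp_cmult(2)[OF D(2)] by simp
  also have "\<dots> \<le> 2 powr p * (pn (\<lambda>x. f x - k x) + (norm a powr p + 1) * pn (\<lambda>x. g x - l x))"
    using pn_nonneg[of "\<lambda>x. g x - l x"] by (intro mult_left_mono add_left_mono mult_right_mono) auto
  also have "\<dots> < 2 powr p * (d + (norm a powr p + 1) * d)"
    using k l by (intro mult_strict_left_mono add_strict_mono mult_strict_left_mono) (auto intro: add_nonneg_pos)
  also have "\<dots> = d * (2 powr p * (1 + (norm a powr p + 1)))" by (simp add: algebra_simps)
  also have "\<dots> = e"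
  proof -
    have "0 < 2 powr p * (1 + (norm a powr p + 1))" by (intro mult_pos_pos add_pos_nonneg) auto
    then show ?thesis unfolding d_def by (subst nonzero_eq_divide_eq[symmetric]) auto
  qed
  finally have "pn (\<lambda>x. (f x - k x) + a * (g x - l x)) < e" .
  then show "\<exists>k\<in>Cc. pn (\<lambda>x. f x + a * g x - k x) < e"
    using kl by (intro bexI[of _ "\<lambda>x. k x + a * l x"]) (auto simp: algebra_simps)
qed

lemma approx_indicator_compact:
  assumes A: "compact A" shows "approx (indicator A)"
  unfolding approx_def
proof (intro conjI allI impI)
  show AL: "indicator A \<in> Lp" using A by (auto intro: Lp_indicator_compact borel_compact)
  \<comment> \<open>Keeping every neighbourhood of A inside K bounds the weight by b there, so the
    error is at most b^p times the measure of U - A.\<close>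
  obtain W K where W: "open W" "compact K" "A \<subseteq> W" "W \<subseteq> K"
    using compact_nbhd_base_compact[OF lc A open_UNIV] by auto
  obtain b where b: "0 < b" "\<And>x. x \<in> K \<Longrightarrow> \<omega> x \<le> b" using w_bounds[OF W(2)] by metis
  fix e :: real assume e: "0 < e"
  define d where "d = e / b powr p"
  have d: "0 < d" using e b by (simp add: d_def)
  have As: "A \<in> sets borel" by (rule borel_compact[OF A])
  obtain U where U: "open U" "A \<subseteq> U" "U \<subseteq> W" and UA: "emeasure M (U - A) < ennreal d"
    using outer_regular_compact[OF A W(1,3) d] by blast
  have UK: "U \<subseteq> K" using U(3) W(4) by blast
  have UAs: "U - A \<in> sets M" using U As by auto
  from UA have "ennreal (measure M (U - A)) < ennreal d"
    using emeasure_eq_ennreal_measure[of M "U - A"] by (metis ennreal_less_top order_less_trans less_irrefl)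
  then have mUA: "measure M (U - A) < d" by (simp add: ennreal_less_iff)
  obtain k :: "'g \<Rightarrow> real" and L where k: "continuous_on UNIV k" "\<And>x. 0 \<le> k x" "\<And>x. k x \<le> 1"
    "\<forall>x\<in>A. k x = 1" "compact L" "L \<subseteq> U" "\<And>x. x \<notin> L \<Longrightarrow> k x = 0"
    using urysohn_bump[OF lc A U(1,2)] by metis
  have kC: "(\<lambda>x. complex_of_real (k x)) \<in> Cc" by (rule Cc_of_real[OF k(1,5,7)])
  have i: "integrable M (\<lambda>x. b powr p * indicator (U - A) x)"
    using UA UAs by (intro integrable_mult_right) (simp add: order_less_trans[OF _ ennreal_less_top])
  have m: "(\<lambda>x. indicator A x - complex_of_real (k x)) \<in> borel_measurable borel"
    using Cc_measurable[OF kC] As by (intro borel_measurable_diff borel_measurable_indicator)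
  have "norm (indicator A x - complex_of_real (k x)) powr p * \<omega> x powr p \<le> b powr p * indicator (U - A) x" for x
  proof (cases "x \<in> U - A")
    case True
    have "norm (indicator A x - complex_of_real (k x)) powr p * \<omega> x powr p \<le> 1 powr p * b powr p"
      using True k(2,3)[of x] b(2)[of x] UK w_pos[of x] p by (intro mult_mono powr_mono2) auto
    then show ?thesis using True by simp
  next
    case False
    then have "indicator A x - complex_of_real (k x) = 0"
      using k(4) k(7)[of x] k(6) U by (cases "x \<in> A") auto
    then show ?thesis using False by simp
  qed
  from Lp_dom(2)[OF m i this] have "pn (\<lambda>x. indicator A x - complex_of_real (k x)) \<le> b powr p * measure M (U - A)"
    using UAs by simp
  also have "\<dots> < b powr p * d" using mUA b by simp
  also have "\<dots> = e" using b by (simp add: d_def)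
  finally show "\<exists>k\<in>Cc. pn (\<lambda>x. indicator A x - k x) < e" by (rule bexI[OF _ kC])
qed

lemma approx_indicator:
  assumes K: "compact K" and A: "A \<in> sets borel" "A \<subseteq> K"
  shows "approx (indicator A)"
proof -
  have f: "indicator A \<in> Lp" by (rule Lp_indicator_compact[OF K A])
  obtain L where L: "\<And>j::nat. compact (L j)" "\<And>j. L j \<subseteq> {x. (indicator A x :: complex) \<noteq> 0}"
    "(\<lambda>j. pn (\<lambda>x. indicator (L j) x * indicator A x - indicator A x)) \<longlonglongrightarrow> 0"
    using Lp_cutoff[OF f] by blast
  have "indicator (L j) x * indicator A x = (indicator (L j) x :: complex)" for j x
    using L(2)[of j] by (auto simp: indicator_def)
  then have "(\<lambda>j. pn (\<lambda>x. indicator (L j) x - indicator A x)) \<longlonglongrightarrow> 0" using L(3) by (simp only:)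
  then show ?thesis by (rule approx_limit[OF f approx_indicator_compact[OF L(1)]])
qed

lemma approx_simple:
  assumes K: "compact K" and F: "simple_function M F" and z: "\<And>x. x \<notin> K \<Longrightarrow> F x = 0"
  shows "approx F"
proof -
  have fin: "finite (range F)" using simple_functionD(1)[OF F] by simp
  have app: "approx (\<lambda>x. \<Sum>v\<in>S. v * indicator (F -` {v}) x)" if S: "finite S" "S \<subseteq> range F - {0}" for S
    using S
  proof (induction S rule: finite_induct)
    case empty show ?case using approx_0 by simp
  next
    case (insert v S)
    have "F -` {v} \<in> sets borel" using simple_functionD(2)[OF F, of "{v}"] by simp
    moreover have "F -` {v} \<subseteq> K" using z insert.prems by auto
    ultimately have "approx (indicator (F -` {v}))" by (intro approx_indicator[OF K])
    then have "approx (\<lambda>x. (\<Sum>v\<in>S. v * indicator (F -` {v}) x) + v * indicator (F -` {v}) x)"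
      using insert by (intro approx_add) auto
    moreover have "(\<lambda>x. \<Sum>v\<in>insert v S. v * indicator (F -` {v}) x) = (\<lambda>x. (\<Sum>v\<in>S. v * indicator (F -` {v}) x) + v * indicator (F -` {v}) x)"
      unfolding sum.insert[OF insert.hyps] by (simp only: add.commute)
    ultimately show ?case by (simp only:)
  qed
  have "(\<Sum>v\<in>range F - {0}. v * indicator (F -` {v}) x) = F x" for x
  proof -
    have "(\<Sum>v\<in>range F - {0}. v * indicator (F -` {v}) x) = (\<Sum>v\<in>range F - {0}. if v = F x then v else 0)"
      by (intro sum.cong) (auto simp: indicator_def)
    also have "\<dots> = F x" using fin sum.delta[of "range F - {0}" "F x" "\<lambda>v. v"] by auto
    finally show ?thesis .
  qed
  then show ?thesis using app[of "range F - {0}"] fin by simp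
qed

lemma simple_approximation:
  fixes f :: "'g \<Rightarrow> complex"
  assumes f: "f \<in> borel_measurable borel"
  shows "\<exists>F. (\<forall>i::nat. simple_function M (F i)) \<and> (\<forall>x. (\<lambda>i. F i x) \<longlonglongrightarrow> f x) \<and> (\<forall>i x. norm (F i x) \<le> 2 * norm (f x))"
  using borel_measurable_implies_sequence_metric[of f M 0] f by simp

lemma simple_meas: "simple_function M F \<Longrightarrow> F \<in> borel_measurable borel"
  for F :: "'g \<Rightarrow> complex"
  using borel_measurable_simple_function by fastforce

lemma approx_Lp:
  assumes f: "f \<in> Lp" shows "approx f"
proof -
  obtain L where L: "\<And>j::nat. compact (L j)" "(\<lambda>j. pn (\<lambda>x. indicator (L j) x * f x - f x)) \<longlonglongrightarrow> 0"
    using Lp_cutoff[OF f] by blast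
  show ?thesis
  proof (rule approx_limit[OF f _ L(2)])
    fix j
    have Ls: "L j \<in> sets borel" using L(1) by (rule borel_compact)
    have g: "(\<lambda>x. indicator (L j) x * f x) \<in> Lp" by (rule Lp_indicator(1)[OF f Ls])
    obtain F where F: "\<And>i::nat. simple_function M (F i)" "\<And>x. (\<lambda>i. F i x) \<longlonglongrightarrow> indicator (L j) x * f x"
      "\<And>i x. norm (F i x) \<le> 2 * norm (indicator (L j) x * f x)"
      using simple_approximation[OF Lp_meas[OF g]] by blast
    show "approx (\<lambda>x. indicator (L j) x * f x)"
    proof (rule approx_limit[OF g])
      show "approx (F i)" for i
      proof (rule approx_simple[OF L(1)[of j] F(1)])
        show "F i x = 0" if "x \<notin> L j" for x using F(3)[of i x] that by simp
      qed
      show "(\<lambda>i. pn (\<lambda>x. F i x - indicator (L j) x * f x)) \<longlonglongrightarrow> 0"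
      proof (rule Lp_dominated[OF g, where C = 3])
        show "(\<lambda>x. F i x - indicator (L j) x * f x) \<in> borel_measurable borel" for i
          using simple_meas[OF F(1)] Lp_meas[OF g] by (intro borel_measurable_diff)
        show "norm (F i x - indicator (L j) x * f x) \<le> 3 * norm (indicator (L j) x * f x)" for i x
          using norm_triangle_ineq4[of "F i x" "indicator (L j) x * f x"] F(3)[of i x] by simp
        show "AE x in M. (\<lambda>i. F i x - indicator (L j) x * f x) \<longlonglongrightarrow> 0"
          using F(2) by (intro AE_I2) (simp add: LIM_zero)
      qed simp
    qed
  qed
qed

lemma dense_Cc:
  assumes "f \<in> Lp" "0 < e" shows "\<exists>k\<in>Cc. pn (\<lambda>x. f x - k x) < e"
  using approx_Lp[OF assms(1)] assms(2) unfolding approx_def by blast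

lemma ltrans_continuous_Cc:
  assumes k: "k \<in> Cc" and e: "0 < e"
  shows "\<exists>V. open V \<and> 0 \<in> V \<and> (\<forall>a\<in>V. pn (\<lambda>z. ltrans a k z - k z) < e)"
proof -
  obtain K where K: "continuous_on UNIV k" "compact K" "\<And>x. x \<notin> K \<Longrightarrow> k x = 0" using k by (auto simp: Cc_def)
  obtain V0 K0 where V0: "open V0" "compact K0" "(0::'g) \<in> V0" "V0 \<subseteq> K0"
    using compact_nbhd_base[OF lc open_UNIV, of 0] by auto
  define L where "L = (\<lambda>(x, y). x + y) ` (K0 \<times> K)"
  have L: "compact L" unfolding L_def by (intro compact_plus V0 K)
  have z: "ltrans a k y - k y = 0" if "a \<in> V0" "y \<notin> L" for a y
  proof -
    have "- a + y \<notin> K"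
    proof
      assume "- a + y \<in> K"
      then have "a + (- a + y) \<in> L" unfolding L_def using that V0 by (intro image_eqI[of _ _ "(a, - a + y)"]) auto
      then show False using that by (simp add: add.assoc[symmetric])
    qed
    moreover have "y \<notin> K"
    proof
      assume "y \<in> K"
      then have "0 + y \<in> L" unfolding L_def using V0 by (intro image_eqI[of _ _ "(0, y)"]) auto
      then show False using that by simp
    qed
    ultimately show ?thesis using K(3) by (simp add: ltrans_def)
  qed
  obtain C where C: "0 \<le> C" "\<forall>f\<in>borel_measurable borel. \<forall>d\<ge>0. (\<forall>x. x \<notin> L \<longrightarrow> f x = 0) \<longrightarrow> (\<forall>x\<in>L. norm (f x) \<le> d) \<longrightarrow> pn f \<le> C * d powr p"
    using pn_compact_support_le[OF L] by blast
  \<comment> \<open>Chosen so that C * d^p = e * C / (C + 1), which is below e even when C =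
    0.\<close>
  define d where "d = (e / (C + 1)) powr (1/p)"
  have d: "0 < d" using e C by (auto simp: d_def)
  have dp: "C * d powr p < e"
  proof -
    have "d powr p = e / (C + 1)" using e C p by (simp add: d_def powr_powr)
    moreover have "C * (e / (C + 1)) < e" using e C by (simp add: field_simps)
    ultimately show ?thesis by simp
  qed
  have c: "continuous_on UNIV (\<lambda>z. k (- fst z + snd z))"
    by (rule continuous_on_compose2[OF K(1)]) (auto intro!: continuous_intros)
  have "\<exists>V. open V \<and> 0 \<in> V \<and> (\<forall>a\<in>V. \<forall>y\<in>L. dist (k (- a + y)) (k y) < d)"
    using tube_dist[OF c L d, of 0] by simp
  then obtain V1 where V1: "open V1" "0 \<in> V1" "\<forall>a\<in>V1. \<forall>y\<in>L. dist (k (- a + y)) (k y) < d"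
    by blast
  have "pn (\<lambda>z. ltrans a k z - k z) < e" if a: "a \<in> V0 \<inter> V1" for a
  proof -
    have "(\<lambda>z. ltrans a k z - k z) \<in> borel_measurable borel"
      using Lp_meas[OF Lp_diff(1)[OF Lp_ltrans(1)[OF Lp_Cc[OF k]] Lp_Cc[OF k]]] .
    moreover have "\<forall>x\<in>L. norm (ltrans a k x - k x) \<le> d"
      using V1(3) a by (auto simp: ltrans_def dist_norm less_imp_le)
    ultimately have "pn (\<lambda>z. ltrans a k z - k z) \<le> C * d powr p"
      using C(2) d z a by simp
    then show ?thesis using dp by simp
  qed
  then show ?thesis using V0 V1 by (intro exI[of _ "V0 \<inter> V1"]) auto
qed

lemma ltrans_continuous:
  assumes f: "f \<in> Lp" and e: "0 < e"
  shows "\<exists>V. open V \<and> 0 \<in> V \<and> (\<forall>a\<in>V. pn (\<lambda>z. ltrans a f z - f z) < e)"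
proof -
  obtain V0 K0 where V0: "open V0" "compact K0" "(0::'g) \<in> V0" "V0 \<subseteq> K0"
    using compact_nbhd_base[OF lc open_UNIV, of 0] by auto
  obtain b where b: "0 < b" "\<And>x. x \<in> K0 \<Longrightarrow> \<omega> x \<le> b" using w_bounds[OF V0(2)] by metis
  \<comment> \<open>The factor 4^p is the price of a three-term sum. The terms are the translated
    error f - k, bounded by b^p * d, the modulus of continuity of k, and the error k - f.\<close>
  define d where "d = e / (4 powr p * (b powr p + 2))"
  have d: "0 < d" unfolding d_def using e by (intro divide_pos_pos mult_pos_pos add_nonneg_pos) auto
  obtain k where k: "k \<in> Cc" "pn (\<lambda>x. f x - k x) < d" using dense_Cc[OF f d] by blast
  obtain V1 where V1: "open V1" "0 \<in> V1" "\<forall>a\<in>V1. pn (\<lambda>z. ltrans a k z - k z) < d"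
    using ltrans_continuous_Cc[OF k(1) d] by blast
  have "pn (\<lambda>z. ltrans a f z - f z) < e" if a: "a \<in> V0 \<inter> V1" for a
  proof -
    have kL: "k \<in> Lp" by (rule Lp_Cc[OF k(1)])
    have D: "(\<lambda>x. f x - k x) \<in> Lp" by (rule Lp_diff(1)[OF f kL])
    have 1: "pn (ltrans a (\<lambda>x. f x - k x)) \<le> b powr p * pn (\<lambda>x. f x - k x)"
    proof (rule order_trans[OF Lp_ltrans(2)[OF D] mult_right_mono])
      show "\<omega> a powr p \<le> b powr p" using a V0 b w_pos[of a] p by (intro powr_mono2) auto
    qed (rule pn_nonneg)
    have "(\<lambda>z. ltrans a f z - f z) = (\<lambda>z. ltrans a (\<lambda>x. f x - k x) z + (ltrans a k z - k z) + (k z - f z))"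
      by (auto simp: ltrans_def)
    then have "pn (\<lambda>z. ltrans a f z - f z) \<le> 4 powr p * (pn (ltrans a (\<lambda>x. f x - k x)) + pn (\<lambda>z. ltrans a k z - k z) + pn (\<lambda>z. k z - f z))"
      using pn_triangle3[OF Lp_ltrans(1)[OF D] Lp_diff(1)[OF Lp_ltrans(1)[OF kL] kL] Lp_diff(1)[OF kL f], of a] by simp
    also have "\<dots> < 4 powr p * (b powr p * d + d + d)"
    proof (intro mult_strict_left_mono add_le_less_mono add_strict_mono)
      have "pn (ltrans a (\<lambda>x. f x - k x)) + pn (\<lambda>z. ltrans a k z - k z) < b powr p * d + d"
        using 1 k(2) V1(3) a mult_left_mono[of "pn (\<lambda>x. f x - k x)" d "b powr p"] by (intro add_le_less_mono) auto
      then show "pn (ltrans a (\<lambda>x. f x - k x)) + pn (\<lambda>z. ltrans a k z - k z) \<le> b powr p * d + d" by simp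
      show "pn (\<lambda>z. k z - f z) < d" using k(2) pn_minus_commute[of f k] by simp
    qed auto
    also have "\<dots> = d * (4 powr p * (b powr p + 2))" by (simp add: algebra_simps)
    also have "\<dots> = e"
    proof -
      have "0 < 4 powr p * (b powr p + 2)" by (intro mult_pos_pos add_nonneg_pos) auto
      then show ?thesis unfolding d_def by (subst nonzero_eq_divide_eq[symmetric]) auto
    qed
    finally show ?thesis .
  qed
  then show ?thesis using V0 V1 by (intro exI[of _ "V0 \<inter> V1"]) auto
qed

end

subsection \<open>Convolution\<close>

text \<open>A tagged Borel partition of K. A tag belongs to K but possibly not to its own piece;
  only the inclusion of the piece in the neighbourhood of the tag matters.\<close>

definition subordinate :: "'a set \<Rightarrow> ('a \<Rightarrow> 'a::topological_space set) \<Rightarrow> 'a set \<Rightarrow> ('a \<Rightarrow> 'a set) \<Rightarrow> bool" where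
  "subordinate K V X A \<longleftrightarrow> finite X \<and> X \<subseteq> K \<and> (\<forall>x\<in>X. A x \<in> sets borel \<and> A x \<subseteq> V x) \<and>
     disjoint_family_on A X \<and> (\<Union>x\<in>X. A x) = K"

lemma subordinate_exists:
  fixes K :: "'a::t2_space set"
  assumes "compact K" "\<And>x. open (V x)" "\<And>x. x \<in> V x"
  shows "\<exists>X A. subordinate K V X A"
  using compact_borel_partition[OF assms(1), of V] assms(2,3) unfolding subordinate_def by metis

lemma subordinate_mono:
  "subordinate K V X A \<Longrightarrow> (\<And>x. V x \<subseteq> W x) \<Longrightarrow> subordinate K W X A"
  unfolding subordinate_def by blast

context weighted_group
begin

lemma conv_Lp: "f \<in> Lp \<Longrightarrow> g \<in> Lp \<Longrightarrow> conv M f g \<in> Lp"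
  using ca by (simp add: conv_algebra_def)

lemma reflect_meas:
  fixes g :: "'g \<Rightarrow> 'b::topological_space"
  assumes "g \<in> borel_measurable borel" shows "(\<lambda>y. g (- y + x)) \<in> borel_measurable borel"
  by (rule borel_measurable_continuous_compose[OF assms]) (auto intro!: continuous_intros)

lemma conv_Cc_support:
  fixes k :: "'g \<Rightarrow> complex"
  assumes K: "\<And>x. x \<notin> K \<Longrightarrow> k x = 0" and x: "x \<in> Q" and y: "y \<notin> (\<lambda>(x, y). x + y) ` (Q \<times> uminus ` K)"
  shows "k (- y + x) = (0::complex)"
proof (rule K, rule notI)
  assume "- y + x \<in> K"
  then have "x + - (- y + x) \<in> (\<lambda>(x, y). x + y) ` (Q \<times> uminus ` K)" using x by force
  moreover have "x + - (- y + x) = y"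
  proof -
    have "- (- y + x) = - x + y" by (simp add: minus_add)
    then show ?thesis by (simp add: add.assoc[symmetric])
  qed
  ultimately show False using y by simp
qed

lemma conv_Cc_integrable:
  assumes f: "f \<in> Lp" and k: "k \<in> Cc" shows "integrable M (\<lambda>y. f y * k (- y + x))"
proof -
  obtain K where K: "continuous_on UNIV k" "compact K" "\<And>x. x \<notin> K \<Longrightarrow> k x = 0" using k by (auto simp: Cc_def)
  define L where "L = (\<lambda>(x, y). x + y) ` ({x} \<times> uminus ` K)"
  have L: "compact L" unfolding L_def by (intro compact_plus compact_uminus K) auto
  have z: "k (- y + x) = 0" if "y \<notin> L" for y
    using conv_Cc_support[of K k x "{x}" y] K(3) that by (simp add: L_def)
  have c: "continuous_on UNIV (\<lambda>y. k (- y + x))"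
    by (rule continuous_on_compose2[OF K(1)]) (auto intro!: continuous_intros)
  have "integrable M (\<lambda>y. indicator L y * f y)" using Lp_loc_integrable[OF L] f by blast
  then show ?thesis by (rule integrable_mult_continuous[OF foc L _ c z])
qed

text \<open>Continuity is checked on a neighbourhood V of x inside a compact Q: for points of Q all
  kernels y |-> k (- y + x) are supported in the single compact set L.\<close>

lemma conv_Cc_continuous:
  assumes f: "f \<in> Lp" and k: "k \<in> Cc" shows "continuous_on UNIV (conv M f k)"
proof -
  obtain K where K: "continuous_on UNIV k" "compact K" "\<And>x. x \<notin> K \<Longrightarrow> k x = 0" using k by (auto simp: Cc_def)
  have "isCont (conv M f k) x" for x
  proof -
    obtain V Q where V: "open V" "compact Q" "x \<in> V" "V \<subseteq> Q"
      using compact_nbhd_base[OF lc open_UNIV, of x] by auto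
    define L where "L = (\<lambda>(x, y). x + y) ` (Q \<times> uminus ` K)"
    have L: "compact L" unfolding L_def by (intro compact_plus compact_uminus K V)
    have z: "k (- snd (x', y) + fst (x', y)) = 0" if "x' \<in> V" "y \<notin> L" for x' y
      using conv_Cc_support[of K k x' Q y] K(3) that V by (auto simp: L_def)
    have c: "continuous_on UNIV (\<lambda>z. k (- snd z + fst z))"
      by (rule continuous_on_compose2[OF K(1)]) (auto intro!: continuous_intros)
    have i: "integrable M (\<lambda>y. indicator L y * f y)" using Lp_loc_integrable[OF L] f by blast
    have "continuous_on V (\<lambda>x. \<integral>y. f y * k (- snd (x, y) + fst (x, y)) \<partial>M)"
      by (rule continuous_param_integral[OF foc c L V(1) z i])
    then have "continuous_on V (conv M f k)" by (simp add: conv_def[abs_def])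
    then show ?thesis using V by (simp add: continuous_on_eq_continuous_at)
  qed
  then show ?thesis by (simp add: continuous_at_imp_continuous_on)
qed

text \<open>Evaluation of f * k at a point is continuous in f for the \<open>Lp\<close> norm. This
  is what allows identities between convolutions to pass to limits in f.\<close>

lemma conv_Cc_bound:
  assumes k: "k \<in> Cc" shows "\<exists>C>0. \<forall>f\<in>Lp. norm (conv M f k x) \<le> C * pn f powr (1/p)"
proof -
  obtain K where K: "continuous_on UNIV k" "compact K" "\<And>x. x \<notin> K \<Longrightarrow> k x = 0" using k by (auto simp: Cc_def)
  obtain B where B: "0 < B" "\<And>x. norm (k x) \<le> B" using Cc_bounded[OF k] by metis
  define L where "L = (\<lambda>(x, y). x + y) ` ({x} \<times> uminus ` K)"
  have L: "compact L" unfolding L_def by (intro compact_plus compact_uminus K) auto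
  have z: "k (- y + x) = 0" if "y \<notin> L" for y
    using conv_Cc_support[of K k x "{x}" y] K(3) that by (simp add: L_def)
  obtain C where C: "0 < C" "\<forall>f\<in>Lp. integrable M (\<lambda>x. indicator L x * f x) \<and> (\<integral>x. norm (indicator L x * f x) \<partial>M) \<le> C * pn f powr (1/p)"
    using Lp_loc_integrable[OF L] by blast
  have "norm (conv M f k x) \<le> B * C * pn f powr (1/p)" if f: "f \<in> Lp" for f
  proof -
    have i: "integrable M (\<lambda>x. indicator L x * f x)" using C f by blast
    have "norm (conv M f k x) \<le> (\<integral>y. B * norm (indicator L y * f y) \<partial>M)"
      unfolding conv_def
    proof (rule norm_lebesgue_integral_le[OF conv_Cc_integrable[OF f k]])
      show "integrable M (\<lambda>y. B * norm (indicator L y * f y))" using i by (intro integrable_mult_right integrable_norm)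
      show "norm (f y * k (- y + x)) \<le> B * norm (indicator L y * f y)" for y
        using z[of y] mult_left_mono[OF B(2)[of "- y + x"], of "norm (f y)"] by (cases "y \<in> L") (auto simp: norm_mult mult.commute[of B])
    qed
    also have "\<dots> = B * (\<integral>y. norm (indicator L y * f y) \<partial>M)" by simp
    also have "\<dots> \<le> B * (C * pn f powr (1/p))" using C f B by (intro mult_left_mono) auto
    finally show ?thesis by (simp add: mult.assoc)
  qed
  then show ?thesis using B C by (intro exI[of _ "B * C"]) auto
qed

lemma conv_cmult_left: "conv M (\<lambda>x. a * f x) k x = a * conv M f k x"
  unfolding conv_def by (simp add: mult.assoc)

lemma conv_diff_left:
  assumes "f \<in> Lp" "g \<in> Lp" "k \<in> Cc"
  shows "conv M (\<lambda>x. f x - g x) k x = conv M f k x - conv M g k x"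
  unfolding conv_def using conv_Cc_integrable[OF assms(1,3)] conv_Cc_integrable[OF assms(2,3)]
  by (simp add: left_diff_distrib)

lemma conv_ltrans:
  assumes "f \<in> borel_measurable borel" "g \<in> borel_measurable borel"
  shows "conv M (ltrans a f) g = ltrans a (conv M f g)"
proof
  fix x
  have "(\<lambda>y. f (- a + y) * g (- y + x)) \<in> borel_measurable borel"
    by (intro borel_measurable_times reflect_meas assms borel_measurable_continuous_compose[OF assms(1)]) (auto intro!: continuous_intros)
  from integral_plus[OF this, of a]
  have "(\<integral>y. f (- a + y) * g (- y + x) \<partial>M) = (\<integral>y. f (- a + (a + y)) * g (- (a + y) + x) \<partial>M)" by simp
  then show "conv M (ltrans a f) g x = ltrans a (conv M f g) x"
    by (simp add: conv_def ltrans_def add.assoc[symmetric] minus_add diff_conv_add_uminus del: add_uminus_conv_diff)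
qed

lemma conv_cong_left:
  assumes "f \<in> borel_measurable borel" "f' \<in> borel_measurable borel" "g \<in> borel_measurable borel"
    and "AE x in M. f x = f' x"
  shows "conv M f g = conv M f' g"
proof
  fix x
  have "(\<lambda>y. f y * g (- y + x)) \<in> borel_measurable borel" "(\<lambda>y. f' y * g (- y + x)) \<in> borel_measurable borel"
    using assms by (auto intro!: borel_measurable_times reflect_meas)
  then show "conv M f g x = conv M f' g x"
    unfolding conv_def using assms(4) by (intro integral_cong_AE) (auto elim: eventually_mono)
qed

lemma AE_reflect_compact:
  assumes K: "compact K" and P: "AE y in M. P y"
  shows "AE y in M. y \<in> K \<longrightarrow> P (- y + x)"
proof -
  have "compact ((+) (- x) ` K)" using K by (intro compact_continuous_image continuous_intros)
  from AE_plus[OF AE_uminus_compact[OF this P], of "- x"] show ?thesis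
    by eventually_elim (simp add: minus_add diff_conv_add_uminus del: add_uminus_conv_diff)
qed

text \<open>The map y |-> - y + x is controlled on null sets only within compact sets, by
  \<open>inversion_bound\<close>, and f is carried almost everywhere by countably many of those. So
  convolution is well defined on classes in the right factor as well.\<close>

lemma conv_cong_right:
  assumes f: "f \<in> Lp" and g: "g \<in> borel_measurable borel" "g' \<in> borel_measurable borel"
    and eq: "AE x in M. g x = g' x"
  shows "conv M f g = conv M f g'"
proof
  fix x
  have m: "(\<lambda>y. f y * g (- y + x)) \<in> borel_measurable borel" "(\<lambda>y. f y * g' (- y + x)) \<in> borel_measurable borel"
    using Lp_meas[OF f] g by (auto intro!: borel_measurable_times reflect_meas)
  have "AE y in M. f y \<noteq> 0 \<longrightarrow> g (- y + x) = g' (- y + x)"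
    by (rule AE_support_of_compacts[OF f AE_reflect_compact[OF _ eq]])
  then show "conv M f g x = conv M f g' x"
    unfolding conv_def using m by (intro integral_cong_AE) (auto elim: eventually_mono)
qed

lemma nn_integral_plus:
  assumes "u \<in> borel_measurable borel"
  shows "(\<integral>\<^sup>+y. u (x + y) \<partial>M) = (\<integral>\<^sup>+y. u y \<partial>M)"
  using nn_integral_distr[OF measurable_plus, of u x] assms by (simp add: distr_plus)

text \<open>Counterpart of \<open>Lp_loc_integrable\<close> for the right factor of a convolution.
  Translating by x turns y |-> - y + x into plain inversion on the compact set K1, where
  \<open>nn_integral_uminus_compact\<close> applies.\<close>

lemma reflect_loc_integrable:
  assumes K: "compact K"
  shows "\<exists>C>0. \<forall>h\<in>Lp. integrable M (\<lambda>y. indicator K y * h (- y + x)) \<and>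
    (\<integral>y. norm (indicator K y * h (- y + x)) \<partial>M) \<le> C * pn h powr (1/p)"
proof -
  define K1 where "K1 = (+) (- x) ` K"
  have K1: "compact K1" unfolding K1_def using K by (intro compact_continuous_image continuous_intros)
  have K2: "compact (uminus ` K1)" by (rule compact_uminus[OF K1])
  have Ks: "K \<in> sets borel" "uminus ` K1 \<in> sets borel" using K K2 by (auto intro: borel_compact)
  have inK: "x + y \<in> K \<longleftrightarrow> y \<in> K1" for y
    unfolding K1_def by (metis (no_types, opaque_lifting) add.assoc add.left_inverse add.left_neutral add.right_inverse image_iff)
  obtain C where C: "0 < C" "\<forall>u\<in>borel_measurable borel. (\<integral>\<^sup>+y. indicator K1 y * u (- y) \<partial>M) \<le> ennreal C * (\<integral>\<^sup>+y. u y \<partial>M)"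
    using nn_integral_uminus_compact[OF K1] by blast
  obtain D where D: "0 < D" "\<forall>f\<in>Lp. integrable M (\<lambda>x. indicator (uminus ` K1) x * f x) \<and> (\<integral>x. norm (indicator (uminus ` K1) x * f x) \<partial>M) \<le> D * pn f powr (1/p)"
    using Lp_loc_integrable[OF K2] by blast
  have "integrable M (\<lambda>y. indicator K y * h (- y + x)) \<and>
    (\<integral>y. norm (indicator K y * h (- y + x)) \<partial>M) \<le> C * D * pn h powr (1/p)" if h: "h \<in> Lp" for h
  proof -
    have m: "(\<lambda>y. indicator K y * h (- y + x)) \<in> borel_measurable borel"
      by (intro indicator_mult_meas Ks reflect_meas Lp_meas[OF h])
    define u where "u y = ennreal (norm (indicator (uminus ` K1) y * h y))" for y
    have um: "u \<in> borel_measurable borel"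
      unfolding u_def using indicator_mult_meas[OF Ks(2) Lp_meas[OF h]] by measurable
    have ih: "integrable M (\<lambda>x. indicator (uminus ` K1) x * h x)" using D h by blast
    have mn: "(\<lambda>y. ennreal (norm (indicator K y * h (- y + x)))) \<in> borel_measurable borel"
      using m by measurable
    have "(\<integral>\<^sup>+y. ennreal (norm (indicator K y * h (- y + x))) \<partial>M) = (\<integral>\<^sup>+y. ennreal (norm (indicator K (x + y) * h (- (x + y) + x))) \<partial>M)"
      using nn_integral_plus[OF mn] by simp
    also have "\<dots> = (\<integral>\<^sup>+y. indicator K1 y * u (- y) \<partial>M)"
    proof (intro nn_integral_cong)
      fix y
      have "- (x + y) + x = - y" by (simp add: minus_add add.assoc diff_conv_add_uminus del: add_uminus_conv_diff)
      then show "ennreal (norm (indicator K (x + y) * h (- (x + y) + x))) = indicator K1 y * u (- y)"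
        using inK[of y] by (auto simp: u_def indicator_def)
    qed
    also have "\<dots> \<le> ennreal C * (\<integral>\<^sup>+y. u y \<partial>M)" using C um by blast
    also have "(\<integral>\<^sup>+y. u y \<partial>M) = ennreal (\<integral>y. norm (indicator (uminus ` K1) y * h y) \<partial>M)"
      unfolding u_def by (intro nn_integral_eq_integral integrable_norm ih) auto
    also have "\<dots> \<le> ennreal (D * pn h powr (1/p))" using D h by (intro ennreal_leI) blast
    also have "ennreal C * ennreal (D * pn h powr (1/p)) = ennreal (C * D * pn h powr (1/p))"
      using C D by (simp add: ennreal_mult' mult.assoc)
    finally have le: "(\<integral>\<^sup>+y. ennreal (norm (indicator K y * h (- y + x))) \<partial>M) \<le> ennreal (C * D * pn h powr (1/p))"
      by (simp add: mult_left_mono)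
    then have i: "integrable M (\<lambda>y. indicator K y * h (- y + x))"
      using m by (intro integrableI_bounded) (auto intro: le_less_trans)
    moreover have "ennreal (\<integral>y. norm (indicator K y * h (- y + x)) \<partial>M) \<le> ennreal (C * D * pn h powr (1/p))"
      using le nn_integral_eq_integral[OF integrable_norm[OF i]] by simp
    ultimately show ?thesis using C D by (simp add: ennreal_le_iff)
  qed
  then show ?thesis using C D by (intro exI[of _ "C * D"]) auto
qed

text \<open>\<open>powr_sum_le\<close> applied pointwise; the constant depends on the total size B
  of the coefficients but not on their number.\<close>

lemma pn_sum_le:
  assumes X: "finite X" and g: "\<And>x. x \<in> X \<Longrightarrow> g x \<in> Lp" and B: "(\<Sum>x\<in>X. norm (c x)) \<le> B" "0 < B"
  shows "pn (\<lambda>z. \<Sum>x\<in>X. c x * g x z) \<le> B powr (p - 1) * (\<Sum>x\<in>X. norm (c x) * pn (g x))"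
proof -
  let ?u = "\<lambda>z. B powr (p - 1) * (\<Sum>x\<in>X. norm (c x) * (norm (g x z) powr p * \<omega> z powr p))"
  have i: "integrable M ?u"
    by (intro integrable_mult_right Bochner_Integration.integrable_sum Lp_int g)
  have m: "(\<lambda>z. \<Sum>x\<in>X. c x * g x z) \<in> borel_measurable borel"
    by (rule Lp_meas[OF Lp_sum[OF X Lp_cmult(1)[OF g]]])
  have "norm (\<Sum>x\<in>X. c x * g x z) powr p * \<omega> z powr p \<le> ?u z" for z
  proof -
    have "norm (\<Sum>x\<in>X. c x * g x z) powr p \<le> (\<Sum>x\<in>X. norm (c x) * norm (g x z)) powr p"
      using p sum_norm_le[of X "\<lambda>x. c x * g x z" "\<lambda>x. norm (c x) * norm (g x z)"]
      by (intro powr_mono2) (auto simp: norm_mult)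
    also have "\<dots> \<le> B powr (p - 1) * (\<Sum>x\<in>X. norm (c x) * norm (g x z) powr p)"
      using B p by (intro powr_sum_le[OF X]) auto
    finally have "norm (\<Sum>x\<in>X. c x * g x z) powr p * \<omega> z powr p \<le> (B powr (p - 1) * (\<Sum>x\<in>X. norm (c x) * norm (g x z) powr p)) * \<omega> z powr p"
      by (intro mult_right_mono) auto
    then show ?thesis by (simp add: sum_distrib_right sum_distrib_left mult.assoc)
  qed
  from Lp_dom(2)[OF m i this] show ?thesis
    using Lp_int[OF g] by (simp add: pnorm_def)
qed

end

section \<open>Riemann sums for convolution by a bounded compactly supported function\<close>

locale bounded_compact = weighted_group M \<omega> p
  for M :: "'g::{topological_group_add,t2_space} measure" and \<omega> p +
  fixes f :: "'g \<Rightarrow> complex" and K B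
  assumes fm: "f \<in> borel_measurable borel" and K: "compact K" and z: "\<And>x. x \<notin> K \<Longrightarrow> f x = 0"
    and B: "0 < B" "\<And>x. norm (f x) \<le> B"
begin

definition coef where "coef A x = (\<integral>y. indicator (A x) y * f y \<partial>M)"

text \<open>The added 1 keeps this positive when f vanishes almost everywhere, so that tolerances
  can be divided by it.\<close>

definition mass where "mass = (\<integral>y. norm (f y) \<partial>M) + 1"

lemma f_int: "integrable M f"
  by (rule integrable_compact_support[OF foc fm K B(2) z])

lemma f_Lp: "f \<in> Lp"
  by (rule Lp_compact_support[OF fm K z B(2)])

lemma mass_pos: "0 < mass"
  unfolding mass_def by (intro add_nonneg_pos Bochner_Integration.integral_nonneg) auto

lemma sum_coef_le:
  assumes S: "subordinate K V X A"
  shows "(\<Sum>x\<in>X. norm (coef A x)) \<le> mass"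
proof -
  have X: "finite X" and A: "\<And>x. x \<in> X \<Longrightarrow> A x \<in> sets M" and dj: "disjoint_family_on A X"
    using S by (auto simp: subordinate_def)
  have i: "integrable M (\<lambda>y. indicator (A x) y * f y)" if "x \<in> X" for x
    by (rule integrable_indicator_mult[OF A[OF that] f_int])
  have "(\<Sum>x\<in>X. norm (coef A x)) \<le> (\<Sum>x\<in>X. \<integral>y. norm (indicator (A x) y * f y) \<partial>M)"
    unfolding coef_def by (intro sum_mono integral_norm_bound)
  also have "\<dots> = (\<integral>y. (\<Sum>x\<in>X. norm (indicator (A x) y * f y)) \<partial>M)"
    by (rule Bochner_Integration.integral_sum[symmetric]) (intro integrable_norm i)
  also have "\<dots> \<le> (\<integral>y. norm (f y) \<partial>M)"
  proof (intro integral_mono Bochner_Integration.integrable_sum integrable_norm i f_int)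
    fix y
    show "(\<Sum>x\<in>X. norm (indicator (A x) y * f y)) \<le> norm (f y)"
    proof (cases "\<exists>x\<in>X. y \<in> A x")
      case True
      then obtain x0 where x0: "x0 \<in> X" "y \<in> A x0" by blast
      have "(\<Sum>x\<in>X. norm (indicator (A x) y * f y)) = (\<Sum>x\<in>X. if x = x0 then norm (f y) else 0)"
        using dj x0 by (intro sum.cong) (auto simp: disjoint_family_on_def indicator_def)
      then show ?thesis using X by (simp add: x0)
    next
      case False
      then have "(\<Sum>x\<in>X. norm (indicator (A x) y * f y)) = 0" by (intro sum.neutral) auto
      then show ?thesis by simp
    qed
  qed auto
  finally show ?thesis by (simp add: mass_def)
qed

text \<open>The bound is uniform over all partitions: the coefficients have total size at most
  \<open>mass\<close>, and translations by points of K cost at most b^p. This uniformity lets g be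
  approximated before the partition is chosen.\<close>

lemma pn_riemann_sum_le:
  assumes S: "subordinate K V X A" and g: "g \<in> Lp" and b: "\<And>x. x \<in> K \<Longrightarrow> \<omega> x \<le> b"
  shows "pn (\<lambda>z. \<Sum>x\<in>X. coef A x * ltrans x g z) \<le> mass powr p * b powr p * pn g"
proof -
  have X: "finite X" "X \<subseteq> K" using S by (auto simp: subordinate_def)
  have "pn (\<lambda>z. \<Sum>x\<in>X. coef A x * ltrans x g z) \<le> mass powr (p - 1) * (\<Sum>x\<in>X. norm (coef A x) * pn (ltrans x g))"
    by (rule pn_sum_le[OF X(1) Lp_ltrans(1)[OF g] sum_coef_le[OF S] mass_pos])
  also have "\<dots> \<le> mass powr (p - 1) * (\<Sum>x\<in>X. norm (coef A x) * (b powr p * pn g))"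
  proof (intro mult_left_mono sum_mono)
    fix x assume x: "x \<in> X"
    have "\<omega> x powr p \<le> b powr p" using b x X w_pos[of x] p by (intro powr_mono2) auto
    then show "pn (ltrans x g) \<le> b powr p * pn g"
      using Lp_ltrans(2)[OF g, of x] mult_right_mono[of "\<omega> x powr p" "b powr p" "pn g"] pn_nonneg[of g] by simp
  qed auto
  also have "\<dots> = mass powr (p - 1) * ((\<Sum>x\<in>X. norm (coef A x)) * (b powr p * pn g))"
    by (simp add: sum_distrib_right)
  also have "\<dots> \<le> mass powr (p - 1) * (mass * (b powr p * pn g))"
    using pn_nonneg[of g] by (intro mult_left_mono mult_right_mono sum_coef_le[OF S]) auto
  also have "\<dots> = mass powr p * b powr p * pn g"
    using mass_pos by (simp add: powr_diff)
  finally show ?thesis .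
qed

text \<open>For k in \<open>Cc\<close> the convolution and all its Riemann sums vanish off L = K +
  Q, so a uniform estimate there converts into one for \<open>pn\<close>.\<close>

lemma conv_riemann_Cc:
  assumes k: "k \<in> Cc" and e: "0 < e"
  shows "\<exists>V. (\<forall>x. open (V x) \<and> x \<in> V x) \<and> (\<forall>X A. subordinate K V X A \<longrightarrow>
     pn (\<lambda>z. conv M f k z - (\<Sum>x\<in>X. coef A x * ltrans x k z)) < e)"
proof -
  obtain Q where Q: "continuous_on UNIV k" "compact Q" "\<And>x. x \<notin> Q \<Longrightarrow> k x = 0" using k by (auto simp: Cc_def)
  define L where "L = (\<lambda>(x, y). x + y) ` (K \<times> Q)"
  have L: "compact L" unfolding L_def by (intro compact_plus Q K)
  have zL: "k (- y + x) = 0" if "y \<in> K" "x \<notin> L" for x y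
  proof (rule Q(3), rule notI)
    assume "- y + x \<in> Q"
    then have "y + (- y + x) \<in> L" unfolding L_def using that by (intro image_eqI[of _ _ "(y, - y + x)"]) auto
    then show False using that by (simp add: add.assoc[symmetric])
  qed
  obtain C where C: "0 \<le> C" "\<forall>f\<in>borel_measurable borel. \<forall>d\<ge>0. (\<forall>x. x \<notin> L \<longrightarrow> f x = 0) \<longrightarrow> (\<forall>x\<in>L. norm (f x) \<le> d) \<longrightarrow> pn f \<le> C * d powr p"
    using pn_compact_support_le[OF L] by blast
  define d where "d = (e / (C + 1)) powr (1/p) / mass"
  have d: "0 < d" unfolding d_def using e C mass_pos by (intro divide_pos_pos) auto
  have dp: "C * (d * mass) powr p < e"
  proof -
    have "(d * mass) powr p = e / (C + 1)" using e C p mass_pos by (simp add: d_def powr_powr)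
    moreover have "C * (e / (C + 1)) < e" using e C by (simp add: field_simps)
    ultimately show ?thesis by simp
  qed
  have c: "continuous_on UNIV (\<lambda>z. k (- fst z + snd z))"
    by (rule continuous_on_compose2[OF Q(1)]) (auto intro!: continuous_intros)
  have "\<exists>V. open V \<and> x \<in> V \<and> (\<forall>a\<in>V. \<forall>y\<in>L. dist (k (- a + y)) (k (- x + y)) < d)" for x
    using tube_dist[OF c L d, of x] by simp
  then obtain V where V: "\<And>x. open (V x) \<and> x \<in> V x" "\<And>x a y. a \<in> V x \<Longrightarrow> y \<in> L \<Longrightarrow> dist (k (- a + y)) (k (- x + y)) < d"
    by metis
  have "pn (\<lambda>z. conv M f k z - (\<Sum>x\<in>X. coef A x * ltrans x k z)) < e" if S: "subordinate K V X A" for X A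
  proof -
    have X: "finite X" "X \<subseteq> K" "\<And>x. x \<in> X \<Longrightarrow> A x \<in> sets borel" "\<And>x. x \<in> X \<Longrightarrow> A x \<subseteq> V x"
      "disjoint_family_on A X" "(\<Union>x\<in>X. A x) = K" using S by (auto simp: subordinate_def)
    have m: "(\<lambda>z. conv M f k z - (\<Sum>x\<in>X. coef A x * ltrans x k z)) \<in> borel_measurable borel"
      by (intro Lp_meas Lp_diff(1) conv_Lp f_Lp Lp_sum X Lp_cmult(1) Lp_ltrans(1) Lp_Cc k)
    have z0: "conv M f k y - (\<Sum>x\<in>X. coef A x * ltrans x k y) = 0" if y: "y \<notin> L" for y
    proof -
      have "(\<lambda>a. f a * k (- a + y)) = (\<lambda>_. 0)" using z zL y by (metis mult_eq_0_iff)
      then have "conv M f k y = 0" by (simp add: conv_def)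
      moreover have "(\<Sum>x\<in>X. coef A x * ltrans x k y) = 0"
        using zL y X(2) by (intro sum.neutral) (auto simp: ltrans_def)
      ultimately show ?thesis by simp
    qed
    have le: "norm (conv M f k y - (\<Sum>x\<in>X. coef A x * ltrans x k y)) \<le> d * mass" if y: "y \<in> L" for y
    proof -
      have "norm (conv M f k y - (\<Sum>x\<in>X. coef A x * ltrans x k y)) \<le> d * (\<integral>x. norm (f x) \<partial>M)"
        unfolding conv_def coef_def ltrans_def
      proof (rule riemann_sum_bound[OF sets_M f_int conv_Cc_integrable[OF f_Lp k] z X(1,3,5,6)])
        show "norm (k (- x' + y) - k (- x + y)) \<le> d" if "x \<in> X" "x' \<in> A x" for x x'
          using V(2)[of x' x y] X(4)[OF that(1)] that y by (auto simp: dist_norm less_imp_le)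
      qed
      also have "\<dots> \<le> d * mass" using d by (simp add: mass_def)
      finally show ?thesis .
    qed
    have "pn (\<lambda>z. conv M f k z - (\<Sum>x\<in>X. coef A x * ltrans x k z)) \<le> C * (d * mass) powr p"
      using C(2)[rule_format, OF m, of "d * mass"] z0 le d mass_pos by auto
    then show ?thesis using dp by simp
  qed
  then show ?thesis using V(1) by blast
qed

text \<open>The convolution is a limit of Riemann sums that satisfy the bound uniformly; the factor
  2^p comes from the weak triangle inequality.\<close>

lemma conv_bound_Cc: "\<exists>D>0. \<forall>k\<in>Cc. pn (conv M f k) \<le> D * pn k"
proof -
  obtain b where b: "0 < b" "\<And>x. x \<in> K \<Longrightarrow> \<omega> x \<le> b" using w_bounds[OF K] by metis
  define D where "D = 2 powr p * (mass powr p * b powr p)"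
  have D: "0 < D" using mass_pos b by (simp add: D_def)
  have "pn (conv M f k) \<le> D * pn k" if k: "k \<in> Cc" for k
  proof (rule field_le_epsilon)
    fix e :: real assume e: "0 < e"
    define d where "d = e / 2 powr p"
    have d: "0 < d" using e by (simp add: d_def)
    obtain V where V: "\<forall>x. open (V x) \<and> x \<in> V x" "\<forall>X A. subordinate K V X A \<longrightarrow>
       pn (\<lambda>z. conv M f k z - (\<Sum>x\<in>X. coef A x * ltrans x k z)) < d"
      using conv_riemann_Cc[OF k d] by blast
    then obtain X A where S: "subordinate K V X A" using subordinate_exists[OF K, of V] by blast
    then have lt: "pn (\<lambda>z. conv M f k z - (\<Sum>x\<in>X. coef A x * ltrans x k z)) < d" using V by blast
    have X: "finite X" using S by (simp add: subordinate_def)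
    have kL: "k \<in> Lp" by (rule Lp_Cc[OF k])
    have L1: "(\<lambda>z. \<Sum>x\<in>X. coef A x * ltrans x k z) \<in> Lp" by (intro Lp_sum X Lp_cmult(1) Lp_ltrans(1) kL)
    have L2: "(\<lambda>z. conv M f k z - (\<Sum>x\<in>X. coef A x * ltrans x k z)) \<in> Lp"
      by (intro Lp_diff(1) conv_Lp f_Lp kL L1)
    have "pn (conv M f k) = pn (\<lambda>z. (\<Sum>x\<in>X. coef A x * ltrans x k z) + (conv M f k z - (\<Sum>x\<in>X. coef A x * ltrans x k z)))"
      by simp
    also have "\<dots> \<le> 2 powr p * (pn (\<lambda>z. \<Sum>x\<in>X. coef A x * ltrans x k z) + pn (\<lambda>z. conv M f k z - (\<Sum>x\<in>X. coef A x * ltrans x k z)))"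
      by (rule Lp_add(2)[OF L1 L2])
    also have "\<dots> \<le> 2 powr p * (mass powr p * b powr p * pn k + d)"
      using pn_riemann_sum_le[OF S kL b(2)] lt by (intro mult_left_mono add_mono) auto
    also have "\<dots> = D * pn k + e" by (simp add: D_def d_def algebra_simps)
    finally show "pn (conv M f k) \<le> D * pn k + e" .
  qed
  then show ?thesis using D by blast
qed

lemma conv_right_integrable: "g \<in> Lp \<Longrightarrow> integrable M (\<lambda>y. f y * g (- y + x))"
proof -
  assume g: "g \<in> Lp"
  have i: "integrable M (\<lambda>y. indicator K y * g (- y + x))" using reflect_loc_integrable[OF K] g by blast
  have "integrable M (\<lambda>y. f y * (indicator K y * g (- y + x)))"
  proof (rule Bochner_Integration.integrable_bound[OF integrable_mult_right[OF integrable_norm[OF i], of B]])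
    show "(\<lambda>y. f y * (indicator K y * g (- y + x))) \<in> borel_measurable M"
      using fm reflect_meas[OF Lp_meas[OF g]] borel_compact[OF K] by (auto intro!: borel_measurable_times indicator_mult_meas)
    show "AE y in M. norm (f y * (indicator K y * g (- y + x))) \<le> norm (B * norm (indicator K y * g (- y + x)))"
      using mult_right_mono[OF B(2)] B(1) by (intro AE_I2) (simp add: norm_mult)
  qed
  moreover have "f y * (indicator K y * g (- y + x)) = f y * g (- y + x)" for y
    using z by (auto simp: indicator_def)
  ultimately show ?thesis by simp
qed

lemma conv_add_right: "g \<in> Lp \<Longrightarrow> h \<in> Lp \<Longrightarrow> conv M f (\<lambda>x. g x + h x) x = conv M f g x + conv M f h x"
  unfolding conv_def using conv_right_integrable[of g x] conv_right_integrable[of h x] by (simp add: distrib_left)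

lemma conv_right_bound: "\<exists>C>0. \<forall>g\<in>Lp. norm (conv M f g x) \<le> C * pn g powr (1/p)"
proof -
  obtain C where C: "0 < C" "\<forall>h\<in>Lp. integrable M (\<lambda>y. indicator K y * h (- y + x)) \<and>
    (\<integral>y. norm (indicator K y * h (- y + x)) \<partial>M) \<le> C * pn h powr (1/p)"
    using reflect_loc_integrable[OF K] by blast
  have "norm (conv M f g x) \<le> B * C * pn g powr (1/p)" if g: "g \<in> Lp" for g
  proof -
    have "norm (conv M f g x) \<le> (\<integral>y. B * norm (indicator K y * g (- y + x)) \<partial>M)"
      unfolding conv_def
    proof (rule norm_lebesgue_integral_le[OF conv_right_integrable[OF g]])
      show "integrable M (\<lambda>y. B * norm (indicator K y * g (- y + x)))"
        using C g by (intro integrable_mult_right integrable_norm) blast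
      show "norm (f y * g (- y + x)) \<le> B * norm (indicator K y * g (- y + x))" for y
        using z[of y] B(2)[of y] by (cases "y \<in> K") (auto simp: norm_mult intro!: mult_right_mono)
    qed
    also have "\<dots> = B * (\<integral>y. norm (indicator K y * g (- y + x)) \<partial>M)" by simp
    also have "\<dots> \<le> B * (C * pn g powr (1/p))" using C g B by (intro mult_left_mono) auto
    finally show ?thesis by (simp add: mult.assoc)
  qed
  then show ?thesis using B C by (intro exI[of _ "B * C"]) auto
qed

text \<open>Density alone does not extend the bound, because continuity of g |-> f * g in
  \<open>Lp\<close> is what is being proved. The functions f * k n converge pointwise by
  \<open>conv_right_bound\<close>, and Fatou's lemma transfers the bound to the limit.\<close>

lemma conv_bound: "\<exists>D>0. \<forall>g\<in>Lp. pn (conv M f g) \<le> D * pn g"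
proof -
  obtain D where D: "0 < D" "\<forall>k\<in>Cc. pn (conv M f k) \<le> D * pn k" using conv_bound_Cc by blast
  have "pn (conv M f g) \<le> D * 2 powr p * pn g" if g: "g \<in> Lp" for g
  proof (rule field_le_epsilon)
    fix e :: real assume e: "0 < e"
    \<comment> \<open>With this choice D * 2^p * d = e, matching the definition of R below.\<close>
    define d where "d = e / (D * 2 powr p)"
    have d: "0 < d" using e D by (simp add: d_def)
    have "\<exists>k\<in>Cc. pn (\<lambda>x. g x - k x) < d / real (Suc n)" for n
      using d by (intro dense_Cc[OF g]) auto
    then obtain k where k: "\<And>n. k n \<in> Cc" "\<And>n. pn (\<lambda>x. g x - k n x) < d / real (Suc n)" by metis
    have lim0: "(\<lambda>n. pn (\<lambda>x. g x - k n x)) \<longlonglongrightarrow> 0"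
    proof (rule tendsto_sandwich[OF always_eventually always_eventually tendsto_const])
      show "(\<lambda>n. d / real (Suc n)) \<longlonglongrightarrow> 0" by (rule LIMSEQ_Suc[OF lim_const_over_n])
    qed (use k(2) pn_nonneg in \<open>auto simp: less_imp_le\<close>)
    have lim: "(\<lambda>n. conv M f (k n) x) \<longlonglongrightarrow> conv M f g x" for x
    proof -
      obtain C where C: "0 < C" "\<forall>g\<in>Lp. norm (conv M f g x) \<le> C * pn g powr (1/p)" using conv_right_bound by blast
      have l: "(\<lambda>n. C * pn (\<lambda>x. g x - k n x) powr (1/p)) \<longlonglongrightarrow> 0"
        using p pn_nonneg by (intro tendsto_mult_right_zero tendsto_zero_powrI[OF lim0 tendsto_const]) auto
      have eqn: "conv M f g x = conv M f (k n) x + conv M f (\<lambda>x. g x - k n x) x" for n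
        using conv_add_right[OF Lp_Cc[OF k(1)[of n]] Lp_diff(1)[OF g Lp_Cc[OF k(1)[of n]]]] by simp
      have "(\<lambda>n. conv M f g x - conv M f (k n) x) \<longlonglongrightarrow> 0"
      proof (rule Lim_null_comparison[OF _ l], intro always_eventually allI)
        fix n
        have "norm (conv M f (\<lambda>x. g x - k n x) x) \<le> C * pn (\<lambda>x. g x - k n x) powr (1/p)"
          using C(2) Lp_diff(1)[OF g Lp_Cc[OF k(1)[of n]]] by blast
        then show "norm (conv M f g x - conv M f (k n) x) \<le> C * pn (\<lambda>x. g x - k n x) powr (1/p)"
          using eqn[of n] by simp
      qed
      from tendsto_diff[OF tendsto_const[of "conv M f g x"] this] show ?thesis by simp
    qed
    define R where "R = D * 2 powr p * pn g + e"
    have R: "pn (conv M f (k n)) \<le> R" for n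
    proof -
      have "pn (k n) = pn (\<lambda>x. g x + (k n x - g x))" by simp
      also have "\<dots> \<le> 2 powr p * (pn g + pn (\<lambda>x. k n x - g x))"
        by (rule Lp_add(2)[OF g Lp_diff(1)[OF Lp_Cc[OF k(1)] g]])
      also have "\<dots> \<le> 2 powr p * (pn g + d)"
      proof (intro mult_left_mono add_left_mono)
        have "pn (\<lambda>x. k n x - g x) < d / real (Suc n)" using k(2)[of n] pn_minus_commute[of g "k n"] by simp
        also have "\<dots> \<le> d" using d by (simp add: divide_le_eq)
        finally show "pn (\<lambda>x. k n x - g x) \<le> d" by simp
      qed auto
      finally have "D * pn (k n) \<le> D * (2 powr p * (pn g + d))" using D by (intro mult_left_mono) auto
      also have "\<dots> = R" using D by (simp add: R_def d_def algebra_simps)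
      finally show ?thesis using D(2) k(1)[of n] by (meson order_trans)
    qed
    let ?u = "\<lambda>h x. ennreal (norm (h x) powr p * \<omega> x powr p)"
    have fk: "conv M f (k n) \<in> Lp" for n by (intro conv_Lp f_Lp Lp_Cc k)
    have fg: "conv M f g \<in> Lp" by (intro conv_Lp f_Lp g)
    have "ennreal (pn (conv M f g)) = (\<integral>\<^sup>+x. ?u (conv M f g) x \<partial>M)"
      unfolding pnorm_def using Lp_int[OF fg] by (intro nn_integral_eq_integral[symmetric]) auto
    also have "\<dots> \<le> (\<integral>\<^sup>+x. liminf (\<lambda>n. ?u (conv M f (k n)) x) \<partial>M)"
    proof (intro nn_integral_mono)
      fix x
      have "(\<lambda>n. ?u (conv M f (k n)) x) \<longlonglongrightarrow> ?u (conv M f g) x"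
        using p by (intro tendsto_ennrealI tendsto_mult_right tendsto_powr2[OF tendsto_norm[OF lim] tendsto_const]) auto
      then show "?u (conv M f g) x \<le> liminf (\<lambda>n. ?u (conv M f (k n)) x)"
        by (intro eq_refl lim_imp_Liminf[OF trivial_limit_sequentially, symmetric])
    qed
    also have "\<dots> \<le> liminf (\<lambda>n. \<integral>\<^sup>+x. ?u (conv M f (k n)) x \<partial>M)"
    proof (rule nn_integral_liminf)
      fix n show "(\<lambda>x. ?u (conv M f (k n)) x) \<in> borel_measurable M"
        using Lp_meas[OF fk[of n]] by (simp) measurable
    qed
    also have "\<dots> \<le> liminf (\<lambda>n. ennreal R)"
    proof (intro Liminf_mono always_eventually allI)
      fix n
      have "(\<integral>\<^sup>+x. ?u (conv M f (k n)) x \<partial>M) = ennreal (pn (conv M f (k n)))"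
        unfolding pnorm_def using Lp_int[OF fk] by (intro nn_integral_eq_integral) auto
      then show "(\<integral>\<^sup>+x. ?u (conv M f (k n)) x \<partial>M) \<le> ennreal R" using R[of n] by (simp add: ennreal_leI)
    qed
    also have "\<dots> = ennreal R" by (simp add: Liminf_const)
    finally show "pn (conv M f g) \<le> D * 2 powr p * pn g + e"
      using D e pn_nonneg[of g] by (subst (asm) ennreal_le_iff) (auto simp: R_def intro!: add_nonneg_nonneg mult_nonneg_nonneg)
  qed
  then show ?thesis using D by (intro exI[of _ "D * 2 powr p"]) auto
qed

text \<open>Replacing g by a nearby k in \<open>Cc\<close> changes the convolution little by
  \<open>conv_bound\<close> and the Riemann sums little by \<open>pn_riemann_sum_le\<close>, the
  latter for every partition at once.\<close>

lemma conv_riemann: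
  assumes g: "g \<in> Lp" and e: "0 < e"
  shows "\<exists>V. (\<forall>x. open (V x) \<and> x \<in> V x) \<and> (\<forall>X A. subordinate K V X A \<longrightarrow>
     pn (\<lambda>z. conv M f g z - (\<Sum>x\<in>X. coef A x * ltrans x g z)) < e)"
proof -
  obtain D where D: "0 < D" "\<forall>g\<in>Lp. pn (conv M f g) \<le> D * pn g" using conv_bound by blast
  obtain b where b: "0 < b" "\<And>x. x \<in> K \<Longrightarrow> \<omega> x \<le> b" using w_bounds[OF K] by metis
  \<comment> \<open>The summands D, 1 and mass^p * b^p account for the convolution of g - k, the
    Riemann error of k, and the Riemann sum of k - g.\<close>
  define Q where "Q = 4 powr p * (D + 1 + mass powr p * b powr p)"
  have Q: "0 < Q" unfolding Q_def using D by (intro mult_pos_pos add_pos_nonneg) auto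
  define d where "d = e / Q"
  have d: "0 < d" using e Q by (simp add: d_def)
  obtain k where k: "k \<in> Cc" "pn (\<lambda>x. g x - k x) < d" using dense_Cc[OF g d] by blast
  obtain V where V: "\<forall>x. open (V x) \<and> x \<in> V x" "\<forall>X A. subordinate K V X A \<longrightarrow>
     pn (\<lambda>z. conv M f k z - (\<Sum>x\<in>X. coef A x * ltrans x k z)) < d"
    using conv_riemann_Cc[OF k(1) d] by blast
  have "pn (\<lambda>z. conv M f g z - (\<Sum>x\<in>X. coef A x * ltrans x g z)) < e" if S: "subordinate K V X A" for X A
  proof -
    have X: "finite X" using S by (simp add: subordinate_def)
    have kL: "k \<in> Lp" by (rule Lp_Cc[OF k(1)])
    have G: "(\<lambda>x. g x - k x) \<in> Lp" by (rule Lp_diff(1)[OF g kL])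
    have G': "(\<lambda>x. k x - g x) \<in> Lp" by (rule Lp_diff(1)[OF kL g])
    have L1: "conv M f (\<lambda>x. g x - k x) \<in> Lp" by (intro conv_Lp f_Lp G)
    have L2: "(\<lambda>z. conv M f k z - (\<Sum>x\<in>X. coef A x * ltrans x k z)) \<in> Lp"
      by (intro Lp_diff(1) conv_Lp f_Lp kL Lp_sum X Lp_cmult(1) Lp_ltrans(1))
    have L3: "(\<lambda>z. \<Sum>x\<in>X. coef A x * ltrans x (\<lambda>x. k x - g x) z) \<in> Lp"
      by (intro Lp_sum X Lp_cmult(1) Lp_ltrans(1) G')
    have "conv M f g z - (\<Sum>x\<in>X. coef A x * ltrans x g z) = conv M f (\<lambda>x. g x - k x) z
      + (conv M f k z - (\<Sum>x\<in>X. coef A x * ltrans x k z)) + (\<Sum>x\<in>X. coef A x * ltrans x (\<lambda>x. k x - g x) z)" for z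
      using conv_add_right[OF kL G, of z]
      by (simp add: ltrans_def right_diff_distrib sum_subtractf)
    then have "pn (\<lambda>z. conv M f g z - (\<Sum>x\<in>X. coef A x * ltrans x g z)) \<le> 4 powr p * (pn (conv M f (\<lambda>x. g x - k x))
      + pn (\<lambda>z. conv M f k z - (\<Sum>x\<in>X. coef A x * ltrans x k z)) + pn (\<lambda>z. \<Sum>x\<in>X. coef A x * ltrans x (\<lambda>x. k x - g x) z))"
      using pn_triangle3[OF L1 L2 L3] by simp
    also have "\<dots> < 4 powr p * (D * d + d + mass powr p * b powr p * d)"
    proof (rule mult_strict_left_mono[OF add_less_le_mono[OF add_le_less_mono]])
      have "pn (conv M f (\<lambda>x. g x - k x)) \<le> D * pn (\<lambda>x. g x - k x)" using D G by blast
      also have "\<dots> \<le> D * d" using k(2) D by (intro mult_left_mono) auto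
      finally show "pn (conv M f (\<lambda>x. g x - k x)) \<le> D * d" .
      show "pn (\<lambda>z. conv M f k z - (\<Sum>x\<in>X. coef A x * ltrans x k z)) < d" using V S by blast
      have "pn (\<lambda>z. \<Sum>x\<in>X. coef A x * ltrans x (\<lambda>x. k x - g x) z) \<le> mass powr p * b powr p * pn (\<lambda>x. k x - g x)"
        by (rule pn_riemann_sum_le[OF S G' b(2)])
      also have "\<dots> \<le> mass powr p * b powr p * d"
        using k(2) pn_minus_commute[of g k] by (intro mult_left_mono) auto
      finally show "pn (\<lambda>z. \<Sum>x\<in>X. coef A x * ltrans x (\<lambda>x. k x - g x) z) \<le> mass powr p * b powr p * d" .
    qed auto
    also have "\<dots> = d * Q" by (simp add: Q_def algebra_simps)
    also have "\<dots> = e" using Q by (simp add: d_def)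
    finally show ?thesis .
  qed
  then show ?thesis using V(1) by blast
qed

end

subsection \<open>Separating multipliers are weighted translations\<close>

context weighted_group
begin

text \<open>A compact set need not be a countable intersection of open sets, so bumps may not
  decrease to its indicator everywhere. Choosing \<open>U n\<close> with summable excess over A
  makes the bumps converge to the indicator almost everywhere, by Borel-Cantelli, and dominated
  convergence finishes.\<close>

lemma integral_compact_eq_0:
  assumes h: "h \<in> Lp" and 0: "\<And>v. v \<in> Cc \<Longrightarrow> (\<integral>x. h x * v x \<partial>M) = 0" and A: "compact A"
  shows "(\<integral>x. indicator A x * h x \<partial>M) = 0"
proof -
  obtain W K where W: "open W" "compact K" "A \<subseteq> W" "W \<subseteq> K"
    using compact_nbhd_base_compact[OF lc A open_UNIV] by auto
  have As: "A \<in> sets borel" by (rule borel_compact[OF A])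
  have "\<exists>U. open U \<and> A \<subseteq> U \<and> U \<subseteq> K \<and> emeasure M (U - A) < ennreal ((1/2) ^ n)" for n :: nat
  proof -
    have "0 < (1/2 :: real) ^ n" by simp
    from outer_regular_compact[OF A W(1,3) this] show ?thesis using W(4) by blast
  qed
  then obtain U where U: "\<And>n. open (U n)" "\<And>n. A \<subseteq> U n" "\<And>n. U n \<subseteq> K" "\<And>n::nat. emeasure M (U n - A) < ennreal ((1/2) ^ n)"
    by metis
  have UAs: "U n - A \<in> sets M" for n using U As by auto
  have "AE x in M. \<forall>\<^sub>F n in sequentially. x \<in> space M - (U n - A)"
  proof (rule borel_cantelli_AE1[OF UAs])
    show "emeasure M (U n - A) < \<infinity>" for n using U(4)[of n] by (auto intro: less_trans)
    have le: "measure M (U n - A) \<le> (1/2) ^ n" for n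
      unfolding measure_def using U(4)[of n] by (intro enn2real_leI) (auto simp: less_imp_le)
    show "summable (\<lambda>n. measure M (U n - A))"
      by (rule summable_comparison_test[OF _ summable_geometric[of "1/2::real"]]) (use le in auto)
  qed
  have "\<exists>v::'g \<Rightarrow> real. (\<lambda>x. complex_of_real (v x)) \<in> Cc \<and> (\<forall>x. norm (v x) \<le> 1) \<and> (\<forall>x\<in>A. v x = 1) \<and> (\<forall>x. x \<notin> U n \<longrightarrow> v x = 0)" for n
  proof -
    obtain v :: "'g \<Rightarrow> real" and L where v: "continuous_on UNIV v" "\<And>x. 0 \<le> v x" "\<And>x. v x \<le> 1"
      "\<forall>x\<in>A. v x = 1" "compact L" "L \<subseteq> U n" "\<And>x. x \<notin> L \<Longrightarrow> v x = 0"
      using urysohn_bump[OF lc A U(1,2)] by metis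
    have "v x = 0" if "x \<notin> U n" for x using v(6) that by (intro v(7)) blast
    then show ?thesis
      using v(2,3,4) Cc_of_real[OF v(1,5,7)] by (intro exI[of _ v]) auto
  qed
  then obtain v :: "nat \<Rightarrow> 'g \<Rightarrow> real" where v: "\<And>n. (\<lambda>x. complex_of_real (v n x)) \<in> Cc" "\<And>n x. norm (v n x) \<le> 1"
    "\<And>n x. x \<in> A \<Longrightarrow> v n x = 1" "\<And>n x. x \<notin> U n \<Longrightarrow> v n x = 0" by metis
  have iK: "integrable M (\<lambda>x. indicator K x * h x)" using Lp_loc_integrable[OF W(2)] h by blast
  have "(\<lambda>n. \<integral>x. h x * complex_of_real (v n x) \<partial>M) \<longlonglongrightarrow> (\<integral>x. indicator A x * h x \<partial>M)"
  proof (rule integral_dominated_convergence)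
    show "integrable M (\<lambda>x. norm (indicator K x * h x))" using iK by (rule integrable_norm)
    show "(\<lambda>x. indicator A x * h x) \<in> borel_measurable M" using indicator_mult_meas[OF As Lp_meas[OF h]] by simp
    show "(\<lambda>x. h x * complex_of_real (v n x)) \<in> borel_measurable M" for n
      using Lp_meas[OF h] Cc_measurable[OF v(1)[of n]] by (simp add: borel_measurable_times)
    show "AE x in M. norm (h x * complex_of_real (v n x)) \<le> norm (indicator K x * h x)" for n
    proof (intro AE_I2)
      show "norm (h x * complex_of_real (v n x)) \<le> norm (indicator K x * h x)" for x
      proof (cases "x \<in> K")
        case False
        then have "v n x = 0" using U(3)[of n] by (intro v(4)) blast
        then show ?thesis by simp
      qed (use v(2)[of n x] in \<open>auto simp: norm_mult mult_left_le\<close>)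
    qed
    show "AE x in M. (\<lambda>n. h x * complex_of_real (v n x)) \<longlonglongrightarrow> indicator A x * h x"
      using \<open>AE x in M. \<forall>\<^sub>F n in sequentially. x \<in> space M - (U n - A)\<close>
    proof eventually_elim
      case (elim x)
      have "\<forall>\<^sub>F n in sequentially. h x * complex_of_real (v n x) = indicator A x * h x"
        using elim by eventually_elim (use v(3,4) in \<open>auto simp: indicator_def\<close>)
      then show ?case by (rule tendsto_eventually)
    qed
  qed
  moreover have "(\<integral>x. h x * complex_of_real (v n x) \<partial>M) = 0" for n by (rule 0[OF v(1)])
  ultimately have "(\<lambda>n::nat. 0) \<longlonglongrightarrow> (\<integral>x. indicator A x * h x \<partial>M)" by simp
  then show ?thesis using LIMSEQ_unique tendsto_const by blast
qed

text \<open>If Re (c * h) exceeded 1/(n+1) on a subset of K of positive measure, inner regularity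
  would give a compact set of positive measure there, contradicting
  \<open>integral_compact_eq_0\<close>. Letting c run through the four fourth roots of unity then
  forces h = 0.\<close>

lemma AE_eq_0_of_Cc:
  assumes h: "h \<in> Lp" and 0: "\<And>v. v \<in> Cc \<Longrightarrow> (\<integral>x. h x * v x \<partial>M) = 0"
  shows "AE x in M. h x = 0"
proof -
  have one: "AE x in M. x \<in> K \<longrightarrow> Re (c * h x) \<le> 1 / real (Suc n)" if K: "compact K" for K n c
  proof -
    define D where "D = {x\<in>K. 1 / real (Suc n) < Re (c * h x)}"
    have "(\<lambda>x. Re (c * h x)) \<in> borel_measurable borel" using Lp_meas[OF h] by measurable
    then have "K \<inter> {x. 1 / real (Suc n) < Re (c * h x)} \<in> sets borel"
      using borel_compact[OF K] by (intro sets.Int) (auto simp: borel_measurable_iff_greater)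
    moreover have "D = K \<inter> {x. 1 / real (Suc n) < Re (c * h x)}" by (auto simp: D_def)
    ultimately have Ds: "D \<in> sets borel" by simp
    have "emeasure M D \<le> emeasure M K" using compact_sets[OF K] by (intro emeasure_mono) (auto simp: D_def)
    then have Df: "emeasure M D < \<infinity>" using finite_compact[OF K] by simp
    have "emeasure M D = 0"
    proof (rule ccontr)
      assume "emeasure M D \<noteq> 0"
      moreover obtain e where "0 \<le> e" "emeasure M D = ennreal e"
        using Df by (cases "emeasure M D") auto
      ultimately have e: "0 < e" "ennreal e \<le> emeasure M D" by (auto simp: less_le)
      obtain A where A: "compact A" "A \<subseteq> D" "emeasure M (D - A) < e" using inner_regular[OF Ds Df e(1)] by blast
      have As: "A \<in> sets M" by (rule compact_sets[OF A(1)])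
      have "emeasure M A \<noteq> 0"
      proof
        assume "emeasure M A = 0"
        moreover have "emeasure M D = emeasure M A + emeasure M (D - A)"
          using A As Ds by (subst plus_emeasure) (auto simp: Un_absorb1)
        ultimately show False using A(3) e(2) by simp
      qed
      then have mA: "0 < measure M A" using finite_compact[OF A(1)] by (simp add: measure_def enn2real_positive_iff zero_less_iff_neq_zero)
      have iA: "integrable M (\<lambda>x. indicator A x * h x)" using Lp_loc_integrable[OF A(1)] h by blast
      have "0 = Re (c * (\<integral>x. indicator A x * h x \<partial>M))" using integral_compact_eq_0[OF h 0 A(1)] by simp
      also have "\<dots> = (\<integral>x. Re (c * (indicator A x * h x)) \<partial>M)"
        using integral_Re[OF integrable_mult_right[OF iA, of c]] by simp
      also have "\<dots> \<ge> (\<integral>x. 1 / real (Suc n) * indicator A x \<partial>M)"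
      proof (intro integral_mono)
        show "integrable M (\<lambda>x. 1 / real (Suc n) * indicator A x)"
          using finite_compact[OF A(1)] As by (intro integrable_mult_right) (simp add: less_top)
        show "integrable M (\<lambda>x. Re (c * (indicator A x * h x)))" using iA by (intro integrable_Re integrable_mult_right)
        show "1 / real (Suc n) * indicator A x \<le> Re (c * (indicator A x * h x))" for x
          using A(2) by (cases "x \<in> A") (auto simp: D_def)
      qed
      finally have "1 / real (Suc n) * measure M A \<le> 0" using As by simp
      then show False using mA by (simp add: divide_le_0_iff)
    qed
    then have "D \<in> null_sets M" using Ds by auto
    then have "AE x in M. x \<notin> D" by (rule AE_not_in)
    then show ?thesis by eventually_elim (auto simp: D_def)
  qed
  have "AE x in M. h x \<noteq> 0 \<longrightarrow> h x = 0"
  proof (rule AE_support_of_compacts[OF h])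
    fix K :: "'g set" assume K: "compact K"
    have "AE x in M. \<forall>n. x \<in> K \<longrightarrow> Re (c * h x) \<le> 1 / real (Suc n)" for c
      unfolding AE_all_countable using one[OF K] by blast
    then have "AE x in M. \<forall>c\<in>{1, -1, \<i>, -\<i>}. \<forall>n. x \<in> K \<longrightarrow> Re (c * h x) \<le> 1 / real (Suc n)"
      by (intro AE_finite_allI) auto
    then show "AE x in M. x \<in> K \<longrightarrow> h x = 0"
    proof eventually_elim
      case (elim x)
      show ?case
      proof
        assume x: "x \<in> K"
        have "Re (c * h x) \<le> 0" if "c \<in> {1, -1, \<i>, -\<i>}" for c
        proof (rule LIMSEQ_le_const[OF LIMSEQ_Suc[OF lim_inverse_n']])
          show "\<exists>N. \<forall>n\<ge>N. Re (c * h x) \<le> 1 / real (Suc n)" using elim x that by blast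
        qed
        from this[of 1] this[of "-1"] this[of \<i>] this[of "-\<i>"] show "h x = 0"
          by (simp add: complex_eq_iff)
      qed
    qed
  qed
  then show ?thesis by eventually_elim blast
qed

text \<open>The value of f * k at 0 is the integral of f against the reflection of k, so these
  values already test f against all of \<open>Cc\<close>.\<close>

lemma conv_determines:
  assumes f: "f \<in> Lp" and g: "g \<in> Lp" and eq: "\<And>k. k \<in> Cc \<Longrightarrow> conv M f k 0 = conv M g k 0"
  shows "AE x in M. f x = g x"
proof -
  have "AE x in M. f x - g x = 0"
  proof (rule AE_eq_0_of_Cc[OF Lp_diff(1)[OF f g]])
    fix v :: "'g \<Rightarrow> complex" assume v: "v \<in> Cc"
    have "conv M (\<lambda>x. f x - g x) (\<lambda>y. v (- y)) 0 = 0"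
      using conv_diff_left[OF f g Cc_uminus[OF v], of 0] eq[OF Cc_uminus[OF v]] by simp
    then show "(\<integral>x. (f x - g x) * v x \<partial>M) = 0" by (simp add: conv_def)
  qed
  then show ?thesis by eventually_elim simp
qed

text \<open>The essential support. Unlike the closure of the set where f is nonzero, it depends only
  on the class of f modulo null sets.\<close>

definition esupp :: "('g \<Rightarrow> complex) \<Rightarrow> 'g set" where
  "esupp f = {y. \<forall>U. open U \<and> y \<in> U \<longrightarrow> \<not> (AE z in M. z \<in> U \<longrightarrow> f z = 0)}"

lemma closed_esupp: "closed (esupp f)"
proof -
  have "open (- esupp f)"
  proof (subst open_subopen, rule ballI)
    fix y assume "y \<in> - esupp f"
    then obtain U where "open U" "y \<in> U" "AE z in M. z \<in> U \<longrightarrow> f z = 0" by (auto simp: esupp_def)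
    then show "\<exists>T. open T \<and> y \<in> T \<and> T \<subseteq> - esupp f" by (intro exI[of _ U]) (auto simp: esupp_def)
  qed
  then show ?thesis by (simp add: closed_def)
qed

text \<open>The complement of the support is a union of possibly uncountably many open sets on which
  f vanishes almost everywhere. Exhausting the part of f outside its support by compact sets reduces
  to finitely many of them at a time.\<close>

lemma AE_esupp:
  assumes f: "f \<in> Lp" shows "AE z in M. z \<notin> esupp f \<longrightarrow> f z = 0"
proof -
  have Es: "- esupp f \<in> sets borel" using closed_esupp[of f] by (intro borel_open) auto
  let ?g = "\<lambda>z. indicator (- esupp f) z * f z"
  have g: "?g \<in> Lp" by (rule Lp_indicator(1)[OF f Es])
  obtain L where L: "\<And>j::nat. compact (L j)" "\<And>j. L j \<subseteq> {x. ?g x \<noteq> 0}"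
    "AE x in M. ?g x \<noteq> 0 \<longrightarrow> (\<exists>j0. \<forall>j\<ge>j0. x \<in> L j)"
    using Lp_exhaustion[OF g] by blast
  have "AE z in M. z \<in> L j \<longrightarrow> f z = 0" for j
  proof -
    have "\<forall>y\<in>L j. \<exists>U. open U \<and> y \<in> U \<and> (AE z in M. z \<in> U \<longrightarrow> f z = 0)"
    proof
      fix y assume "y \<in> L j"
      then have "?g y \<noteq> 0" using L(2)[of j] by blast
      then have "y \<notin> esupp f" by (auto simp: indicator_def)
      then show "\<exists>U. open U \<and> y \<in> U \<and> (AE z in M. z \<in> U \<longrightarrow> f z = 0)" unfolding esupp_def by blast
    qed
    then obtain U where U: "\<And>y. y \<in> L j \<Longrightarrow> open (U y) \<and> y \<in> U y \<and> (AE z in M. z \<in> U y \<longrightarrow> f z = 0)" by metis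
    obtain Y where Y: "Y \<subseteq> L j" "finite Y" "L j \<subseteq> (\<Union>y\<in>Y. U y)"
      by (rule compactE_image[OF L(1)[of j], of "L j" U]) (use U in auto)
    have "AE z in M. \<forall>y\<in>Y. z \<in> U y \<longrightarrow> f z = 0" using U Y by (intro AE_finite_allI) auto
    then show ?thesis by eventually_elim (use Y in blast)
  qed
  then have "AE z in M. \<forall>j. z \<in> L j \<longrightarrow> f z = 0" unfolding AE_all_countable by blast
  with L(3) show ?thesis
  proof eventually_elim
    case (elim z)
    show ?case
    proof (rule impI, rule ccontr)
      assume "z \<notin> esupp f" "f z \<noteq> 0"
      then have "?g z \<noteq> 0" by simp
      then show False using elim \<open>f z \<noteq> 0\<close> by blast
    qed
  qed
qed

lemma esupp_subset:
  assumes "closed C" "AE x in M. x \<notin> C \<longrightarrow> f x = 0" shows "esupp f \<subseteq> C"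
proof
  fix y assume y: "y \<in> esupp f"
  show "y \<in> C"
  proof (rule ccontr)
    assume "y \<notin> C"
    then have "open (- C)" "y \<in> - C" using assms by auto
    moreover have "AE z in M. z \<in> - C \<longrightarrow> f z = 0" using assms(2) by simp
    ultimately show False using y unfolding esupp_def by blast
  qed
qed

lemma esupp_nonempty:
  assumes "f \<in> Lp" "\<not> (AE x in M. f x = 0)" shows "esupp f \<noteq> {}"
  using AE_esupp[OF assms(1)] assms(2) by auto

text \<open>Nonnegativity excludes cancellation: if the integral were 0, u would vanish almost
  everywhere on the open neighbourhood of y where k (- z + (y + s)) is positive.\<close>

lemma conv_pos:
  fixes u k :: "'g \<Rightarrow> real"
  assumes u: "(\<lambda>x. complex_of_real (u x)) \<in> Lp" "\<And>x. 0 \<le> u x" and y: "y \<in> esupp (\<lambda>x. complex_of_real (u x))"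
    and k: "continuous_on UNIV k" "(\<lambda>x. complex_of_real (k x)) \<in> Cc" "\<And>x. 0 \<le> k x" "0 < k s"
  shows "conv M (\<lambda>x. complex_of_real (u x)) (\<lambda>x. complex_of_real (k x)) (y + s) \<noteq> 0"
proof
  assume 0: "conv M (\<lambda>x. complex_of_real (u x)) (\<lambda>x. complex_of_real (k x)) (y + s) = 0"
  have "integrable M (\<lambda>z. complex_of_real (u z) * complex_of_real (k (- z + (y + s))))"
    using conv_Cc_integrable[OF u(1) k(2)] .
  then have i: "integrable M (\<lambda>z. u z * k (- z + (y + s)))"
    by (simp add: complex_of_real_integrable_eq flip: of_real_mult)
  have "complex_of_real (\<integral>z. u z * k (- z + (y + s)) \<partial>M) = 0"
    using 0 unfolding conv_def by (simp flip: of_real_mult integral_complex_of_real)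
  then have "(\<integral>z. u z * k (- z + (y + s)) \<partial>M) = 0" by simp
  then have ae: "AE z in M. u z * k (- z + (y + s)) = 0"
    using integral_nonneg_eq_0_iff_AE[OF i] u(2) k(3) by simp
  have c: "continuous_on UNIV (\<lambda>z. k (- z + (y + s)))"
    by (rule continuous_on_compose2[OF k(1)]) (auto intro!: continuous_intros)
  have "open {z. 0 < k (- z + (y + s))}" by (intro open_Collect_less c continuous_intros)
  moreover have "y \<in> {z. 0 < k (- z + (y + s))}" using k(4) by (simp add: add.assoc[symmetric])
  moreover have "AE z in M. z \<in> {z. 0 < k (- z + (y + s))} \<longrightarrow> complex_of_real (u z) = 0"
    using ae by eventually_elim auto
  ultimately show False using y unfolding esupp_def by blast
qed

end

section \<open>Bounded biseparating operators that commute with right convolution\<close>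

locale separating_multiplier = weighted_group M \<omega> p
  for M :: "'g::{topological_group_add,t2_space} measure" and \<omega> p +
  fixes S :: "('g \<Rightarrow> complex) \<Rightarrow> ('g \<Rightarrow> complex)" and C :: real
  assumes S_Lp: "f \<in> Lp \<Longrightarrow> S f \<in> Lp"
    and S_add: "f \<in> Lp \<Longrightarrow> g \<in> Lp \<Longrightarrow> AE x in M. S (\<lambda>x. f x + g x) x = S f x + S g x"
    and S_cmult: "f \<in> Lp \<Longrightarrow> AE x in M. S (\<lambda>x. a * f x) x = a * S f x"
    and S_inj: "f \<in> Lp \<Longrightarrow> AE x in M. S f x = 0 \<Longrightarrow> AE x in M. f x = 0"
    and S_surj: "h \<in> Lp \<Longrightarrow> \<exists>f\<in>Lp. AE x in M. S f x = h x"
    and S_bd: "f \<in> Lp \<Longrightarrow> pn (S f) \<le> C * pn f"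
    and S_sep: "f \<in> Lp \<Longrightarrow> g \<in> Lp \<Longrightarrow> AE x in M. f x * g x = 0 \<Longrightarrow> AE x in M. S f x * S g x = 0"
    and S_sep': "f \<in> Lp \<Longrightarrow> g \<in> Lp \<Longrightarrow> AE x in M. S f x * S g x = 0 \<Longrightarrow> AE x in M. f x * g x = 0"
    and S_conv: "f \<in> Lp \<Longrightarrow> g \<in> Lp \<Longrightarrow> AE x in M. S (conv M f g) x = conv M (S f) g x"
begin

text \<open>Let v be f' restricted to the zero set of f. It is disjoint from f, so S v is disjoint
  from S f, hence from |S f| = S f'. Since S also reflects disjointness, v is disjoint from f' and
  therefore vanishes.\<close>

lemma abs_preimage:
  assumes f: "f \<in> Lp"
  shows "\<exists>f'\<in>Lp. (AE x in M. S f' x = complex_of_real (norm (S f x))) \<and> (AE x in M. f x = 0 \<longrightarrow> f' x = 0)"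
proof -
  obtain f' where f': "f' \<in> Lp" "AE x in M. S f' x = complex_of_real (norm (S f x))"
    using S_surj[OF Lp_norm_fun[OF S_Lp[OF f]]] by blast
  have s: "{x. f x = 0} \<in> sets borel" using Lp_meas[OF f] by measurable
  let ?v = "\<lambda>x. indicator {x. f x = 0} x * f' x"
  have v: "?v \<in> Lp" by (rule Lp_indicator(1)[OF f'(1) s])
  have "AE x in M. S ?v x * S f x = 0" by (rule S_sep[OF v f]) (auto simp: indicator_def)
  then have "AE x in M. S ?v x * S f' x = 0" using f'(2) by eventually_elim auto
  then have "AE x in M. ?v x * f' x = 0" by (rule S_sep'[OF v f'(1)])
  then have "AE x in M. f x = 0 \<longrightarrow> f' x = 0" by eventually_elim (auto simp: indicator_def)
  then show ?thesis using f' by blast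
qed

text \<open>If the position t of y1 relative to y2 stayed away from all positions of
  \<open>esupp f\<close> relative to \<open>esupp g\<close>, then bumps k near 0 and l near t would
  make f' * k and g' * l disjoint. Their images |S f| * k and |S g| * l are both positive at y1,
  contradicting separation.\<close>

lemma esupp_S:
  assumes f: "f \<in> Lp" and g: "g \<in> Lp" and y1: "y1 \<in> esupp (S f)" and y2: "y2 \<in> esupp (S g)"
  shows "- y2 + y1 \<in> closure ((\<lambda>(b, a). - b + a) ` (esupp g \<times> esupp f))"
proof (rule ccontr)
  define E where "E = (\<lambda>(b, a). - b + a) ` (esupp g \<times> esupp f)"
  define t where "t = - y2 + y1"
  assume "\<not> ?thesis"
  then have t: "t \<in> - closure E" by (simp add: E_def t_def)
  have "open ((\<lambda>w. t + w) -` (- closure E))"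
    by (intro open_vimage) (auto intro!: continuous_intros)
  moreover have "0 \<in> (\<lambda>w. t + w) -` (- closure E)" using t by simp
  ultimately obtain V where V: "open V" "0 \<in> V" "\<And>u v. u \<in> V \<Longrightarrow> v \<in> V \<Longrightarrow> u - v \<in> (\<lambda>w. t + w) -` (- closure E)"
    using diff_nbhd by metis
  obtain k :: "'g \<Rightarrow> real" and L where k: "continuous_on UNIV k" "\<And>x. 0 \<le> k x" "\<And>x. k x \<le> 1"
    "k 0 = 1" "compact L" "L \<subseteq> V" "\<And>y. y \<notin> L \<Longrightarrow> k y = 0"
    using bump_at[OF V(1,2)] by metis
  \<comment> \<open>l is k moved to t, so |S g| * l is positive at y2 + t = y1, the same point at
    which |S f| * k is.\<close>
  define l where "l x = k (- t + x)" for x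
  let ?k = "\<lambda>x. complex_of_real (k x)" and ?l = "\<lambda>x. complex_of_real (l x)"
  have kC: "?k \<in> Cc" by (rule Cc_of_real[OF k(1,5,7)])
  have lC: "?l \<in> Cc" unfolding l_def using Cc_translate_left[OF kC, of "- t"] by simp
  have lc': "continuous_on UNIV l" unfolding l_def
    by (rule continuous_on_compose2[OF k(1)]) (auto intro!: continuous_intros)
  have kV: "k x = 0" if "x \<notin> V" for x using k(6,7) that by blast
  obtain f' where f': "f' \<in> Lp" "AE x in M. S f' x = complex_of_real (norm (S f x))" "AE x in M. f x = 0 \<longrightarrow> f' x = 0"
    using abs_preimage[OF f] by blast
  obtain g' where g': "g' \<in> Lp" "AE x in M. S g' x = complex_of_real (norm (S g x))" "AE x in M. g x = 0 \<longrightarrow> g' x = 0"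
    using abs_preimage[OF g] by blast
  have conv0: "\<exists>a\<in>esupp h. m (- a + x) \<noteq> 0"
    if "h \<in> Lp" "AE x in M. h x = 0 \<longrightarrow> h' x = 0" "conv M h' m x \<noteq> 0" for h h' :: "'g \<Rightarrow> complex" and m x
  proof (rule ccontr)
    assume "\<not> ?thesis"
    then have no: "\<And>a. a \<in> esupp h \<Longrightarrow> m (- a + x) = 0" by blast
    have "AE y in M. h' y * m (- y + x) = 0"
      using AE_esupp[OF that(1)] that(2) by eventually_elim (use no in auto)
    then have "conv M h' m x = 0" unfolding conv_def by (rule integral_eq_zero_AE)
    then show False using that by simp
  qed
  \<comment> \<open>If both factors were nonzero at x, there would be a in \<open>esupp f\<close>
    and b in \<open>esupp g\<close> with - a + x and - t + (- b + x) in V. The difference of the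
    latter and the former, added to t on the left, is - b + a, which the choice of V keeps off the
    closure of E.\<close>
  have prod0: "conv M f' ?k x * conv M g' ?l x = 0" for x
  proof (rule ccontr)
    assume "conv M f' ?k x * conv M g' ?l x \<noteq> 0"
    then have n: "conv M f' ?k x \<noteq> 0" "conv M g' ?l x \<noteq> 0" by auto
    obtain a where a: "a \<in> esupp f" "?k (- a + x) \<noteq> 0" using conv0[OF f f'(3) n(1)] by blast
    obtain b where b: "b \<in> esupp g" "?l (- b + x) \<noteq> 0" using conv0[OF g g'(3) n(2)] by blast
    have aV: "- a + x \<in> V" using a(2) kV by auto
    have bV: "- t + (- b + x) \<in> V" using b(2) kV by (auto simp: l_def)
    have "t + ((- t + (- b + x)) - (- a + x)) = - b + a"
    proof -
      have "- (- a + x) = - x + a" by (simp add: minus_add)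
      then have "t + ((- t + (- b + x)) - (- a + x)) = ((- b + x) + - x) + a"
        unfolding diff_conv_add_uminus
        by (simp only: add.assoc[symmetric] add.right_inverse add.left_neutral)
      then show ?thesis by simp
    qed
    then have "- b + a \<in> - closure E" using V(3)[OF bV aV] by auto
    moreover have "- b + a \<in> E" unfolding E_def using a b by force
    ultimately show False using closure_subset by blast
  qed
  let ?u = "\<lambda>x. complex_of_real (norm (S f x))" and ?w = "\<lambda>x. complex_of_real (norm (S g x))"
  have uL: "?u \<in> Lp" "?w \<in> Lp" using f g by (auto intro: Lp_norm_fun S_Lp)
  have Lk: "?k \<in> Lp" "?l \<in> Lp" using kC lC by (auto intro: Lp_Cc)
  have "AE x in M. S (conv M f' ?k) x * S (conv M g' ?l) x = 0"
    by (rule S_sep) (auto intro!: conv_Lp f' g' Lk simp: prod0)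
  moreover have "AE x in M. S (conv M f' ?k) x = conv M ?u ?k x"
    using S_conv[OF f'(1) Lk(1)] conv_cong_left[OF Lp_meas[OF S_Lp[OF f'(1)]] Lp_meas[OF uL(1)] Lp_meas[OF Lk(1)] f'(2)] by simp
  moreover have "AE x in M. S (conv M g' ?l) x = conv M ?w ?l x"
    using S_conv[OF g'(1) Lk(2)] conv_cong_left[OF Lp_meas[OF S_Lp[OF g'(1)]] Lp_meas[OF uL(2)] Lp_meas[OF Lk(2)] g'(2)] by simp
  ultimately have "AE x in M. conv M ?u ?k x * conv M ?w ?l x = 0" by eventually_elim simp
  then have "(\<lambda>x. conv M ?u ?k x * conv M ?w ?l x) = (\<lambda>_. 0)"
    by (intro AE_eq_continuous continuous_on_mult conv_Cc_continuous uL kC lC) (auto elim: eventually_mono)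
  then have z: "conv M ?u ?k y1 * conv M ?w ?l y1 = 0" by meson
  have e1: "y1 \<in> esupp ?u" "y2 \<in> esupp ?w" using y1 y2 by (simp_all add: esupp_def)
  have "conv M ?u ?k (y1 + 0) \<noteq> 0"
    by (rule conv_pos[OF uL(1) _ e1(1) k(1) kC k(2)]) (use k(4) in auto)
  moreover have "conv M ?w ?l (y2 + t) \<noteq> 0"
    by (rule conv_pos[OF uL(2) _ e1(2) lc' lC]) (use k(2,4) in \<open>auto simp: l_def\<close>)
  moreover have "y2 + t = y1" by (simp add: t_def add.assoc[symmetric])
  ultimately show False using z by simp
qed

text \<open>The point a is where S sends a unit mass at 0: it is common to the closures of all
  supports \<open>esupp (S g)\<close> as g is confined to ever smaller compact neighbourhoods of 0.
  \<open>esupp_S\<close> traps these closures in one compact set, so the finite intersection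
  property yields a.\<close>

lemma exists_shift: "\<exists>a. \<forall>f\<in>Lp. \<forall>y\<in>esupp (S f). - a + y \<in> esupp f"
proof -
  obtain V0 K0 where V0: "open V0" "compact K0" "(0::'g) \<in> V0" "V0 \<subseteq> K0"
    using compact_nbhd_base[OF lc open_UNIV, of 0] by auto
  define I where "I = {K. compact K \<and> 0 \<in> interior K \<and> K \<subseteq> K0}"
  define F where "F K = closure (\<Union>f\<in>{f\<in>Lp. \<forall>x. x \<notin> K \<longrightarrow> f x = 0}. esupp (S f))" for K
  have sub: "esupp f \<subseteq> K" if "closed K" "\<forall>x. x \<notin> K \<longrightarrow> f x = 0" for f K
    using that by (intro esupp_subset) auto
  have ne: "\<exists>f\<in>Lp. (\<forall>x. x \<notin> K \<longrightarrow> f x = 0) \<and> esupp (S f) \<noteq> {}" if K: "compact K" "0 \<in> interior K" for K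
  proof -
    have i: "indicator K \<in> Lp" using K by (intro Lp_indicator_compact[OF K(1)]) (auto intro: borel_compact)
    have "\<not> (AE x in M. S (indicator K) x = 0)"
    proof
      assume "AE x in M. S (indicator K) x = 0"
      then have "AE x in M. indicator K x = (0::complex)" by (rule S_inj[OF i])
      then have "AE x in M. x \<notin> interior K" by eventually_elim (use interior_subset in \<open>auto simp: indicator_def split: if_splits\<close>)
      then show False using open_AE_notin[OF open_interior] K by blast
    qed
    then have "esupp (S (indicator K)) \<noteq> {}" by (rule esupp_nonempty[OF S_Lp[OF i]])
    then show ?thesis using i by (intro bexI[of _ "indicator K"]) auto
  qed
  have K0I: "K0 \<in> I" using V0 interior_maximal[of V0 K0] by (auto simp: I_def)
  obtain f0 y0 where f0: "f0 \<in> Lp" "\<forall>x. x \<notin> K0 \<longrightarrow> f0 x = 0" "y0 \<in> esupp (S f0)"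
    using ne[of K0] K0I by (auto simp: I_def)
  define Q where "Q = (\<lambda>(b, a). - b + a) ` (K0 \<times> K0)"
  have Q: "compact Q" unfolding Q_def
    by (intro compact_continuous_image compact_Times V0) (auto simp: case_prod_beta intro!: continuous_intros)
  have Q': "compact ((+) y0 ` Q)" using Q by (intro compact_continuous_image continuous_intros)
  have FQ: "F K \<subseteq> (+) y0 ` Q" if K: "K \<in> I" for K
    unfolding F_def
  proof (rule closure_minimal)
    show "closed ((+) y0 ` Q)" by (rule compact_imp_closed[OF Q'])
    show "(\<Union>f\<in>{f\<in>Lp. \<forall>x. x \<notin> K \<longrightarrow> f x = 0}. esupp (S f)) \<subseteq> (+) y0 ` Q"
    proof
      fix y assume "y \<in> (\<Union>f\<in>{f\<in>Lp. \<forall>x. x \<notin> K \<longrightarrow> f x = 0}. esupp (S f))"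
      then obtain f where f: "f \<in> Lp" "\<forall>x. x \<notin> K \<longrightarrow> f x = 0" "y \<in> esupp (S f)" by auto
      have KK: "K \<subseteq> K0" using K by (simp add: I_def)
      have "- y0 + y \<in> closure ((\<lambda>(b, a). - b + a) ` (esupp f0 \<times> esupp f))"
        by (rule esupp_S[OF f(1) f0(1) f(3) f0(3)])
      also have "\<dots> \<subseteq> closure Q" unfolding Q_def
        using sub[OF compact_imp_closed[OF V0(2)] f0(2)] sub[OF compact_imp_closed[OF V0(2)], of f] f(2) KK
        by (intro closure_mono image_mono Sigma_mono) auto
      also have "\<dots> = Q" using compact_imp_closed[OF Q] by simp
      finally have "y0 + (- y0 + y) \<in> (+) y0 ` Q" by blast
      then show "y \<in> (+) y0 ` Q" by (simp add: add.assoc[symmetric])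
    qed
  qed
  have "(+) y0 ` Q \<inter> (\<Inter>K\<in>I. F K) \<noteq> {}"
  proof (rule compact_imp_fip_image[OF Q'])
    show "closed (F K)" for K by (simp add: F_def)
    fix J assume J: "finite J" "J \<subseteq> I"
    \<comment> \<open>Including K0 makes K compact even when J is empty.\<close>
    define K where "K = K0 \<inter> \<Inter>J"
    have "compact K \<and> 0 \<in> interior K"
    proof
      show "compact K" unfolding K_def using J V0
        by (intro compact_Int_closed closed_Inter) (auto simp: I_def subset_iff intro: compact_imp_closed)
      have "open (\<Inter>K\<in>J. interior K)" using J(1) by (intro open_INT) auto
      moreover have "(\<Inter>K\<in>J. interior K) \<subseteq> \<Inter>J" using interior_subset by blast
      ultimately have "(\<Inter>K\<in>J. interior K) \<subseteq> interior (\<Inter>J)" by (rule interior_maximal[rotated])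
      moreover have "0 \<in> (\<Inter>K\<in>J. interior K)" using J(2) by (auto simp: I_def)
      ultimately have "0 \<in> interior (\<Inter>J)" by (rule subsetD)
      then show "0 \<in> interior K" unfolding K_def using K0I by (simp add: I_def)
    qed
    then have KI: "K \<in> I" by (auto simp: I_def K_def)
    have "F K \<subseteq> F K'" if "K' \<in> J" for K'
      unfolding F_def using that by (intro closure_mono UN_mono) (auto simp: K_def)
    moreover have "F K \<noteq> {}"
      unfolding F_def using ne[of K] KI closure_subset by (fastforce simp: I_def)
    ultimately show "(+) y0 ` Q \<inter> (\<Inter>K\<in>J. F K) \<noteq> {}" using FQ[OF KI] by blast
  qed
  then obtain a where a: "\<And>K. K \<in> I \<Longrightarrow> a \<in> F K" by blast
  \<comment> \<open>Otherwise take g supported so near 0, and a' in \<open>esupp (S g)\<close> so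
    near a, that \<open>esupp_S\<close> yields b near 0 and c in \<open>esupp f\<close> with - b + c
    near - a + y; then c = b + (- b + c) would lie off \<open>esupp f\<close>.\<close>
  have "- a + y \<in> esupp f" if f: "f \<in> Lp" and y: "y \<in> esupp (S f)" for f y
  proof (rule ccontr)
    assume n: "- a + y \<notin> esupp f"
    have "open (- esupp f)" "0 + (- a + y) \<in> - esupp f" using closed_esupp[of f] n by auto
    then obtain W N where WN: "open W" "open N" "0 \<in> W" "- a + y \<in> N" "\<And>w n. w \<in> W \<Longrightarrow> n \<in> N \<Longrightarrow> w + n \<in> - esupp f"
      using add_nbhd[of "- esupp f" 0 "- a + y"] by metis
    have WV: "open (W \<inter> V0)" "0 \<in> W \<inter> V0" using WN V0 by auto
    obtain V K where VK: "open V" "compact K" "0 \<in> V" "V \<subseteq> K" "K \<subseteq> W \<inter> V0"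
      using compact_nbhd_base[OF lc WV] by auto
    have KI: "K \<in> I" unfolding I_def using VK V0 interior_maximal[of V K] by auto
    have "open ((\<lambda>a'. - a' + y) -` N)" by (intro open_vimage WN) (auto intro!: continuous_intros)
    moreover have "a \<in> (\<lambda>a'. - a' + y) -` N" using WN by simp
    ultimately have "(\<lambda>a'. - a' + y) -` N \<inter> (\<Union>f\<in>{f\<in>Lp. \<forall>x. x \<notin> K \<longrightarrow> f x = 0}. esupp (S f)) \<noteq> {}"
      using a[OF KI] unfolding F_def closure_iff_nhds_not_empty by blast
    then obtain a' g where g: "- a' + y \<in> N" "g \<in> Lp" "\<forall>x. x \<notin> K \<longrightarrow> g x = 0" "a' \<in> esupp (S g)" by auto
    have "- a' + y \<in> closure ((\<lambda>(b, a). - b + a) ` (esupp g \<times> esupp f))"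
      by (rule esupp_S[OF f g(2) y g(4)])
    then have "N \<inter> (\<lambda>(b, a). - b + a) ` (esupp g \<times> esupp f) \<noteq> {}"
      using g(1) WN(2) unfolding closure_iff_nhds_not_empty by blast
    then obtain b c where bc: "b \<in> esupp g" "c \<in> esupp f" "- b + c \<in> N" by auto
    have "b \<in> W" using bc(1) sub[OF compact_imp_closed[OF VK(2)] g(3)] VK by auto
    then have "b + (- b + c) \<in> - esupp f" using WN(5) bc(3) by blast
    then show False using bc(2) by (simp add: add.assoc[symmetric])
  qed
  then show ?thesis by blast
qed

end

section \<open>Multipliers that do not enlarge supports are scalars\<close>

locale local_multiplier = weighted_group M \<omega> p
  for M :: "'g::{topological_group_add,t2_space} measure" and \<omega> p +
  fixes U :: "('g \<Rightarrow> complex) \<Rightarrow> ('g \<Rightarrow> complex)" and C :: real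
  assumes U_Lp: "f \<in> Lp \<Longrightarrow> U f \<in> Lp"
    and U_add: "f \<in> Lp \<Longrightarrow> g \<in> Lp \<Longrightarrow> AE x in M. U (\<lambda>x. f x + g x) x = U f x + U g x"
    and U_cmult: "f \<in> Lp \<Longrightarrow> AE x in M. U (\<lambda>x. a * f x) x = a * U f x"
    and U_bd: "f \<in> Lp \<Longrightarrow> pn (U f) \<le> C * pn f"
    and U_esupp: "f \<in> Lp \<Longrightarrow> esupp (U f) \<subseteq> esupp f"
    and U_conv: "f \<in> Lp \<Longrightarrow> g \<in> Lp \<Longrightarrow> AE x in M. U (conv M f g) x = conv M (U f) g x"
begin

lemma U_diff:
  assumes f: "f \<in> Lp" and g: "g \<in> Lp" shows "AE x in M. U (\<lambda>x. f x - g x) x = U f x - U g x"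
proof -
  have "(\<lambda>x. f x - g x) = (\<lambda>x. f x + (-1) * g x)" by auto
  moreover have "AE x in M. U (\<lambda>x. f x + (-1) * g x) x = U f x - U g x"
    using U_add[OF f Lp_cmult(1)[OF g, of "-1"]] U_cmult[OF g, of "-1"] by eventually_elim simp
  ultimately show ?thesis by simp
qed

lemma pn_U_diff:
  assumes f: "f \<in> Lp" and g: "g \<in> Lp" shows "pn (\<lambda>x. U f x - U g x) \<le> C * pn (\<lambda>x. f x - g x)"
proof -
  have D: "(\<lambda>x. f x - g x) \<in> Lp" by (rule Lp_diff(1)[OF f g])
  have "pn (\<lambda>x. U f x - U g x) = pn (U (\<lambda>x. f x - g x))"
    using U_diff[OF f g] by (intro pn_cong_AE Lp_meas Lp_diff(1) U_Lp f g) (auto elim: eventually_mono)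
  then show ?thesis using U_bd[OF D] by simp
qed

text \<open>The closed support of f may be much larger than the set where f is nonzero, so
  \<open>U_esupp\<close> alone says too little. It is applied to f cut off to compact sets inside
  that set, where support and nonvanishing agree well enough, and boundedness of U gives the
  limit.\<close>

lemma local_vanish:
  assumes f: "f \<in> Lp" shows "AE x in M. f x = 0 \<longrightarrow> U f x = 0"
proof -
  have As: "{x. f x = 0} \<in> sets borel" using Lp_meas[OF f] by measurable
  let ?h = "\<lambda>x. indicator {x. f x = 0} x * U f x"
  have hL: "?h \<in> Lp" by (rule Lp_indicator(1)[OF U_Lp[OF f] As])
  obtain L where L: "\<And>j::nat. compact (L j)" "\<And>j. L j \<subseteq> {x. f x \<noteq> 0}"
    "(\<lambda>j. pn (\<lambda>x. indicator (L j) x * f x - f x)) \<longlonglongrightarrow> 0"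
    using Lp_cutoff[OF f] by blast
  have le: "pn ?h \<le> C * pn (\<lambda>x. indicator (L j) x * f x - f x)" for j
  proof -
    let ?fj = "\<lambda>x. indicator (L j) x * f x"
    have fj: "?fj \<in> Lp" by (rule Lp_indicator(1)[OF f borel_compact[OF L(1)]])
    have "esupp ?fj \<subseteq> L j" by (rule esupp_subset) (auto intro: compact_imp_closed L)
    then have sub: "esupp (U ?fj) \<subseteq> L j" using U_esupp[OF fj] by blast
    have "AE x in M. ?h x = indicator {x. f x = 0} x * (U f x - U ?fj x)"
      using AE_esupp[OF U_Lp[OF fj]]
    proof eventually_elim
      case (elim x)
      show ?case
      proof (cases "f x = 0")
        case True
        then have "x \<notin> L j" using L(2) by blast
        then have "U ?fj x = 0" using sub elim by blast
        then show ?thesis by simp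
      qed simp
    qed
    then have "pn ?h = pn (\<lambda>x. indicator {x. f x = 0} x * (U f x - U ?fj x))"
      by (intro pn_cong_AE Lp_meas[OF hL] Lp_meas[OF Lp_indicator(1)[OF Lp_diff(1)[OF U_Lp[OF f] U_Lp[OF fj]] As]])
    also have "\<dots> \<le> pn (\<lambda>x. U f x - U ?fj x)" by (rule Lp_indicator(2)[OF Lp_diff(1)[OF U_Lp[OF f] U_Lp[OF fj]] As])
    also have "\<dots> \<le> C * pn (\<lambda>x. f x - ?fj x)" by (rule pn_U_diff[OF f fj])
    finally show ?thesis using pn_minus_commute[of f ?fj] by simp
  qed
  have "(\<lambda>j. C * pn (\<lambda>x. indicator (L j) x * f x - f x)) \<longlonglongrightarrow> 0" using L(3) tendsto_mult_right_zero by blast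
  then have "pn ?h \<le> 0" by (rule LIMSEQ_le_const) (use le in blast)
  then have "pn ?h = 0" using pn_nonneg[of ?h] by simp
  then have "AE x in M. ?h x = 0" using pn_eq_0_iff[OF hL] by simp
  then show ?thesis by eventually_elim (auto simp: indicator_def)
qed

lemma local_indicator:
  assumes f: "f \<in> Lp" and A: "A \<in> sets borel"
  shows "AE x in M. U (\<lambda>x. indicator A x * f x) x = indicator A x * U f x"
proof -
  let ?f1 = "\<lambda>x. indicator A x * f x" and ?f2 = "\<lambda>x. indicator (- A) x * f x"
  have A': "- A \<in> sets borel" using A by auto
  have L: "?f1 \<in> Lp" "?f2 \<in> Lp" using Lp_indicator(1)[OF f A] Lp_indicator(1)[OF f A'] by auto
  have "(\<lambda>x. ?f1 x + ?f2 x) = f" by (auto simp: indicator_def)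
  then have "AE x in M. U f x = U ?f1 x + U ?f2 x" using U_add[OF L] by simp
  then show ?thesis using local_vanish[OF L(1)] local_vanish[OF L(2)]
    by eventually_elim (auto simp: indicator_def)
qed

lemma local_simple:
  assumes f: "f \<in> Lp" and s: "simple_function M s" and B: "\<And>x. norm (s x) \<le> B"
  shows "AE x in M. U (\<lambda>x. s x * f x) x = s x * U f x"
proof -
  have fin: "finite (range s)" using simple_functionD(1)[OF s] by simp
  have vs: "s -` {v} \<in> sets borel" for v using simple_functionD(2)[OF s, of "{v}"] by simp
  have L: "(\<lambda>x. \<Sum>v\<in>V. v * (indicator (s -` {v}) x * f x)) \<in> Lp" if "finite V" for V
    by (intro Lp_sum that Lp_cmult(1) Lp_indicator(1) f vs)
  have app: "AE x in M. U (\<lambda>x. \<Sum>v\<in>V. v * (indicator (s -` {v}) x * f x)) x = (\<Sum>v\<in>V. v * (indicator (s -` {v}) x * U f x))"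
    if "finite V" for V
    using that
  proof (induction V rule: finite_induct)
    case empty
    have "AE x in M. U (\<lambda>x. 0 * f x) x = 0 * U f x" by (rule U_cmult[OF f])
    then show ?case by simp
  next
    case (insert v V)
    let ?g = "\<lambda>x. indicator (s -` {v}) x * f x"
    have g: "?g \<in> Lp" by (rule Lp_indicator(1)[OF f vs])
    have "AE x in M. U (\<lambda>x. v * ?g x + (\<Sum>v\<in>V. v * (indicator (s -` {v}) x * f x))) x
      = v * (indicator (s -` {v}) x * U f x) + (\<Sum>v\<in>V. v * (indicator (s -` {v}) x * U f x))"
      using U_add[OF Lp_cmult(1)[OF g, of v] L[OF insert.hyps(1)]] U_cmult[OF g, of v] local_indicator[OF f vs[of v]] insert.IH
      by eventually_elim simp
    then show ?case unfolding sum.insert[OF insert.hyps] .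
  qed
  have eq: "(\<Sum>v\<in>range s. v * (indicator (s -` {v}) x * c)) = s x * c" for x c
  proof -
    have "(\<Sum>v\<in>range s. v * (indicator (s -` {v}) x * c)) = (\<Sum>v\<in>range s. if v = s x then v * c else 0)"
      by (intro sum.cong) (auto simp: indicator_def)
    also have "\<dots> = s x * c" using fin sum.delta[of "range s" "s x" "\<lambda>v. v * c"] by auto
    finally show ?thesis .
  qed
  show ?thesis using app[OF fin] unfolding eq .
qed

text \<open>Simple functions approximate s with a uniform bound, so both sides pass to the limit in
  \<open>pn\<close> by dominated convergence and boundedness of U.\<close>

lemma local_bounded:
  assumes f: "f \<in> Lp" and s: "s \<in> borel_measurable borel" and B: "\<And>x. norm (s x) \<le> 1"
  shows "AE x in M. U (\<lambda>x. s x * f x) x = s x * U f x"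
proof -
  obtain F where F: "\<And>i::nat. simple_function M (F i)" "\<And>x. (\<lambda>i. F i x) \<longlonglongrightarrow> s x" "\<And>i x. norm (F i x) \<le> 2 * norm (s x)"
    using simple_approximation[OF s] by blast
  have FB: "norm (F i x) \<le> 2" for i x using F(3)[of i x] B[of x] by simp
  have FsB: "norm (F i x - s x) \<le> 3" for i x
    using norm_triangle_ineq4[of "F i x" "s x"] FB[of i x] B[of x] by simp
  have Fm: "F i \<in> borel_measurable borel" for i by (rule simple_meas[OF F(1)])
  have mul: "(\<lambda>x. t x * g x) \<in> Lp" if "g \<in> Lp" "t \<in> borel_measurable borel" "\<And>x. norm (t x) \<le> 3" for t g :: "'g \<Rightarrow> complex"
  proof (rule Lp_mono(1)[OF Lp_cmult(1)[OF that(1), of 3]])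
    show "(\<lambda>x. t x * g x) \<in> borel_measurable borel" using that Lp_meas[of g] by (intro borel_measurable_times) auto
    show "norm (t x * g x) \<le> norm (3 * g x)" for x using mult_right_mono[OF that(3)[of x], of "norm (g x)"] by (simp add: norm_mult)
  qed
  have sL: "(\<lambda>x. s x * g x) \<in> Lp" if "g \<in> Lp" for g
    by (rule mul[OF that s order_trans[OF B]]) simp
  have FL: "(\<lambda>x. F i x * g x) \<in> Lp" if "g \<in> Lp" for g i
    by (rule mul[OF that Fm order_trans[OF FB]]) simp
  have lim: "(\<lambda>i. pn (\<lambda>x. F i x * g x - s x * g x)) \<longlonglongrightarrow> 0" if g: "g \<in> Lp" for g
  proof (rule Lp_dominated[OF g, where C = 3])
    show "(\<lambda>x. F i x * g x - s x * g x) \<in> borel_measurable borel" for i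
      by (rule Lp_meas[OF Lp_diff(1)[OF FL[OF g] sL[OF g]]])
    show "norm (F i x * g x - s x * g x) \<le> 3 * norm (g x)" for i x
      using mult_right_mono[OF FsB[of i x], of "norm (g x)"] by (simp add: norm_mult flip: left_diff_distrib)
    have "(\<lambda>i. (F i x - s x) * g x) \<longlonglongrightarrow> 0" for x
      using F(2)[of x] by (intro tendsto_mult_left_zero) (simp add: LIM_zero)
    then show "AE x in M. (\<lambda>i. F i x * g x - s x * g x) \<longlonglongrightarrow> 0" by (simp add: left_diff_distrib)
  qed simp
  let ?h = "\<lambda>x. U (\<lambda>x. s x * f x) x - s x * U f x"
  have hL: "?h \<in> Lp" by (rule Lp_diff(1)[OF U_Lp[OF sL[OF f]] sL[OF U_Lp[OF f]]])
  have le: "pn ?h \<le> 2 powr p * (C * pn (\<lambda>x. F i x * f x - s x * f x) + pn (\<lambda>x. F i x * U f x - s x * U f x))" for i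
  proof -
    let ?A = "\<lambda>x. U (\<lambda>x. s x * f x) x - U (\<lambda>x. F i x * f x) x" and ?B = "\<lambda>x. F i x * U f x - s x * U f x"
    have AL: "?A \<in> Lp" by (rule Lp_diff(1)[OF U_Lp[OF sL[OF f]] U_Lp[OF FL[OF f]]])
    have BL: "?B \<in> Lp" by (rule Lp_diff(1)[OF FL[OF U_Lp[OF f]] sL[OF U_Lp[OF f]]])
    have "AE x in M. ?h x = ?A x + ?B x" using local_simple[OF f F(1)[of i] FB] by eventually_elim simp
    then have "pn ?h = pn (\<lambda>x. ?A x + ?B x)"
      by (intro pn_cong_AE Lp_meas[OF hL] Lp_meas[OF Lp_add(1)[OF AL BL]])
    also have "\<dots> \<le> 2 powr p * (pn ?A + pn ?B)" by (rule Lp_add(2)[OF AL BL])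
    also have "\<dots> \<le> 2 powr p * (C * pn (\<lambda>x. F i x * f x - s x * f x) + pn ?B)"
      using pn_U_diff[OF sL[OF f] FL[OF f, of i]] pn_minus_commute[of "\<lambda>x. s x * f x" "\<lambda>x. F i x * f x"]
      by (intro mult_left_mono add_right_mono) auto
    finally show ?thesis .
  qed
  have "(\<lambda>i. 2 powr p * (C * pn (\<lambda>x. F i x * f x - s x * f x) + pn (\<lambda>x. F i x * U f x - s x * U f x))) \<longlonglongrightarrow> 2 powr p * (C * 0 + 0)"
    by (intro tendsto_intros lim f U_Lp)
  then have "pn ?h \<le> 2 powr p * (C * 0 + 0)" by (rule LIMSEQ_le_const) (use le in blast)
  then have "pn ?h = 0" using pn_nonneg[of ?h] by simp
  then have "AE x in M. ?h x = 0" using pn_eq_0_iff[OF hL] by simp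
  then show ?thesis by eventually_elim simp
qed

text \<open>Both f and g are bounded multiples of h = |f| + |g|, so U multiplies both by U h / h.
  The cross-multiplied form expresses that U is a multiplication operator without requiring one
  function of \<open>Lp\<close> that is nonzero almost everywhere.\<close>

lemma local_commute:
  assumes f: "f \<in> Lp" and g: "g \<in> Lp" shows "AE x in M. g x * U f x = f x * U g x"
proof -
  define h where "h x = complex_of_real (norm (f x)) + complex_of_real (norm (g x))" for x
  have h: "h \<in> Lp" unfolding h_def by (intro Lp_add(1) Lp_norm_fun f g)
  have hm: "h \<in> borel_measurable borel" by (rule Lp_meas[OF h])
  have nh: "norm (h x) = norm (f x) + norm (g x)" for x
    unfolding h_def by (simp add: norm_of_real flip: of_real_add)
  \<comment> \<open>Where h is 0 so is u, and division by zero returns 0, so u / h is bounded by 1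
    everywhere and (u / h) * h = u without exception.\<close>
  have key: "AE x in M. U u x = (u x / h x) * U h x" if u: "u \<in> Lp" "\<And>x. norm (u x) \<le> norm (h x)" for u
  proof -
    have "AE x in M. U (\<lambda>x. (u x / h x) * h x) x = (u x / h x) * U h x"
    proof (rule local_bounded[OF h])
      show "(\<lambda>x. u x / h x) \<in> borel_measurable borel" using Lp_meas[OF u(1)] hm by measurable
      show "norm (u x / h x) \<le> 1" for x using u(2)[of x] by (auto simp: norm_divide divide_le_eq_1)
    qed
    moreover have "(\<lambda>x. (u x / h x) * h x) = u"
    proof
      show "(u x / h x) * h x = u x" for x using u(2)[of x] by (cases "h x = 0") auto
    qed
    ultimately show ?thesis by simp
  qed
  have "AE x in M. U f x = (f x / h x) * U h x" "AE x in M. U g x = (g x / h x) * U h x"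
    using key[OF f] key[OF g] nh by auto
  then show ?thesis by eventually_elim simp
qed

text \<open>\<open>local_commute\<close> for f * l and k * k gives an identity of continuous
  functions, hence valid at the point 0. There k * k is nonzero, so (U f) * l at 0 is c times f * l
  at 0 for all l in \<open>Cc\<close>, and \<open>conv_determines\<close> concludes.\<close>

lemma local_scalar: "\<exists>c. \<forall>f\<in>Lp. AE x in M. U f x = c * f x"
proof -
  obtain k :: "'g \<Rightarrow> real" and L where k: "continuous_on UNIV k" "\<And>x. 0 \<le> k x" "\<And>x. k x \<le> 1"
    "k 0 = 1" "compact L" "\<And>y. y \<notin> L \<Longrightarrow> k y = 0"
    using bump_at[OF open_UNIV UNIV_I, of 0] by metis
  let ?k = "\<lambda>x. complex_of_real (k x)"
  have kC: "?k \<in> Cc" by (rule Cc_of_real[OF k(1,5,6)])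
  have kL: "?k \<in> Lp" by (rule Lp_Cc[OF kC])
  have "0 \<in> esupp ?k"
    unfolding esupp_def
  proof (intro CollectI allI impI notI, elim conjE)
    fix W assume W: "open W" "(0::'g) \<in> W" and ae: "AE z in M. z \<in> W \<longrightarrow> ?k z = 0"
    have "open (W \<inter> {z. 0 < k z})" using W k(1) by (intro open_Int open_Collect_less continuous_intros) auto
    moreover have "AE z in M. z \<notin> W \<inter> {z. 0 < k z}" using ae by eventually_elim auto
    ultimately have "W \<inter> {z. 0 < k z} = {}" by (rule open_AE_notin)
    moreover have "0 \<in> W \<inter> {z. 0 < k z}" using W k(4) by simp
    ultimately show False by simp
  qed
  from conv_pos[OF kL k(2) this k(1) kC k(2), of 0] have nz: "conv M ?k ?k 0 \<noteq> 0" using k(4) by simp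
  define c where "c = conv M (U ?k) ?k 0 / conv M ?k ?k 0"
  have "AE x in M. U f x = c * f x" if f: "f \<in> Lp" for f
  proof (rule conv_determines[OF U_Lp[OF f] Lp_cmult(1)[OF f]])
    fix l :: "'g \<Rightarrow> complex" assume l: "l \<in> Cc"
    have lL: "l \<in> Lp" by (rule Lp_Cc[OF l])
    have "AE x in M. conv M ?k ?k x * conv M (U f) l x = conv M f l x * conv M (U ?k) ?k x"
      using local_commute[OF conv_Lp[OF f lL] conv_Lp[OF kL kL]] U_conv[OF f lL] U_conv[OF kL kL] by eventually_elim simp
    then have "(\<lambda>x. conv M ?k ?k x * conv M (U f) l x) = (\<lambda>x. conv M f l x * conv M (U ?k) ?k x)"
      by (intro AE_eq_continuous continuous_on_mult conv_Cc_continuous U_Lp f kL kC l) (auto elim: eventually_mono)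
    then have "conv M ?k ?k 0 * conv M (U f) l 0 = conv M f l 0 * conv M (U ?k) ?k 0" by meson
    then have "conv M (U f) l 0 = c * conv M f l 0" using nz by (simp add: c_def field_simps)
    then show "conv M (U f) l 0 = conv M (\<lambda>x. c * f x) l 0" by (simp add: conv_cmult_left)
  qed
  then show ?thesis by blast
qed

end

context separating_multiplier
begin

theorem multiplier_form: "\<exists>a c. c \<noteq> 0 \<and> (\<forall>f\<in>Lp. AE x in M. S f x = c * ltrans a f x)"
proof -
  obtain a where a: "\<And>f y. f \<in> Lp \<Longrightarrow> y \<in> esupp (S f) \<Longrightarrow> - a + y \<in> esupp f" using exists_shift by blast
  \<comment> \<open>Undoing the shift a leaves an operator that satisfies \<open>U_esupp\<close>;
    left translation keeps the commutation with right convolution.\<close>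
  define U where "U f = ltrans (- a) (S f)" for f
  have Ux: "U f x = S f (a + x)" for f x by (simp add: U_def ltrans_def)
  interpret U: local_multiplier M \<omega> p U "\<omega> (- a) powr p * C"
  proof
    fix f g :: "'g \<Rightarrow> complex" and b
    assume f: "f \<in> Lp"
    show "U f \<in> Lp" unfolding U_def by (rule Lp_ltrans(1)[OF S_Lp[OF f]])
    show "AE x in M. U (\<lambda>x. b * f x) x = b * U f x" unfolding Ux by (rule AE_plus[OF S_cmult[OF f]])
    have "pn (U f) \<le> \<omega> (- a) powr p * pn (S f)" unfolding U_def by (rule Lp_ltrans(2)[OF S_Lp[OF f]])
    also have "\<dots> \<le> \<omega> (- a) powr p * (C * pn f)" by (intro mult_left_mono S_bd f) auto
    finally show "pn (U f) \<le> \<omega> (- a) powr p * C * pn f" by (simp add: mult.assoc)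
    show "esupp (U f) \<subseteq> esupp f"
    proof
      fix y assume y: "y \<in> esupp (U f)"
      have "a + y \<in> esupp (S f)"
        unfolding esupp_def
      proof (intro CollectI allI impI notI, elim conjE)
        fix W assume W: "open W" "a + y \<in> W" "AE z in M. z \<in> W \<longrightarrow> S f z = 0"
        have "open ((\<lambda>z. a + z) -` W)" by (intro open_vimage W) (auto intro!: continuous_intros)
        moreover have "AE z in M. z \<in> (\<lambda>z. a + z) -` W \<longrightarrow> U f z = 0"
          using AE_plus[OF W(3), of a] by eventually_elim (simp add: Ux)
        ultimately show False using y W(2) unfolding esupp_def by blast
      qed
      from a[OF f this] show "y \<in> esupp f" by (simp add: add.assoc[symmetric])
    qed
    assume g: "g \<in> Lp"
    show "AE x in M. U (\<lambda>x. f x + g x) x = U f x + U g x" unfolding Ux by (rule AE_plus[OF S_add[OF f g]])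
    have "conv M (U f) g = ltrans (- a) (conv M (S f) g)"
      unfolding U_def by (rule conv_ltrans[OF Lp_meas[OF S_Lp[OF f]] Lp_meas[OF g]])
    then show "AE x in M. U (conv M f g) x = conv M (U f) g x"
      using AE_plus[OF S_conv[OF f g], of a] by (simp add: U_def ltrans_def)
  qed
  obtain c where c: "\<And>f. f \<in> Lp \<Longrightarrow> AE x in M. U f x = c * f x" using U.local_scalar by blast
  have form: "AE x in M. S f x = c * ltrans a f x" if f: "f \<in> Lp" for f
    using AE_plus[OF c[OF f], of "- a"] by eventually_elim (simp add: Ux ltrans_def add.assoc[symmetric])
  have "c \<noteq> 0"
  proof
    assume c0: "c = 0"
    obtain V K where VK: "open V" "compact K" "(0::'g) \<in> V" "V \<subseteq> K"
      using compact_nbhd_base[OF lc open_UNIV, of 0] by auto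
    have i: "indicator K \<in> Lp" using VK by (intro Lp_indicator_compact[OF VK(2)]) (auto intro: borel_compact)
    have "AE x in M. S (indicator K) x = 0" using form[OF i] by eventually_elim (simp add: c0)
    then have "AE x in M. indicator K x = (0::complex)" by (rule S_inj[OF i])
    then have "AE x in M. x \<notin> V" by eventually_elim (use VK in \<open>auto simp: indicator_def split: if_splits\<close>)
    then show False using open_AE_notin[OF VK(1)] VK(3) by blast
  qed
  then show ?thesis using form by blast
qed

end

subsection \<open>Biseparating isomorphisms\<close>

context weighted_group
begin

lemma ltrans_cong_AE: "AE x in M. f x = g x \<Longrightarrow> AE x in M. ltrans a f x = ltrans a g x"
  unfolding ltrans_def by (rule AE_plus)

lemma compact_indicator_exists:
  assumes "open W" "x \<in> W"
  shows "\<exists>V K. open V \<and> compact K \<and> x \<in> V \<and> V \<subseteq> K \<and> K \<subseteq> W \<and> (indicator K :: 'g \<Rightarrow> complex) \<in> Lp"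
proof -
  obtain V K where VK: "open V" "compact K" "x \<in> V" "V \<subseteq> K" "K \<subseteq> W"
    by (rule compact_nbhd_base[OF lc assms])
  have "(indicator K :: 'g \<Rightarrow> complex) \<in> Lp"
    by (rule Lp_indicator_compact[OF VK(2)]) (auto intro: borel_compact VK)
  then show ?thesis using VK by blast
qed

text \<open>Test on the indicator of a small compact neighbourhood K of 0: if b and b' differed, the
  translates b + K and b' + K could be made disjoint.\<close>

lemma ltrans_unique:
  assumes c: "c \<noteq> 0" and eq: "\<And>h. h \<in> Lp \<Longrightarrow> AE x in M. c * ltrans b h x = c' * ltrans b' h x"
  shows "b = b'" "c = c'"
proof -
  show b: "b = b'"
  proof (rule ccontr)
    assume "b \<noteq> b'"
    then obtain U U' where U: "open U" "open U'" "b \<in> U" "b' \<in> U'" "U \<inter> U' = {}" using hausdorff by metis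
    define W where "W = (\<lambda>v. b + v) -` U \<inter> (\<lambda>v. b' + v) -` U'"
    have W: "open W" "0 \<in> W" unfolding W_def
      using U by (auto intro!: open_Int open_vimage continuous_intros)
    obtain V K where VK: "open V" "compact K" "0 \<in> V" "V \<subseteq> K" "K \<subseteq> W" "(indicator K :: 'g \<Rightarrow> complex) \<in> Lp"
      using compact_indicator_exists[OF W] by blast
    have oV: "open ((\<lambda>x. - b + x) -` V)" by (intro open_vimage VK) (auto intro!: continuous_intros)
    have "AE x in M. x \<notin> (\<lambda>x. - b + x) -` V"
      using eq[OF VK(6)]
    proof eventually_elim
      case (elim x)
      show ?case
      proof
        assume x: "x \<in> (\<lambda>x. - b + x) -` V"
        then have xK: "- b + x \<in> K" using VK by auto
        then have "b + (- b + x) \<in> U" using VK by (auto simp: W_def)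
        then have xU: "x \<in> U" by (simp add: add.assoc[symmetric])
        have "- b' + x \<notin> K"
        proof
          assume "- b' + x \<in> K"
          then have "b' + (- b' + x) \<in> U'" using VK by (auto simp: W_def)
          then show False using xU U by (auto simp: add.assoc[symmetric])
        qed
        then show False using elim xK c by (simp add: ltrans_def)
      qed
    qed
    from open_AE_notin[OF oV this] show False using VK(3) by (metis add.left_inverse empty_iff vimageI)
  qed
  obtain V K where VK: "open V" "compact K" "0 \<in> V" "V \<subseteq> K" "(indicator K :: 'g \<Rightarrow> complex) \<in> Lp"
    using compact_indicator_exists[of UNIV 0] by auto
  have oV: "open ((\<lambda>x. - b + x) -` V)" by (intro open_vimage VK) (auto intro!: continuous_intros)
  show "c = c'"
  proof (rule ccontr)
    assume n: "c \<noteq> c'"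
    have "AE x in M. x \<notin> (\<lambda>x. - b + x) -` V"
      using eq[OF VK(5)] by eventually_elim (use n b VK(4) in \<open>auto simp: ltrans_def indicator_def split: if_splits\<close>)
    from open_AE_notin[OF oV this] show False using VK(3) by (metis add.left_inverse empty_iff vimageI)
  qed
qed

lemma pn_indicator_pos:
  assumes "open V" "V \<noteq> {}" "V \<subseteq> K" "(indicator K :: 'g \<Rightarrow> complex) \<in> Lp" shows "0 < pn (indicator K)"
proof -
  have "pn (indicator K) \<noteq> 0"
  proof
    assume "pn (indicator K) = 0"
    then have "AE x in M. indicator K x = (0::complex)" using pn_eq_0_iff[OF assms(4)] by simp
    then have "AE x in M. x \<notin> V" by eventually_elim (use assms in \<open>auto simp: indicator_def split: if_splits\<close>)
    then show False using open_AE_notin assms by blast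
  qed
  then show ?thesis using pn_nonneg[of "indicator K"] by simp
qed

text \<open>Lower counterpart of \<open>Lp_ltrans\<close>. From \<omega> b \<le> \<omega> (b + y) *
  \<omega> (- y) the weight on b + K is at least \<omega> b divided by its bound on - K, so the norm
  of a translated indicator detects the weight up to a constant.\<close>

lemma pn_ltrans_indicator_ge: "\<exists>h\<in>Lp. \<exists>\<beta>>0. \<forall>b. \<omega> b powr p * \<beta> \<le> pn (ltrans b h)"
proof -
  obtain V K where VK: "open V" "compact K" "0 \<in> V" "V \<subseteq> K" "(indicator K :: 'g \<Rightarrow> complex) \<in> Lp"
    using compact_indicator_exists[of UNIV 0] by auto
  have Ks: "K \<in> sets M" by (rule compact_sets[OF VK(2)])
  have "emeasure M V \<le> emeasure M K" using VK Ks by (intro emeasure_mono) auto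
  then have "0 < emeasure M K" using open_pos[of V] VK by (auto intro: less_le_trans)
  then have mK: "0 < measure M K" using finite_compact[OF VK(2)] by (simp add: measure_def enn2real_positive_iff)
  obtain \<beta> where \<beta>: "0 < \<beta>" "\<And>x. x \<in> uminus ` K \<Longrightarrow> \<omega> x \<le> \<beta>" using w_bounds[OF compact_uminus[OF VK(2)]] by metis
  have "\<omega> b powr p * (measure M K / \<beta> powr p) \<le> pn (ltrans b (indicator K))" for b
  proof -
    let ?u = "\<lambda>x. norm (ltrans b (indicator K :: 'g \<Rightarrow> complex) x) powr p * \<omega> x powr p"
    have Lb: "ltrans b (indicator K :: 'g \<Rightarrow> complex) \<in> Lp" by (rule Lp_ltrans(1)[OF VK(5)])
    have um: "?u \<in> borel_measurable borel" using Lp_meas[OF Lb] by measurable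
    have iu: "integrable M (\<lambda>y. ?u (b + y))" by (rule integrable_plus[OF Lp_int[OF Lb]])
    have "pn (ltrans b (indicator K)) = (\<integral>y. ?u (b + y) \<partial>M)"
      unfolding pnorm_def using integral_plus[OF um, of b] by simp
    also have "\<dots> \<ge> (\<integral>y. (\<omega> b / \<beta>) powr p * indicator K y \<partial>M)"
    proof (rule integral_mono[OF _ iu])
      show "integrable M (\<lambda>y. (\<omega> b / \<beta>) powr p * indicator K y)"
        using finite_compact[OF VK(2)] Ks by (intro integrable_mult_right) (simp add: less_top)
      fix y
      show "(\<omega> b / \<beta>) powr p * indicator K y \<le> ?u (b + y)"
      proof (cases "y \<in> K")
        case True
        have "\<omega> b = \<omega> ((b + y) + - y)" by (simp add: add.assoc)
        also have "\<dots> \<le> \<omega> (b + y) * \<omega> (- y)" by (rule w_mult)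
        also have "\<dots> \<le> \<omega> (b + y) * \<beta>" using True \<beta>(2) w_pos[of "b + y"] by (intro mult_left_mono) auto
        finally have "\<omega> b / \<beta> \<le> \<omega> (b + y)" using \<beta> by (simp add: divide_le_eq)
        then have "(\<omega> b / \<beta>) powr p \<le> \<omega> (b + y) powr p"
          using p \<beta> w_pos[of b] by (intro powr_mono2) auto
        then show ?thesis using True by (simp add: ltrans_def add.assoc[symmetric])
      qed simp
    qed
    also have "(\<integral>y. (\<omega> b / \<beta>) powr p * indicator K y \<partial>M) = \<omega> b powr p * (measure M K / \<beta> powr p)"
      using Ks w_pos[of b] \<beta> by (simp add: powr_divide)
    finally show ?thesis by simp
  qed
  moreover have "0 < measure M K / \<beta> powr p" using mK \<beta> by simp
  ultimately show ?thesis using VK(5) by blast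
qed

end

text \<open>The hypotheses on T, with bounds for \<open>pn\<close>, in a form symmetric under
  passing to \<open>Tinv\<close>. Everything proved here thus holds in both directions.\<close>

locale weighted_iso = G: weighted_group M1 \<omega>1 p + H: weighted_group M2 \<omega>2 p
  for M1 :: "'g::{topological_group_add,t2_space} measure" and \<omega>1
    and M2 :: "'h::{topological_group_add,t2_space} measure" and \<omega>2 and p +
  fixes T :: "('g \<Rightarrow> complex) \<Rightarrow> ('h \<Rightarrow> complex)"
  assumes T_Lp: "f \<in> G.Lp \<Longrightarrow> T f \<in> H.Lp"
    and T_cong: "f \<in> G.Lp \<Longrightarrow> g \<in> G.Lp \<Longrightarrow> AE x in M1. f x = g x \<Longrightarrow> AE y in M2. T f y = T g y"
    and T_add: "f \<in> G.Lp \<Longrightarrow> g \<in> G.Lp \<Longrightarrow> AE y in M2. T (\<lambda>x. f x + g x) y = T f y + T g y"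
    and T_cmult: "f \<in> G.Lp \<Longrightarrow> AE y in M2. T (\<lambda>x. a * f x) y = a * T f y"
    and T_inj: "f \<in> G.Lp \<Longrightarrow> g \<in> G.Lp \<Longrightarrow> AE y in M2. T f y = T g y \<Longrightarrow> AE x in M1. f x = g x"
    and T_surj: "h \<in> H.Lp \<Longrightarrow> \<exists>f\<in>G.Lp. AE y in M2. T f y = h y"
    and T_conv: "f \<in> G.Lp \<Longrightarrow> g \<in> G.Lp \<Longrightarrow> AE y in M2. T (conv M1 f g) y = conv M2 (T f) (T g) y"
    and T_bd: "\<exists>C>0. \<forall>f\<in>G.Lp. H.pn (T f) \<le> C * G.pn f"
    and T_bd': "\<exists>C>0. \<forall>f\<in>G.Lp. G.pn f \<le> C * H.pn (T f)"
    and T_sep: "f \<in> G.Lp \<Longrightarrow> g \<in> G.Lp \<Longrightarrow> AE x in M1. f x * g x = 0 \<Longrightarrow> AE y in M2. T f y * T g y = 0"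
    and T_sep': "f \<in> G.Lp \<Longrightarrow> g \<in> G.Lp \<Longrightarrow> AE y in M2. T f y * T g y = 0 \<Longrightarrow> AE x in M1. f x * g x = 0"
begin

text \<open>T is invertible only modulo null sets, so an inverse on functions is a choice of
  representatives.\<close>

definition Tinv :: "('h \<Rightarrow> complex) \<Rightarrow> 'g \<Rightarrow> complex" where
  "Tinv h = (SOME f. f \<in> G.Lp \<and> (AE y in M2. T f y = h y))"

lemma Tinv:
  assumes "h \<in> H.Lp" shows "Tinv h \<in> G.Lp" "AE y in M2. T (Tinv h) y = h y"
  using someI_ex[of "\<lambda>f. f \<in> G.Lp \<and> (AE y in M2. T f y = h y)"] T_surj[OF assms] unfolding Tinv_def by blast+

lemma Tinv_T: "f \<in> G.Lp \<Longrightarrow> AE x in M1. Tinv (T f) x = f x"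
  using Tinv[OF T_Lp] by (intro T_inj) auto

lemma T_0: "AE y in M2. T (\<lambda>x. 0) y = 0"
  using T_cmult[OF G.Lp_0(1), of 0] by simp

lemma T_diff:
  assumes f: "f \<in> G.Lp" and g: "g \<in> G.Lp" shows "AE y in M2. T (\<lambda>x. f x - g x) y = T f y - T g y"
proof -
  have "(\<lambda>x. f x - g x) = (\<lambda>x. f x + (-1) * g x)" by auto
  moreover have "AE y in M2. T (\<lambda>x. f x + (-1) * g x) y = T f y - T g y"
    using T_add[OF f G.Lp_cmult(1)[OF g, of "-1"]] T_cmult[OF g, of "-1"] by eventually_elim simp
  ultimately show ?thesis by simp
qed

lemma T_sum:
  assumes "finite X" "\<And>x. x \<in> X \<Longrightarrow> f x \<in> G.Lp"
  shows "AE y in M2. T (\<lambda>z. \<Sum>x\<in>X. c x * f x z) y = (\<Sum>x\<in>X. c x * T (f x) y)"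
  using assms
proof (induction X rule: finite_induct)
  case empty
  then show ?case using T_0 by simp
next
  case (insert x X)
  have L: "(\<lambda>z. \<Sum>x\<in>X. c x * f x z) \<in> G.Lp" using insert by (intro G.Lp_sum G.Lp_cmult(1)) auto
  have fx: "f x \<in> G.Lp" using insert by auto
  have IH: "AE y in M2. T (\<lambda>z. \<Sum>x\<in>X. c x * f x z) y = (\<Sum>x\<in>X. c x * T (f x) y)" using insert by auto
  have "AE y in M2. T (\<lambda>z. c x * f x z + (\<Sum>x\<in>X. c x * f x z)) y = c x * T (f x) y + (\<Sum>x\<in>X. c x * T (f x) y)"
    using T_add[OF G.Lp_cmult(1)[OF fx, of "c x"] L] T_cmult[OF fx, of "c x"] IH by eventually_elim simp
  then show ?case unfolding sum.insert[OF insert.hyps] .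
qed

text \<open>Identities for \<open>Tinv\<close> are checked after applying T, using
  \<open>T_inj\<close>. For convolution this needs that replacing either factor by an equivalent
  function changes nothing, which is \<open>conv_cong_left\<close> together with
  \<open>conv_cong_right\<close>.\<close>

lemma weighted_iso_Tinv: "weighted_iso M2 \<omega>2 M1 \<omega>1 p Tinv"
proof unfold_locales
  fix h g :: "'h \<Rightarrow> complex" and a
  assume h: "h \<in> H.Lp"
  note h1 = Tinv(1)[OF h] and h2 = Tinv(2)[OF h]
  show "Tinv h \<in> G.Lp" by (rule h1)
  show "AE y in M1. Tinv (\<lambda>x. a * h x) y = a * Tinv h y"
  proof (rule T_inj[OF Tinv(1)[OF H.Lp_cmult(1)[OF h]] G.Lp_cmult(1)[OF h1]])
    show "AE y in M2. T (Tinv (\<lambda>x. a * h x)) y = T (\<lambda>x. a * Tinv h x) y"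
      using Tinv(2)[OF H.Lp_cmult(1)[OF h, of a]] T_cmult[OF h1, of a] h2 by eventually_elim simp
  qed
  assume g: "g \<in> H.Lp"
  note g1 = Tinv(1)[OF g] and g2 = Tinv(2)[OF g]
  show "AE y in M1. Tinv h y = Tinv g y" if "AE x in M2. h x = g x"
  proof (rule T_inj[OF h1 g1])
    show "AE y in M2. T (Tinv h) y = T (Tinv g) y" using that h2 g2 by eventually_elim simp
  qed
  show "AE y in M1. Tinv (\<lambda>x. h x + g x) y = Tinv h y + Tinv g y"
  proof (rule T_inj[OF Tinv(1)[OF H.Lp_add(1)[OF h g]] G.Lp_add(1)[OF h1 g1]])
    show "AE y in M2. T (Tinv (\<lambda>x. h x + g x)) y = T (\<lambda>x. Tinv h x + Tinv g x) y"
      using Tinv(2)[OF H.Lp_add(1)[OF h g]] T_add[OF h1 g1] h2 g2 by eventually_elim simp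
  qed
  show "AE x in M2. h x = g x" if "AE y in M1. Tinv h y = Tinv g y"
    using T_cong[OF h1 g1 that] h2 g2 by eventually_elim simp
  show "AE y in M1. Tinv (conv M2 h g) y = conv M1 (Tinv h) (Tinv g) y"
  proof (rule T_inj[OF Tinv(1)[OF H.conv_Lp[OF h g]] G.conv_Lp[OF h1 g1]])
    have "conv M2 (T (Tinv h)) (T (Tinv g)) = conv M2 h (T (Tinv g))"
      by (rule H.conv_cong_left) (auto intro!: H.Lp_meas T_Lp h1 g1 h h2)
    also have "\<dots> = conv M2 h g"
      by (rule H.conv_cong_right) (auto intro!: H.Lp_meas T_Lp h1 g1 h g g2)
    finally show "AE y in M2. T (Tinv (conv M2 h g)) y = T (conv M1 (Tinv h) (Tinv g)) y"
      using Tinv(2)[OF H.conv_Lp[OF h g]] T_conv[OF h1 g1] by auto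
  qed
  show "AE y in M1. Tinv h y * Tinv g y = 0" if "AE x in M2. h x * g x = 0"
  proof (rule T_sep'[OF h1 g1])
    show "AE y in M2. T (Tinv h) y * T (Tinv g) y = 0" using that h2 g2 by eventually_elim simp
  qed
  show "AE x in M2. h x * g x = 0" if "AE y in M1. Tinv h y * Tinv g y = 0"
    using T_sep[OF h1 g1 that] h2 g2 by eventually_elim simp
next
  show "\<exists>h\<in>H.Lp. AE y in M1. Tinv h y = f y" if "f \<in> G.Lp" for f
    using Tinv_T[OF that] T_Lp[OF that] by blast
  have eq: "H.pn (T (Tinv h)) = H.pn h" if "h \<in> H.Lp" for h
    by (rule H.pn_cong_AE) (auto intro!: H.Lp_meas T_Lp Tinv that)
  show "\<exists>C>0. \<forall>f\<in>H.Lp. G.pn (Tinv f) \<le> C * H.pn f"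
    using T_bd' Tinv(1) eq by metis
  show "\<exists>C>0. \<forall>f\<in>H.Lp. H.pn f \<le> C * G.pn (Tinv f)"
    using T_bd Tinv(1) eq by metis
qed

text \<open>$T L_a T^{-1}$ commutes with right convolutions, so it is a multiple of a translation.\<close>

lemma intertwine: "\<exists>b c. c \<noteq> 0 \<and> (\<forall>f\<in>G.Lp. AE y in M2. T (ltrans a f) y = c * ltrans b (T f) y)"
proof -
  obtain C1 where C1: "0 < C1" "\<forall>f\<in>G.Lp. H.pn (T f) \<le> C1 * G.pn f" using T_bd by blast
  interpret J: weighted_iso M2 \<omega>2 M1 \<omega>1 p Tinv by (rule weighted_iso_Tinv)
  obtain C2 where C2: "0 < C2" "\<forall>f\<in>H.Lp. G.pn (Tinv f) \<le> C2 * H.pn f" using J.T_bd by blast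
  define S where "S h = T (ltrans a (Tinv h))" for h
  have L: "ltrans a (Tinv h) \<in> G.Lp" if "h \<in> H.Lp" for h by (rule G.Lp_ltrans(1)[OF Tinv(1)[OF that]])
  have untrans: "AE x in M1. u x = 0" if "AE x in M1. ltrans a u x = 0" for u :: "'g \<Rightarrow> complex"
    using G.AE_plus[OF that, of a] by eventually_elim (simp add: ltrans_def add.assoc[symmetric])
  interpret S: separating_multiplier M2 \<omega>2 p S "C1 * (\<omega>1 a powr p * C2)"
  proof unfold_locales
    fix h g :: "'h \<Rightarrow> complex" and b
    assume h: "h \<in> H.Lp"
    show "S h \<in> H.Lp" unfolding S_def by (rule T_Lp[OF L[OF h]])
    have "AE x in M1. ltrans a (Tinv (\<lambda>x. b * h x)) x = b * ltrans a (Tinv h) x"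
      using G.ltrans_cong_AE[OF J.T_cmult[OF h, of b], of a] by (simp add: ltrans_def)
    from T_cong[OF L[OF H.Lp_cmult(1)[OF h]] G.Lp_cmult(1)[OF L[OF h]] this]
    show "AE x in M2. S (\<lambda>x. b * h x) x = b * S h x"
      using T_cmult[OF L[OF h], of b] unfolding S_def by eventually_elim simp
    show "AE x in M2. h x = 0" if s: "AE x in M2. S h x = 0"
    proof -
      have "AE y in M2. T (ltrans a (Tinv h)) y = T (\<lambda>x. 0) y" using s T_0 unfolding S_def by eventually_elim simp
      then have "AE x in M1. ltrans a (Tinv h) x = 0" using T_inj[OF L[OF h] G.Lp_0(1)] by simp
      then have "AE x in M1. Tinv h x = 0" by (rule untrans)
      from T_cong[OF Tinv(1)[OF h] G.Lp_0(1) this] show ?thesis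
        using T_0 Tinv(2)[OF h] by eventually_elim simp
    qed
    show "H.pn (S h) \<le> C1 * (\<omega>1 a powr p * C2) * H.pn h"
    proof -
      have "H.pn (S h) \<le> C1 * G.pn (ltrans a (Tinv h))" unfolding S_def using C1 L[OF h] by blast
      also have "\<dots> \<le> C1 * (\<omega>1 a powr p * G.pn (Tinv h))"
        using C1 by (intro mult_left_mono G.Lp_ltrans(2) Tinv(1) h) auto
      also have "\<dots> \<le> C1 * (\<omega>1 a powr p * (C2 * H.pn h))"
        using C1 C2 h by (intro mult_left_mono) auto
      finally show ?thesis by (simp add: mult.assoc)
    qed
    assume g: "g \<in> H.Lp"
    have "AE x in M1. ltrans a (Tinv (\<lambda>x. h x + g x)) x = ltrans a (Tinv h) x + ltrans a (Tinv g) x"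
      using G.ltrans_cong_AE[OF J.T_add[OF h g], of a] by (simp add: ltrans_def)
    from T_cong[OF L[OF H.Lp_add(1)[OF h g]] G.Lp_add(1)[OF L[OF h] L[OF g]] this]
    show "AE x in M2. S (\<lambda>x. h x + g x) x = S h x + S g x"
      using T_add[OF L[OF h] L[OF g]] unfolding S_def by eventually_elim simp
    show "AE x in M2. S h x * S g x = 0" if "AE x in M2. h x * g x = 0"
      unfolding S_def
    proof (rule T_sep[OF L[OF h] L[OF g]])
      show "AE x in M1. ltrans a (Tinv h) x * ltrans a (Tinv g) x = 0"
        using G.AE_plus[OF J.T_sep[OF h g that], of "- a"] by (simp add: ltrans_def)
    qed
    show "AE x in M2. h x * g x = 0" if s: "AE x in M2. S h x * S g x = 0"
    proof (rule J.T_sep'[OF h g], rule untrans)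
      show "AE x in M1. ltrans a (\<lambda>x. Tinv h x * Tinv g x) x = 0"
        using T_sep'[OF L[OF h] L[OF g] s[unfolded S_def]] by (simp add: ltrans_def)
    qed
    \<comment> \<open>Left translation acts on the left factor of a convolution only, so S (h * g) =
      T ((L_a T^{-1} h) * T^{-1} g) = S h * g.\<close>
    have e1: "AE x in M1. ltrans a (Tinv (conv M2 h g)) x = conv M1 (ltrans a (Tinv h)) (Tinv g) x"
      using G.ltrans_cong_AE[OF J.T_conv[OF h g], of a]
        G.conv_ltrans[OF G.Lp_meas[OF Tinv(1)[OF h]] G.Lp_meas[OF Tinv(1)[OF g]], of a] by simp
    have e2: "conv M2 (S h) (T (Tinv g)) = conv M2 (S h) g"
      unfolding S_def by (rule H.conv_cong_right) (auto intro!: T_Lp L h g H.Lp_meas Tinv)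
    show "AE x in M2. S (conv M2 h g) x = conv M2 (S h) g x"
      using T_cong[OF L[OF H.conv_Lp[OF h g]] G.conv_Lp[OF L[OF h] Tinv(1)[OF g]] e1] T_conv[OF L[OF h] Tinv(1)[OF g]]
      unfolding S_def[symmetric] e2 by eventually_elim (simp add: S_def)
  next
    fix h assume h: "h \<in> H.Lp"
    define u where "u = ltrans (- a) (Tinv h)"
    have u: "u \<in> G.Lp" unfolding u_def by (rule G.Lp_ltrans(1)[OF Tinv(1)[OF h]])
    have "AE x in M1. ltrans a (Tinv (T u)) x = Tinv h x"
      using G.ltrans_cong_AE[OF Tinv_T[OF u], of a] by (simp add: u_def ltrans_ltrans)
    from T_cong[OF L[OF T_Lp[OF u]] Tinv(1)[OF h] this]
    have "AE y in M2. S (T u) y = h y" using Tinv(2)[OF h] unfolding S_def by eventually_elim simp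
    then show "\<exists>f\<in>H.Lp. AE x in M2. S f x = h x" using T_Lp[OF u] by blast
  qed
  obtain b c where bc: "c \<noteq> 0" "\<forall>h\<in>H.Lp. AE x in M2. S h x = c * ltrans b h x" using S.multiplier_form by blast
  have "AE y in M2. T (ltrans a f) y = c * ltrans b (T f) y" if f: "f \<in> G.Lp" for f
  proof -
    have "AE y in M2. S (T f) y = T (ltrans a f) y" unfolding S_def
      by (rule T_cong[OF L[OF T_Lp[OF f]] G.Lp_ltrans(1)[OF f] G.ltrans_cong_AE[OF Tinv_T[OF f]]])
    moreover have "AE y in M2. S (T f) y = c * ltrans b (T f) y" using bc T_Lp[OF f] by blast
    ultimately show ?thesis by eventually_elim simp
  qed
  then show ?thesis using bc by blast
qed

end

section \<open>The homomorphism and the character attached to an isomorphism\<close>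

locale intertwined = weighted_iso M1 \<omega>1 M2 \<omega>2 p T
  for M1 :: "'g::{topological_group_add,t2_space} measure" and \<omega>1
    and M2 :: "'h::{topological_group_add,t2_space} measure" and \<omega>2 and p T +
  fixes \<gamma> :: "'g \<Rightarrow> complex" and \<phi> :: "'g \<Rightarrow> 'h"
  assumes \<gamma>_nz: "\<gamma> a \<noteq> 0"
    and tw: "f \<in> G.Lp \<Longrightarrow> AE y in M2. T (ltrans a f) y = \<gamma> a * ltrans (\<phi> a) (T f) y"

lemma (in weighted_iso) intertwined_exists: "\<exists>\<gamma> \<phi>. intertwined M1 \<omega>1 M2 \<omega>2 p T \<gamma> \<phi>"
proof -
  obtain \<phi> \<gamma> where "\<And>a. \<gamma> a \<noteq> 0 \<and> (\<forall>f\<in>G.Lp. AE y in M2. T (ltrans a f) y = \<gamma> a * ltrans (\<phi> a) (T f) y)"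
    using intertwine by metis
  then have "intertwined M1 \<omega>1 M2 \<omega>2 p T \<gamma> \<phi>" by unfold_locales auto
  then show ?thesis by blast
qed

context intertwined
begin

lemma tw_Tinv:
  assumes h: "h \<in> H.Lp" shows "AE y in M2. T (ltrans a (Tinv h)) y = \<gamma> a * ltrans (\<phi> a) h y"
  using tw[OF Tinv(1)[OF h], of a] H.ltrans_cong_AE[OF Tinv(2)[OF h], of "\<phi> a"] by eventually_elim simp

text \<open>T L_{a+b} = T L_a L_b produces two weighted translations representing the same operator,
  and such a representation is unique.\<close>

lemma hom: "\<phi> (a + b) = \<phi> a + \<phi> b" and char: "\<gamma> (a + b) = \<gamma> a * \<gamma> b"
proof -
  have "AE y in M2. \<gamma> (a + b) * ltrans (\<phi> (a + b)) h y = (\<gamma> a * \<gamma> b) * ltrans (\<phi> a + \<phi> b) h y" if h: "h \<in> H.Lp" for h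
  proof -
    let ?f = "Tinv h"
    have bL: "ltrans b ?f \<in> G.Lp" by (rule G.Lp_ltrans(1)[OF Tinv(1)[OF h]])
    have "AE y in M2. ltrans (\<phi> a) (T (ltrans b ?f)) y = ltrans (\<phi> a) (\<lambda>y. \<gamma> b * ltrans (\<phi> b) h y) y"
      by (rule H.ltrans_cong_AE[OF tw_Tinv[OF h]])
    moreover have "ltrans (\<phi> a) (\<lambda>y. \<gamma> b * ltrans (\<phi> b) h y) y = \<gamma> b * ltrans (\<phi> a + \<phi> b) h y" for y
      unfolding ltrans_ltrans[symmetric] by (simp add: ltrans_def)
    ultimately have "AE y in M2. ltrans (\<phi> a) (T (ltrans b ?f)) y = \<gamma> b * ltrans (\<phi> a + \<phi> b) h y" by simp
    with tw[OF bL, of a] have "AE y in M2. T (ltrans a (ltrans b ?f)) y = \<gamma> a * (\<gamma> b * ltrans (\<phi> a + \<phi> b) h y)"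
      by eventually_elim simp
    with tw_Tinv[OF h, of "a + b"] show ?thesis unfolding ltrans_ltrans by eventually_elim (simp add: mult.assoc)
  qed
  from H.ltrans_unique[OF \<gamma>_nz this] show "\<phi> (a + b) = \<phi> a + \<phi> b" "\<gamma> (a + b) = \<gamma> a * \<gamma> b" by auto
qed

lemma hom_0: "\<phi> 0 = 0" and char_0: "\<gamma> 0 = 1"
proof -
  have "\<phi> 0 + \<phi> 0 = \<phi> 0 + 0" using hom[of 0 0] by simp
  then show "\<phi> 0 = 0" by (simp only: add_left_cancel)
  show "\<gamma> 0 = 1" using char[of 0 0] \<gamma>_nz[of 0] by simp
qed

text \<open>Continuity of translation on the first group, carried over by the bounded operator T. It
  controls \<gamma> and \<phi> only jointly; the following lemmas separate them.\<close>

lemma T_ltrans_small: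
  assumes h: "h \<in> H.Lp" and e: "0 < e"
  shows "\<exists>V. open V \<and> 0 \<in> V \<and> (\<forall>a\<in>V. H.pn (\<lambda>y. \<gamma> a * ltrans (\<phi> a) h y - h y) < e)"
proof -
  obtain C where C: "0 < C" "\<forall>f\<in>G.Lp. H.pn (T f) \<le> C * G.pn f" using T_bd by blast
  let ?f = "Tinv h"
  have f: "?f \<in> G.Lp" by (rule Tinv(1)[OF h])
  have "0 < e / C" using e C by simp
  from G.ltrans_continuous[OF f this]
  obtain V where V: "open V" "0 \<in> V" "\<forall>a\<in>V. G.pn (\<lambda>z. ltrans a ?f z - ?f z) < e / C" by blast
  have "H.pn (\<lambda>y. \<gamma> a * ltrans (\<phi> a) h y - h y) < e" if a: "a \<in> V" for a
  proof -
    have af: "ltrans a ?f \<in> G.Lp" by (rule G.Lp_ltrans(1)[OF f])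
    have D: "(\<lambda>z. ltrans a ?f z - ?f z) \<in> G.Lp" by (rule G.Lp_diff(1)[OF af f])
    have "AE y in M2. \<gamma> a * ltrans (\<phi> a) h y - h y = T (\<lambda>z. ltrans a ?f z - ?f z) y"
      using T_diff[OF af f] tw_Tinv[OF h, of a] Tinv(2)[OF h] by eventually_elim simp
    then have "H.pn (\<lambda>y. \<gamma> a * ltrans (\<phi> a) h y - h y) = H.pn (T (\<lambda>z. ltrans a ?f z - ?f z))"
      by (intro H.pn_cong_AE H.Lp_meas H.Lp_diff(1) H.Lp_cmult(1) H.Lp_ltrans(1) h T_Lp D)
    also have "\<dots> \<le> C * G.pn (\<lambda>z. ltrans a ?f z - ?f z)" using C D by blast
    also have "\<dots> < C * (e / C)" using V a C by (intro mult_strict_left_mono) auto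
    finally show ?thesis using C by simp
  qed
  then show ?thesis using V by blast
qed

text \<open>If \<phi> a were outside W, the translated indicator would be disjoint from the original
  one, and the difference would have at least the norm of the latter whatever the value of \<gamma>
  a.\<close>

lemma \<phi>_nbhd:
  assumes W: "open W" "0 \<in> W" shows "\<exists>V. open V \<and> 0 \<in> V \<and> (\<forall>a\<in>V. \<phi> a \<in> W)"
proof -
  obtain V0 where V0: "open V0" "0 \<in> V0" "\<And>u v. u \<in> V0 \<Longrightarrow> v \<in> V0 \<Longrightarrow> u - v \<in> W" using diff_nbhd[OF W] by metis
  obtain V1 K where K: "open V1" "compact K" "0 \<in> V1" "V1 \<subseteq> K" "K \<subseteq> V0" "(indicator K :: 'h \<Rightarrow> complex) \<in> H.Lp"
    using H.compact_indicator_exists[OF V0(1,2)] by blast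
  let ?h = "indicator K :: 'h \<Rightarrow> complex"
  have pos: "0 < H.pn ?h" using H.pn_indicator_pos[OF K(1) _ K(4,6)] K(3) by blast
  obtain V where V: "open V" "0 \<in> V" "\<forall>a\<in>V. H.pn (\<lambda>y. \<gamma> a * ltrans (\<phi> a) ?h y - ?h y) < H.pn ?h"
    using T_ltrans_small[OF K(6) pos] by blast
  have "\<phi> a \<in> W" if a: "a \<in> V" for a
  proof (rule ccontr)
    assume n: "\<phi> a \<notin> W"
    have dj: "- \<phi> a + y \<notin> K" if "y \<in> K" for y
    proof
      assume "- \<phi> a + y \<in> K"
      then have "y - (- \<phi> a + y) \<in> W" using V0(3) K(5) that by blast
      moreover have "y - (- \<phi> a + y) = \<phi> a" by (metis add_diff_cancel_left' diff_add_eq_diff_diff_swap diff_self add.inverse_inverse diff_0 uminus_add_conv_diff)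
      ultimately show False using n by simp
    qed
    have D: "(\<lambda>y. \<gamma> a * ltrans (\<phi> a) ?h y - ?h y) \<in> H.Lp" by (intro H.Lp_diff(1) H.Lp_cmult(1) H.Lp_ltrans(1) K)
    have "norm (?h y) \<le> norm (\<gamma> a * ltrans (\<phi> a) ?h y - ?h y)" for y
      using dj[of y] by (cases "y \<in> K") (auto simp: ltrans_def)
    from H.Lp_mono(2)[OF D H.Lp_meas[OF K(6)] this] show False using V a by fastforce
  qed
  then show ?thesis using V by blast
qed

lemma \<phi>_cont: "continuous_on UNIV \<phi>"
proof -
  have "open (\<phi> -` W)" if W: "open W" for W
  proof (subst open_subopen, rule ballI)
    fix x assume x: "x \<in> \<phi> -` W"
    have "open ((\<lambda>w. \<phi> x + w) -` W)" by (intro open_vimage W) (auto intro!: continuous_intros)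
    moreover have "0 \<in> (\<lambda>w. \<phi> x + w) -` W" using x by simp
    ultimately obtain V where V: "open V" "0 \<in> V" "\<forall>a\<in>V. \<phi> a \<in> (\<lambda>w. \<phi> x + w) -` W" using \<phi>_nbhd by blast
    have "open ((\<lambda>z. - x + z) -` V)" by (intro open_vimage V) (auto intro!: continuous_intros)
    moreover have "x \<in> (\<lambda>z. - x + z) -` V" using V by simp
    moreover have "(\<lambda>z. - x + z) -` V \<subseteq> \<phi> -` W"
    proof
      fix z assume "z \<in> (\<lambda>z. - x + z) -` V"
      then have "\<phi> x + \<phi> (- x + z) \<in> W" using V by auto
      then show "z \<in> \<phi> -` W" unfolding hom[symmetric] by (simp add: add.assoc[symmetric])
    qed
    ultimately show "\<exists>T. open T \<and> x \<in> T \<and> T \<subseteq> \<phi> -` W" by blast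
  qed
  then show ?thesis by (simp add: continuous_on_open_vimage)
qed

text \<open>Convolving with k and evaluating at 0 turns \<open>T_ltrans_small\<close> into
  convergence of \<gamma> a * F (- \<phi> a) to F 0. Since \<phi> is already known to be continuous,
  the second factor tends to F 0 too, and F 0 is nonzero.\<close>

lemma \<gamma>_tendsto: "(\<gamma> \<longlongrightarrow> 1) (at 0)"
proof -
  obtain k :: "'h \<Rightarrow> real" and L where k: "continuous_on UNIV k" "\<And>x. 0 \<le> k x" "\<And>x. k x \<le> 1"
    "k 0 = 1" "compact L" "\<And>y. y \<notin> L \<Longrightarrow> k y = 0"
    using H.bump_at[OF open_UNIV UNIV_I, of 0] by metis
  let ?k = "\<lambda>x. complex_of_real (k x)"
  have kC: "?k \<in> Cc" by (rule Cc_of_real[OF k(1,5,6)])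
  obtain V1 K where K: "open V1" "compact K" "0 \<in> V1" "V1 \<subseteq> K" "(indicator K :: 'h \<Rightarrow> complex) \<in> H.Lp"
    using H.compact_indicator_exists[of UNIV 0] by auto
  \<comment> \<open>Written as an embedded real function so that \<open>conv_pos\<close>
    applies.\<close>
  let ?h = "\<lambda>x. complex_of_real (indicator K x)"
  have hi: "?h = indicator K" by (auto simp: indicator_def)
  have hL: "?h \<in> H.Lp" unfolding hi by (rule K(5))
  define F where "F = conv M2 ?h ?k"
  have "0 \<in> H.esupp ?h"
    unfolding H.esupp_def
  proof (intro CollectI allI impI notI, elim conjE)
    fix W assume W: "open W" "(0::'h) \<in> W" and ae: "AE z in M2. z \<in> W \<longrightarrow> ?h z = 0"
    have "AE z in M2. z \<notin> W \<inter> V1" using ae by eventually_elim (use K(4) in \<open>auto simp: indicator_def split: if_splits\<close>)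
    then have "W \<inter> V1 = {}" by (intro H.open_AE_notin open_Int W K)
    then show False using W K(3) by blast
  qed
  from H.conv_pos[OF hL _ this k(1) kC k(2), of 0] have F0: "F 0 \<noteq> 0" using k(4) by (simp add: F_def)
  have Fc: "continuous_on UNIV F" unfolding F_def by (rule H.conv_Cc_continuous[OF hL kC])
  obtain C where C: "0 < C" "\<forall>f\<in>H.Lp. norm (conv M2 f ?k 0) \<le> C * H.pn f powr (1/p)" using H.conv_Cc_bound[OF kC] by blast
  have "((\<lambda>a. H.pn (\<lambda>y. \<gamma> a * ltrans (\<phi> a) ?h y - ?h y)) \<longlongrightarrow> 0) (at 0)"
  proof (rule tendstoI)
    fix e :: real assume "0 < e"
    from T_ltrans_small[OF hL this] show "\<forall>\<^sub>F a in at 0. dist (H.pn (\<lambda>y. \<gamma> a * ltrans (\<phi> a) ?h y - ?h y)) 0 < e"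
      unfolding eventually_at_topological using H.pn_nonneg by (simp add: dist_norm) blast
  qed
  then have lim0: "((\<lambda>a. C * H.pn (\<lambda>y. \<gamma> a * ltrans (\<phi> a) ?h y - ?h y) powr (1/p)) \<longlongrightarrow> 0) (at 0)"
    using H.p H.pn_nonneg by (intro tendsto_mult_right_zero tendsto_zero_powrI[OF _ tendsto_const]) auto
  have eq: "conv M2 (\<lambda>y. \<gamma> a * ltrans (\<phi> a) ?h y - ?h y) ?k 0 = \<gamma> a * F (- \<phi> a) - F 0" for a
  proof -
    have aL: "ltrans (\<phi> a) ?h \<in> H.Lp" by (rule H.Lp_ltrans(1)[OF hL])
    have "conv M2 (ltrans (\<phi> a) ?h) ?k 0 = F (- \<phi> a)"
      using H.conv_ltrans[OF H.Lp_meas[OF hL] Cc_measurable[OF kC], of "\<phi> a"] by (simp add: F_def ltrans_def)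
    then show ?thesis
      using H.conv_diff_left[OF H.Lp_cmult(1)[OF aL, of "\<gamma> a"] hL kC, of 0] by (simp add: H.conv_cmult_left F_def)
  qed
  have "((\<lambda>a. \<gamma> a * F (- \<phi> a) - F 0) \<longlongrightarrow> 0) (at 0)"
  proof (rule Lim_null_comparison[OF always_eventually lim0], rule allI)
    fix a
    have "(\<lambda>y. \<gamma> a * ltrans (\<phi> a) ?h y - ?h y) \<in> H.Lp" by (intro H.Lp_diff(1) H.Lp_cmult(1) H.Lp_ltrans(1) hL)
    then show "norm (\<gamma> a * F (- \<phi> a) - F 0) \<le> C * H.pn (\<lambda>y. \<gamma> a * ltrans (\<phi> a) ?h y - ?h y) powr (1/p)"
      using C(2) unfolding eq[symmetric] by blast
  qed
  from tendsto_add[OF this tendsto_const[of "F 0"]] have 1: "((\<lambda>a. \<gamma> a * F (- \<phi> a)) \<longlongrightarrow> F 0) (at 0)" by simp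
  have "continuous_on UNIV (\<lambda>a. F (- \<phi> a))"
    by (rule continuous_on_compose2[OF Fc]) (auto intro!: continuous_intros \<phi>_cont)
  then have "isCont (\<lambda>a. F (- \<phi> a)) 0" by (simp add: continuous_on_eq_continuous_at)
  then have 2: "((\<lambda>a. F (- \<phi> a)) \<longlongrightarrow> F 0) (at 0)" by (simp add: isCont_def hom_0)
  have "((\<lambda>a. \<gamma> a * F (- \<phi> a) / F (- \<phi> a)) \<longlongrightarrow> F 0 / F 0) (at 0)" by (rule tendsto_divide[OF 1 2 F0])
  moreover have "\<forall>\<^sub>F a in at 0. \<gamma> a * F (- \<phi> a) / F (- \<phi> a) = \<gamma> a"
    using tendsto_imp_eventually_ne[OF 2 F0] by eventually_elim simp
  ultimately show ?thesis using F0 by (simp add: tendsto_cong)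
qed

lemma \<gamma>_cont: "continuous_on UNIV \<gamma>"
proof -
  have c0: "isCont \<gamma> 0" using \<gamma>_tendsto by (simp add: isCont_def char_0)
  have "isCont \<gamma> x" for x
  proof -
    have "isCont (\<lambda>z. - x + z) x" by (intro continuous_intros)
    then have "isCont (\<lambda>z. \<gamma> (- x + z)) x" using c0 by (intro isCont_o2[of _ "\<lambda>z. - x + z" \<gamma>]) auto
    then have "isCont (\<lambda>z. \<gamma> x * \<gamma> (- x + z)) x" by (intro continuous_intros)
    then show ?thesis unfolding char[symmetric] by (simp add: add.assoc[symmetric])
  qed
  then show ?thesis by (simp add: continuous_at_imp_continuous_on)
qed

text \<open>Apply T L_x T^{-1} = \<gamma> x L_{\<phi> x} to the test function of
  \<open>pn_ltrans_indicator_ge\<close>: the norm is at least a constant times |\<gamma> x|^p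
  \<omega>2 (\<phi> x)^p and at most a constant times \<omega>1 x^p. The positive lower bound will
  come from the same lemma for \<open>Tinv\<close>.\<close>

lemma ratio_bounded: "\<exists>R>0. \<forall>x. norm (\<gamma> x) * \<omega>2 (\<phi> x) / \<omega>1 x \<le> R"
proof -
  obtain h \<beta> where h: "h \<in> H.Lp" "0 < \<beta>" "\<And>b. \<omega>2 b powr p * \<beta> \<le> H.pn (ltrans b h)"
    using H.pn_ltrans_indicator_ge by blast
  obtain C where C: "0 < C" "\<forall>f\<in>G.Lp. H.pn (T f) \<le> C * G.pn f" using T_bd by blast
  define q where "q = C * G.pn (Tinv h) / \<beta>"
  have q: "0 \<le> q" using C h G.pn_nonneg[of "Tinv h"] by (simp add: q_def)
  have "norm (\<gamma> x) * \<omega>2 (\<phi> x) / \<omega>1 x \<le> q powr (1/p)" for x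
  proof -
    have hL: "ltrans (\<phi> x) h \<in> H.Lp" by (rule H.Lp_ltrans(1)[OF h(1)])
    have fL: "ltrans x (Tinv h) \<in> G.Lp" by (rule G.Lp_ltrans(1)[OF Tinv(1)[OF h(1)]])
    have "(norm (\<gamma> x) * \<omega>2 (\<phi> x)) powr p * \<beta> = norm (\<gamma> x) powr p * (\<omega>2 (\<phi> x) powr p * \<beta>)"
      by (simp add: powr_mult)
    also have "\<dots> \<le> norm (\<gamma> x) powr p * H.pn (ltrans (\<phi> x) h)" by (intro mult_left_mono h) auto
    also have "\<dots> = H.pn (\<lambda>y. \<gamma> x * ltrans (\<phi> x) h y)" using H.Lp_cmult(2)[OF hL] by simp
    also have "\<dots> = H.pn (T (ltrans x (Tinv h)))"
      by (rule H.pn_cong_AE[symmetric]) (auto intro!: H.Lp_meas H.Lp_cmult(1) hL T_Lp fL tw_Tinv h)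
    also have "\<dots> \<le> C * G.pn (ltrans x (Tinv h))" using C fL by blast
    also have "\<dots> \<le> C * (\<omega>1 x powr p * G.pn (Tinv h))" using C by (intro mult_left_mono G.Lp_ltrans(2) Tinv h) auto
    finally have "(norm (\<gamma> x) * \<omega>2 (\<phi> x)) powr p \<le> q * \<omega>1 x powr p"
      using h(2) by (simp add: q_def field_simps)
    then have "(norm (\<gamma> x) * \<omega>2 (\<phi> x)) powr p / \<omega>1 x powr p \<le> q" using G.w_pos[of x] by (simp add: divide_le_eq)
    then have "(norm (\<gamma> x) * \<omega>2 (\<phi> x) / \<omega>1 x) powr p \<le> q"
      using G.w_pos[of x] H.w_pos[of "\<phi> x"] by (simp add: powr_divide)
    then have "((norm (\<gamma> x) * \<omega>2 (\<phi> x) / \<omega>1 x) powr p) powr (1/p) \<le> q powr (1/p)"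
      using G.p by (intro powr_mono2) auto
    then show ?thesis using G.p G.w_pos[of x] H.w_pos[of "\<phi> x"] by (simp add: powr_powr)
  qed
  then have "\<forall>x. norm (\<gamma> x) * \<omega>2 (\<phi> x) / \<omega>1 x \<le> q powr (1/p) + 1" by (simp add: add_increasing2)
  moreover have "0 < q powr (1/p) + 1" by (intro add_nonneg_pos) auto
  ultimately show ?thesis by blast
qed

text \<open>Conjugating a translation by T and then by its inverse returns it, so uniqueness of
  weighted translations makes \<psi> inverse to \<phi> and \<delta> reciprocal to \<gamma>.
  Bijectivity of \<phi> is obtained in no other way.\<close>

lemma inverse_intertwiner:
  assumes J: "intertwined M2 \<omega>2 M1 \<omega>1 p Tinv \<delta> \<psi>"
  shows "\<phi> (\<psi> y) = y" "\<psi> (\<phi> x) = x" "\<gamma> (\<psi> y) * \<delta> y = 1"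
proof -
  interpret J: intertwined M2 \<omega>2 M1 \<omega>1 p Tinv \<delta> \<psi> by (rule J)
  have "AE z in M2. 1 * ltrans y h z = (\<gamma> (\<psi> y) * \<delta> y) * ltrans (\<phi> (\<psi> y)) h z" if h: "h \<in> H.Lp" for h
  proof -
    have yL: "ltrans y h \<in> H.Lp" by (rule H.Lp_ltrans(1)[OF h])
    have L: "ltrans (\<psi> y) (Tinv h) \<in> G.Lp" by (rule G.Lp_ltrans(1)[OF Tinv(1)[OF h]])
    show ?thesis
      using Tinv(2)[OF yL] T_cong[OF Tinv(1)[OF yL] G.Lp_cmult(1)[OF L] J.tw[OF h, of y]]
        T_cmult[OF L, of "\<delta> y"] tw_Tinv[OF h, of "\<psi> y"] by eventually_elim (simp add: mult_ac)
  qed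
  from H.ltrans_unique[OF _ this] show "\<phi> (\<psi> y) = y" "\<gamma> (\<psi> y) * \<delta> y = 1" by auto
  have "AE z in M1. 1 * ltrans x f z = (\<gamma> x * \<delta> (\<phi> x)) * ltrans (\<psi> (\<phi> x)) f z" if f: "f \<in> G.Lp" for f
  proof -
    have xL: "ltrans x f \<in> G.Lp" by (rule G.Lp_ltrans(1)[OF f])
    have L: "ltrans (\<phi> x) (T f) \<in> H.Lp" by (rule H.Lp_ltrans(1)[OF T_Lp[OF f]])
    show ?thesis
      using Tinv_T[OF xL] J.T_cong[OF T_Lp[OF xL] H.Lp_cmult(1)[OF L] tw[OF f, of x]]
        J.T_cmult[OF L, of "\<gamma> x"] J.tw[OF T_Lp[OF f], of "\<phi> x"] G.ltrans_cong_AE[OF Tinv_T[OF f], of "\<psi> (\<phi> x)"]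
      by eventually_elim (simp add: mult_ac)
  qed
  from G.ltrans_unique[OF _ this] show "\<psi> (\<phi> x) = x" by auto
qed

end

section \<open>Transport of Haar measure along the isomorphism\<close>

locale intertwined_homeo = intertwined M1 \<omega>1 M2 \<omega>2 p T \<gamma> \<phi>
  for M1 :: "'g::{topological_group_add,t2_space} measure" and \<omega>1
    and M2 :: "'h::{topological_group_add,t2_space} measure" and \<omega>2 and p T \<gamma> \<phi> +
  fixes \<psi> :: "'h \<Rightarrow> 'g"
  assumes \<phi>\<psi>: "\<phi> (\<psi> y) = y" and \<psi>\<phi>: "\<psi> (\<phi> x) = x" and \<psi>_cont: "continuous_on UNIV \<psi>"
begin

lemma inv_\<phi>: "inv \<phi> = \<psi>"
  by (rule inv_equality) (auto simp: \<phi>\<psi> \<psi>\<phi>)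

lemma bij_\<phi>: "bij \<phi>"
  by (rule o_bij[of \<psi>]) (auto simp: \<phi>\<psi> \<psi>\<phi> fun_eq_iff)

lemma \<phi>_meas: "\<phi> \<in> borel_measurable M1"
  using borel_measurable_continuous_onI[OF \<phi>_cont] by simp

lemma vimage_eq: "\<phi> -` A = \<psi> ` A" and vimage_vimage: "\<phi> -` (\<psi> -` B) = B"
  using \<phi>\<psi> \<psi>\<phi> by (auto simp: image_iff) metis

lemma emeasure_image: "A \<in> sets borel \<Longrightarrow> emeasure (distr M1 borel \<phi>) A = emeasure M1 (\<phi> -` A)"
  by (simp add: emeasure_distr[OF \<phi>_meas])

lemma haar_image: "haar_measure (distr M1 borel \<phi>)"
  unfolding haar_measure_def
proof (intro conjI allI ballI impI)
  have om: "open (\<phi> -` U)" if "open U" for U by (rule open_vimage[OF that \<phi>_cont])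
  have om': "open (\<psi> -` U)" if "open U" for U by (rule open_vimage[OF that \<psi>_cont])
  have cm: "compact (\<phi> -` K)" if "compact K" for K
    unfolding vimage_eq by (rule compact_continuous_image[OF continuous_on_subset[OF \<psi>_cont] that]) auto
  have cm': "compact (\<psi> -` K)" if "compact K" for K
  proof -
    have "\<psi> -` K = \<phi> ` K" using \<phi>\<psi> \<psi>\<phi> by (auto simp: image_iff) metis
    then show ?thesis using compact_continuous_image[OF continuous_on_subset[OF \<phi>_cont] that] by simp
  qed
  have sm: "\<phi> -` A \<in> sets borel" if "A \<in> sets borel" for A
    using measurable_sets[OF \<phi>_meas that] by simp
  show "sets (distr M1 borel \<phi>) = sets borel" by simp
  show "emeasure (distr M1 borel \<phi>) ((+) x ` A) = emeasure (distr M1 borel \<phi>) A" if A: "A \<in> sets borel" for x A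
  proof -
    \<comment> \<open>Translation by x pulls back to translation by \<psi> x, which preserves
      M1.\<close>
    have e: "\<phi> -` ((+) x ` A) = (+) (\<psi> x) ` (\<phi> -` A)"
    proof (intro set_eqI iffI)
      fix z assume "z \<in> \<phi> -` ((+) x ` A)"
      then obtain b where b: "b \<in> A" "\<phi> z = x + b" by auto
      then have "\<phi> z = \<phi> (\<psi> x + \<psi> b)" by (simp add: hom \<phi>\<psi>)
      then have "z = \<psi> x + \<psi> b" using \<psi>\<phi> by metis
      then show "z \<in> (+) (\<psi> x) ` (\<phi> -` A)" using b \<phi>\<psi> by auto
    qed (auto simp: hom \<phi>\<psi>)
    have "(+) x ` A = (\<lambda>y. - x + y) -` A" by (auto simp: image_iff add.assoc[symmetric]) (metis add.assoc add.left_neutral add.right_inverse)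
    then have "(+) x ` A \<in> sets borel"
      using measurable_sets[OF H.measurable_plus[of "- x"], of A] A by simp
    then show ?thesis using A by (simp add: emeasure_image e G.emeasure_image_plus[OF sm[OF A]])
  qed
  show "emeasure (distr M1 borel \<phi>) K < \<infinity>" if "compact K" for K
    using that G.finite_compact[OF cm[OF that]] by (simp add: emeasure_image borel_compact)
  show "0 < emeasure (distr M1 borel \<phi>) U" if U: "open U \<and> U \<noteq> {}" for U
  proof -
    obtain u where "u \<in> U" using U by blast
    then have "\<psi> u \<in> \<phi> -` U" using \<phi>\<psi> by simp
    then show ?thesis using U G.open_pos[of "\<phi> -` U"] om by (auto simp: emeasure_image)
  qed
  show "emeasure (distr M1 borel \<phi>) A = (INF U\<in>{U. open U \<and> A \<subseteq> U}. emeasure (distr M1 borel \<phi>) U)" if A: "A \<in> sets borel" for A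
  proof (rule antisym)
    show "emeasure (distr M1 borel \<phi>) A \<le> (INF U\<in>{U. open U \<and> A \<subseteq> U}. emeasure (distr M1 borel \<phi>) U)"
      by (intro INF_greatest emeasure_mono) auto
    have "emeasure (distr M1 borel \<phi>) A = (INF V\<in>{V. open V \<and> \<phi> -` A \<subseteq> V}. emeasure M1 V)"
      unfolding emeasure_image[OF A] by (rule G.outer[OF sm[OF A]])
    also have "\<dots> \<ge> (INF U\<in>{U. open U \<and> A \<subseteq> U}. emeasure (distr M1 borel \<phi>) U)"
    proof (rule INF_greatest)
      fix V assume V: "V \<in> {V. open V \<and> \<phi> -` A \<subseteq> V}"
      have "\<psi> -` V \<in> {U. open U \<and> A \<subseteq> U}" using V om'[of V] \<phi>\<psi> by auto
      moreover have "emeasure (distr M1 borel \<phi>) (\<psi> -` V) = emeasure M1 V"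
        using V om'[of V] by (simp add: emeasure_image vimage_vimage)
      ultimately show "(INF U\<in>{U. open U \<and> A \<subseteq> U}. emeasure (distr M1 borel \<phi>) U) \<le> emeasure M1 V"
        by (metis INF_lower)
    qed
    finally show "(INF U\<in>{U. open U \<and> A \<subseteq> U}. emeasure (distr M1 borel \<phi>) U) \<le> emeasure (distr M1 borel \<phi>) A" .
  qed
  show "emeasure (distr M1 borel \<phi>) U = (SUP K\<in>{K. compact K \<and> K \<subseteq> U}. emeasure (distr M1 borel \<phi>) K)" if U: "open U" for U
  proof (rule antisym)
    show "(SUP K\<in>{K. compact K \<and> K \<subseteq> U}. emeasure (distr M1 borel \<phi>) K) \<le> emeasure (distr M1 borel \<phi>) U"
      using U by (intro SUP_least emeasure_mono) auto
    have "emeasure (distr M1 borel \<phi>) U = emeasure M1 (\<phi> -` U)" using U by (intro emeasure_image) auto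
    also have "\<dots> = (SUP K\<in>{K. compact K \<and> K \<subseteq> \<phi> -` U}. emeasure M1 K)" by (rule G.inner[OF om[OF U]])
    also have "\<dots> \<le> (SUP K\<in>{K. compact K \<and> K \<subseteq> U}. emeasure (distr M1 borel \<phi>) K)"
    proof (rule SUP_least)
      fix K assume K: "K \<in> {K. compact K \<and> K \<subseteq> \<phi> -` U}"
      have "\<psi> -` K \<in> {K. compact K \<and> K \<subseteq> U}" using K cm'[of K] \<phi>\<psi> by (auto simp: subset_iff)
      moreover have "emeasure (distr M1 borel \<phi>) (\<psi> -` K) = emeasure M1 K"
        using K cm'[of K] by (simp add: emeasure_image vimage_vimage borel_compact)
      ultimately show "emeasure M1 K \<le> (SUP K\<in>{K. compact K \<and> K \<subseteq> U}. emeasure (distr M1 borel \<phi>) K)"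
        by (metis SUP_upper)
    qed
    finally show "emeasure (distr M1 borel \<phi>) U \<le> (SUP K\<in>{K. compact K \<and> K \<subseteq> U}. emeasure (distr M1 borel \<phi>) K)" .
  qed
qed

end

section \<open>Comparison with the standard operator\<close>

locale scaled_intertwined = intertwined_homeo M1 \<omega>1 M2 \<omega>2 p T \<gamma> \<phi> \<psi>
  for M1 :: "'g::{topological_group_add,t2_space} measure" and \<omega>1
    and M2 :: "'h::{topological_group_add,t2_space} measure" and \<omega>2 and p T \<gamma> \<phi> \<psi> +
  fixes c :: real
  assumes c_pos: "0 < c" and scale: "A \<in> sets borel \<Longrightarrow> emeasure (distr M1 borel \<phi>) A = ennreal c * emeasure M2 A"
begin

abbreviation T0 where "T0 \<equiv> T_std c \<gamma> \<phi>"

lemma T0_eq: "T0 f y = complex_of_real c * \<gamma> (\<psi> y) * f (\<psi> y)"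
  by (simp add: T_std_def inv_\<phi>)

lemma haar_const: "haar_const M1 M2 \<phi> c"
  unfolding haar_const_def
proof (intro ballI impI)
  fix E assume "E \<in> sets M1"
  then have E: "E \<in> sets borel" by simp
  have im: "\<phi> ` E = \<psi> -` E" using \<phi>\<psi> \<psi>\<phi> by (auto simp: image_iff) metis
  have "\<psi> -` E \<in> sets borel"
    using measurable_sets[OF borel_measurable_continuous_onI[OF \<psi>_cont] E] by simp
  from scale[OF this] show "emeasure M1 E = ennreal c * emeasure M2 (\<phi> ` E)"
    unfolding im emeasure_image[OF \<open>\<psi> -` E \<in> sets borel\<close>] vimage_vimage .
qed

lemma distr_eq: "distr M1 borel \<phi> = density M2 (\<lambda>_. ennreal c)"
  by (rule measure_eqI) (auto simp: scale emeasure_density_const)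

lemma change_variables:
  fixes F :: "'h \<Rightarrow> 'b::{banach,second_countable_topology}"
  assumes F: "F \<in> borel_measurable borel"
  shows "(\<integral>x. F (\<phi> x) \<partial>M1) = c *\<^sub>R (\<integral>y. F y \<partial>M2)"
    and "integrable M1 (\<lambda>x. F (\<phi> x)) \<longleftrightarrow> integrable M2 F"
proof -
  have "(\<integral>x. F (\<phi> x) \<partial>M1) = (\<integral>y. F y \<partial>distr M1 borel \<phi>)"
    by (rule integral_distr[OF \<phi>_meas F, symmetric])
  also have "\<dots> = (\<integral>y. c *\<^sub>R F y \<partial>M2)"
    unfolding distr_eq using c_pos F by (intro integral_density) auto
  finally show "(\<integral>x. F (\<phi> x) \<partial>M1) = c *\<^sub>R (\<integral>y. F y \<partial>M2)" by simp
  have "integrable M1 (\<lambda>x. F (\<phi> x)) \<longleftrightarrow> integrable (distr M1 borel \<phi>) F"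
    by (rule integrable_distr_eq[OF \<phi>_meas F, symmetric])
  also have "\<dots> \<longleftrightarrow> integrable M2 (\<lambda>y. c *\<^sub>R F y)"
    unfolding distr_eq using c_pos F by (intro integrable_density) auto
  also have "\<dots> \<longleftrightarrow> integrable M2 F"
  proof
    assume "integrable M2 (\<lambda>y. c *\<^sub>R F y)"
    then have "integrable M2 (\<lambda>y. (1 / c) *\<^sub>R (c *\<^sub>R F y))" by (rule integrable_scaleR_right)
    then show "integrable M2 F" using c_pos by simp
  qed (rule integrable_scaleR_right)
  finally show "integrable M1 (\<lambda>x. F (\<phi> x)) \<longleftrightarrow> integrable M2 F" .
qed

lemma T0_meas:
  assumes "f \<in> borel_measurable borel" shows "T0 f \<in> borel_measurable borel"
proof -
  have "(\<lambda>y. f (\<psi> y)) \<in> borel_measurable borel"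
    by (rule borel_measurable_continuous_compose[OF assms \<psi>_cont])
  moreover have "(\<lambda>y. \<gamma> (\<psi> y)) \<in> borel_measurable borel"
    by (rule borel_measurable_continuous_compose[OF borel_measurable_continuous_onI[OF \<gamma>_cont] \<psi>_cont])
  ultimately have "(\<lambda>y. complex_of_real c * \<gamma> (\<psi> y) * f (\<psi> y)) \<in> borel_measurable borel"
    by (intro borel_measurable_times borel_measurable_const)
  then show ?thesis by (simp add: T0_eq[abs_def])
qed

text \<open>The upper bound R for |\<gamma>| \<omega>2(\<phi>) / \<omega>1 dominates the integrand
  after the change of variables.\<close>

lemma T0_Lp: assumes f: "f \<in> G.Lp" shows "T0 f \<in> H.Lp"
proof -
  obtain R where R: "0 < R" "\<And>x. norm (\<gamma> x) * \<omega>2 (\<phi> x) / \<omega>1 x \<le> R" using ratio_bounded by blast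
  let ?F = "\<lambda>y. norm (T0 f y) powr p * \<omega>2 y powr p"
  have Fm: "?F \<in> borel_measurable borel" using T0_meas[OF G.Lp_meas[OF f]] by measurable
  have "(\<lambda>x. ?F (\<phi> x)) \<in> borel_measurable M1" by (rule measurable_compose[OF \<phi>_meas Fm])
  have "integrable M1 (\<lambda>x. ?F (\<phi> x))"
  proof (rule Bochner_Integration.integrable_bound)
    show "integrable M1 (\<lambda>x. (c * R) powr p * (norm (f x) powr p * \<omega>1 x powr p))" using G.Lp_int[OF f] by simp
    show "(\<lambda>x. ?F (\<phi> x)) \<in> borel_measurable M1" by fact
    show "AE x in M1. norm (?F (\<phi> x)) \<le> norm ((c * R) powr p * (norm (f x) powr p * \<omega>1 x powr p))"
    proof (intro AE_I2)
      fix x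
      have "norm (\<gamma> x) * \<omega>2 (\<phi> x) \<le> R * \<omega>1 x" using R(2)[of x] G.w_pos[of x] by (simp add: divide_le_eq)
      then have "(c * norm (f x)) * (norm (\<gamma> x) * \<omega>2 (\<phi> x)) \<le> (c * norm (f x)) * (R * \<omega>1 x)"
        using c_pos by (intro mult_left_mono) auto
      then have "norm (T0 f (\<phi> x)) * \<omega>2 (\<phi> x) \<le> c * R * (norm (f x) * \<omega>1 x)"
        using c_pos by (simp add: T0_eq \<psi>\<phi> norm_mult mult_ac)
      then have "(norm (T0 f (\<phi> x)) * \<omega>2 (\<phi> x)) powr p \<le> (c * R * (norm (f x) * \<omega>1 x)) powr p"
        using G.p H.w_pos[of "\<phi> x"] by (intro powr_mono2) auto
      then show "norm (?F (\<phi> x)) \<le> norm ((c * R) powr p * (norm (f x) powr p * \<omega>1 x powr p))"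
        by (simp add: powr_mult)
    qed
  qed
  then have "integrable M2 ?F" using change_variables(2)[OF Fm] by simp
  then show ?thesis using T0_meas[OF G.Lp_meas[OF f]] by (simp add: Lp_w_def)
qed

text \<open>The factor c in \<open>T0\<close> cancels the one from the change of variables, because
  \<phi> carries M1 to c times M2.\<close>

lemma conv_T0:
  assumes f: "f \<in> borel_measurable borel" and k: "k \<in> Cc"
  shows "conv M2 (T0 f) k y = (\<integral>x. f x * (\<gamma> x * k (- \<phi> x + y)) \<partial>M1)"
proof -
  have m: "(\<lambda>z. T0 f z * k (- z + y)) \<in> borel_measurable borel"
    by (intro borel_measurable_times T0_meas f H.reflect_meas Cc_measurable k)
  have "complex_of_real c * conv M2 (T0 f) k y = (\<integral>x. T0 f (\<phi> x) * k (- \<phi> x + y) \<partial>M1)"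
    using change_variables(1)[OF m] by (simp add: conv_def scaleR_conv_of_real)
  also have "\<dots> = (\<integral>x. complex_of_real c * (f x * (\<gamma> x * k (- \<phi> x + y))) \<partial>M1)"
    by (simp add: T0_eq \<psi>\<phi> mult_ac)
  also have "\<dots> = complex_of_real c * (\<integral>x. f x * (\<gamma> x * k (- \<phi> x + y)) \<partial>M1)" by simp
  finally show ?thesis using c_pos by simp
qed

lemma kernel_Cc:
  assumes k: "k \<in> Cc" shows "(\<lambda>x. \<gamma> x * k (- \<phi> x + y)) \<in> Cc"
proof -
  have \<psi>0: "\<psi> (y - z) = x" if "z = - \<phi> x + y" for x z
  proof -
    have "y - z = \<phi> x" unfolding that
      by (simp add: diff_conv_add_uminus minus_add add.assoc[symmetric] del: add_uminus_conv_diff)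
    then show ?thesis by (simp add: \<psi>\<phi>)
  qed
  have "(\<lambda>x. k (- \<phi> x + y)) \<in> Cc"
  proof (rule Cc_homeo[OF k])
    show "continuous_on UNIV (\<lambda>x. - \<phi> x + y)" by (intro continuous_intros \<phi>_cont)
    show "continuous_on UNIV (\<lambda>z. \<psi> (y - z))"
      by (rule continuous_on_compose2[OF \<psi>_cont]) (auto intro!: continuous_intros)
  qed (rule \<psi>0[OF refl])
  from Cc_mult[OF this \<gamma>_cont] show ?thesis by (simp add: mult.commute)
qed

text \<open>Both sides are limits of $\sum_i c_i\,\gamma(x_i)\,k(\phi(x_i)^{-1}y)$, where $\sum_i c_i L_{x_i}$ are the Riemann
  sums of convolution by $f$, applied to $T^{-1}k$.\<close>

lemma conv_T_Cc_AE:
  assumes f: "f \<in> Cc" and k: "k \<in> Cc" and B: "compact B"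
  shows "AE y in M2. y \<in> B \<longrightarrow> conv M2 (T f) k y = conv M2 (T0 f) k y"
proof -
  obtain K where K: "compact K" "\<And>x. x \<notin> K \<Longrightarrow> f x = 0" using f by (auto simp: Cc_def)
  obtain b where b: "0 < b" "\<And>x. norm (f x) \<le> b" using Cc_bounded[OF f] by metis
  interpret F: bounded_compact M1 \<omega>1 p f K b
    by unfold_locales (use Cc_measurable[OF f] K b in auto)
  have kL: "k \<in> H.Lp" by (rule H.Lp_Cc[OF k])
  have Bs: "B \<in> sets borel" by (rule borel_compact[OF B])
  define g where "g = Tinv k"
  have g: "g \<in> G.Lp" "AE y in M2. T g y = k y" unfolding g_def using Tinv[OF kL] by auto
  have Tf: "T f \<in> H.Lp" by (rule T_Lp[OF F.f_Lp])
  have cfg: "conv M1 f g \<in> G.Lp" by (rule G.conv_Lp[OF F.f_Lp g(1)])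
  have "conv M2 (T f) (T g) = conv M2 (T f) k"
    by (rule H.conv_cong_right[OF Tf H.Lp_meas[OF T_Lp[OF g(1)]] H.Lp_meas[OF kL] g(2)])
  then have Tconv: "AE y in M2. T (conv M1 f g) y = conv M2 (T f) k y" using T_conv[OF F.f_Lp g(1)] by simp
  let ?Q = "conv M2 (T0 f) k" and ?P = "conv M2 (T f) k"
  \<comment> \<open>The Riemann sums of \<open>conv_T0\<close> are close uniformly only for y in a
    compact set, hence the restriction to B.\<close>
  let ?h = "\<lambda>y. indicator B y * (?P y - ?Q y)"
  have PL: "?P \<in> H.Lp" by (rule H.conv_Lp[OF Tf kL])
  have QL: "?Q \<in> H.Lp" by (rule H.conv_Lp[OF T0_Lp[OF F.f_Lp] kL])
  have hL: "?h \<in> H.Lp" by (rule H.Lp_indicator(1)[OF H.Lp_diff(1)[OF PL QL] Bs])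
  obtain C where C: "0 < C" "\<forall>f\<in>G.Lp. H.pn (T f) \<le> C * G.pn f" using T_bd by blast
  obtain D where D: "0 \<le> D" "\<forall>f\<in>borel_measurable borel. \<forall>d\<ge>0. (\<forall>x. x \<notin> B \<longrightarrow> f x = 0) \<longrightarrow> (\<forall>x\<in>B. norm (f x) \<le> d) \<longrightarrow> H.pn f \<le> D * d powr p"
    using H.pn_compact_support_le[OF B] by blast
  have kc: "continuous_on UNIV k" using k by (simp add: Cc_def)
  have cont: "continuous_on UNIV (\<lambda>z. \<gamma> (fst z) * k (- \<phi> (fst z) + snd z))"
    by (auto intro!: continuous_intros continuous_on_compose2[OF \<gamma>_cont] continuous_on_compose2[OF kc] continuous_on_compose2[OF \<phi>_cont])
  have le: "H.pn ?h \<le> 2 powr p * (C * e + D * (e * F.mass) powr p)" if e: "0 < e" for e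
  proof -
    obtain V1 where V1: "\<And>x. open (V1 x) \<and> x \<in> V1 x" "\<And>X A. subordinate K V1 X A \<Longrightarrow>
       G.pn (\<lambda>z. conv M1 f g z - (\<Sum>x\<in>X. F.coef A x * ltrans x g z)) < e"
      using F.conv_riemann[OF g(1) e] by blast
    have "\<exists>V. open V \<and> x \<in> V \<and> (\<forall>a\<in>V. \<forall>y\<in>B. dist (\<gamma> a * k (- \<phi> a + y)) (\<gamma> x * k (- \<phi> x + y)) < e)" for x
      using tube_dist[OF cont B e, of x] by simp
    then obtain V2 where V2: "\<And>x. open (V2 x) \<and> x \<in> V2 x"
      "\<And>x a y. a \<in> V2 x \<Longrightarrow> y \<in> B \<Longrightarrow> dist (\<gamma> a * k (- \<phi> a + y)) (\<gamma> x * k (- \<phi> x + y)) < e"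
      by metis
    \<comment> \<open>A single partition subordinate to both families makes the Riemann sums for f *
      g and for the integral of \<open>conv_T0\<close> use the same tags and coefficients.\<close>
    obtain X A where S: "subordinate K (\<lambda>x. V1 x \<inter> V2 x) X A"
      using subordinate_exists[OF K(1), of "\<lambda>x. V1 x \<inter> V2 x"] V1(1) V2(1) by (auto simp: open_Int)
    have S1: "subordinate K V1 X A" by (rule subordinate_mono[OF S]) auto
    have X: "finite X" "\<And>x. x \<in> X \<Longrightarrow> A x \<in> sets borel" "\<And>x. x \<in> X \<Longrightarrow> A x \<subseteq> V2 x"
      "disjoint_family_on A X" "(\<Union>x\<in>X. A x) = K" using S by (auto simp: subordinate_def)
    let ?s = "\<lambda>z. \<Sum>x\<in>X. F.coef A x * ltrans x g z"
    let ?t = "\<lambda>y. \<Sum>x\<in>X. F.coef A x * (\<gamma> x * k (- \<phi> x + y))"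
    have sL: "?s \<in> G.Lp" by (intro G.Lp_sum X G.Lp_cmult(1) G.Lp_ltrans(1) g)
    have tL: "?t \<in> H.Lp"
    proof -
      have "(\<lambda>y. \<Sum>x\<in>X. F.coef A x * (\<gamma> x * ltrans (\<phi> x) k y)) \<in> H.Lp"
        by (intro H.Lp_sum X H.Lp_cmult(1) H.Lp_ltrans(1) kL)
      then show ?thesis by (simp add: ltrans_def)
    qed
    have "AE y in M2. \<forall>x\<in>X. T (ltrans x g) y = \<gamma> x * k (- \<phi> x + y)"
      using tw_Tinv[OF kL] X(1) by (intro AE_finite_allI) (auto simp: g_def ltrans_def)
    then have "AE y in M2. T ?s y = ?t y"
      using T_sum[OF X(1), of "\<lambda>x. ltrans x g" "F.coef A"] G.Lp_ltrans(1)[OF g(1)]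
      by (auto elim!: eventually_elim2 intro!: sum.cong)
    then have tT: "AE y in M2. ?P y - ?t y = T (\<lambda>z. conv M1 f g z - ?s z) y"
      using Tconv T_diff[OF cfg sL] by eventually_elim simp
    have D1: "(\<lambda>z. conv M1 f g z - ?s z) \<in> G.Lp" by (rule G.Lp_diff(1)[OF cfg sL])
    have PtL: "(\<lambda>y. ?P y - ?t y) \<in> H.Lp" by (rule H.Lp_diff(1)[OF PL tL])
    have tQL: "(\<lambda>y. ?t y - ?Q y) \<in> H.Lp" by (rule H.Lp_diff(1)[OF tL QL])
    have "H.pn (\<lambda>y. ?P y - ?t y) = H.pn (T (\<lambda>z. conv M1 f g z - ?s z))"
      by (rule H.pn_cong_AE[OF H.Lp_meas[OF PtL] H.Lp_meas[OF T_Lp[OF D1]] tT])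
    also have "\<dots> \<le> C * G.pn (\<lambda>z. conv M1 f g z - ?s z)" using C D1 by blast
    also have "\<dots> \<le> C * e" using V1(2)[OF S1] C by (intro mult_left_mono) auto
    finally have p1: "H.pn (\<lambda>y. ?P y - ?t y) \<le> C * e" .
    have close: "norm (?t y - ?Q y) \<le> e * F.mass" if y: "y \<in> B" for y
    proof -
      have "norm (?Q y - ?t y) \<le> e * (\<integral>x. norm (f x) \<partial>M1)"
        unfolding conv_T0[OF F.fm k] F.coef_def
      proof (rule riemann_sum_bound[OF G.sets_M F.f_int _ K(2) X(1,2,4,5)])
        show "integrable M1 (\<lambda>x. f x * (\<gamma> x * k (- \<phi> x + y)))"
          by (rule G.Cc_integrable_M[OF Cc_mult[OF f]]) (use kernel_Cc[OF k, of y] in \<open>auto simp: Cc_def\<close>)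
        show "norm (\<gamma> x' * k (- \<phi> x' + y) - \<gamma> x * k (- \<phi> x + y)) \<le> e" if "x \<in> X" "x' \<in> A x" for x x'
          using V2(2)[of x' x y] X(3)[OF that(1)] that y by (auto simp: dist_norm less_imp_le)
      qed
      also have "\<dots> \<le> e * F.mass" using e by (simp add: F.mass_def)
      finally show ?thesis by (simp add: norm_minus_commute)
    qed
    have iL: "(\<lambda>y. indicator B y * (?t y - ?Q y)) \<in> H.Lp" by (rule H.Lp_indicator(1)[OF tQL Bs])
    have "0 \<le> e * F.mass" using e F.mass_pos by simp
    then have p2: "H.pn (\<lambda>y. indicator B y * (?t y - ?Q y)) \<le> D * (e * F.mass) powr p"
      using D(2)[rule_format, OF H.Lp_meas[OF iL], of "e * F.mass"] close by auto
    have "H.pn ?h = H.pn (\<lambda>y. indicator B y * (?P y - ?t y) + indicator B y * (?t y - ?Q y))"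
      by (simp add: distrib_left[symmetric])
    also have "\<dots> \<le> 2 powr p * (H.pn (\<lambda>y. indicator B y * (?P y - ?t y)) + H.pn (\<lambda>y. indicator B y * (?t y - ?Q y)))"
      by (rule H.Lp_add(2)[OF H.Lp_indicator(1)[OF PtL Bs] iL])
    also have "\<dots> \<le> 2 powr p * (C * e + D * (e * F.mass) powr p)"
      using H.Lp_indicator(2)[OF PtL Bs] p1 p2 by (intro mult_left_mono add_mono) auto
    finally show ?thesis .
  qed
  have "(\<lambda>n. 2 powr p * (C * (1 / real (Suc n)) + D * ((1 / real (Suc n)) * F.mass) powr p)) \<longlonglongrightarrow> 2 powr p * (C * 0 + D * 0)"
  proof (intro tendsto_intros LIMSEQ_Suc[OF lim_inverse_n'])
    have "(\<lambda>n. 1 / real (Suc n) * F.mass) \<longlonglongrightarrow> 0 * F.mass" by (intro tendsto_intros LIMSEQ_Suc[OF lim_inverse_n'])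
    then show "(\<lambda>n. (1 / real (Suc n) * F.mass) powr p) \<longlonglongrightarrow> 0"
      using G.p F.mass_pos by (intro tendsto_zero_powrI[OF _ tendsto_const]) auto
  qed
  then have "H.pn ?h \<le> 2 powr p * (C * 0 + D * 0)"
  proof (rule LIMSEQ_le_const, intro exI[of _ 0] allI impI)
    fix n show "H.pn ?h \<le> 2 powr p * (C * (1 / real (Suc n)) + D * ((1 / real (Suc n)) * F.mass) powr p)"
      by (rule le) simp
  qed
  then have "H.pn ?h = 0" using H.pn_nonneg[of ?h] by simp
  then have "AE y in M2. ?h y = 0" using H.pn_eq_0_iff[OF hL] by simp
  then show ?thesis by eventually_elim (auto simp: indicator_def)
qed

lemma conv_T_Cc:
  assumes f: "f \<in> Cc" and k: "k \<in> Cc" shows "conv M2 (T f) k = conv M2 (T0 f) k"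
  by (rule H.AE_eq_continuous[OF H.conv_Cc_continuous[OF T_Lp k] H.conv_Cc_continuous[OF T0_Lp k] conv_T_Cc_AE[OF f k]])
    (auto intro: G.Lp_Cc f)

text \<open>By \<open>conv_determines\<close> it suffices to compare T f * k and T0 f * k at 0. Both
  depend continuously on f, and they agree for f in \<open>Cc\<close> by
  \<open>conv_T_Cc\<close>.\<close>

theorem T_eq_T0:
  assumes f: "f \<in> G.Lp" shows "AE y in M2. T f y = T0 f y"
proof (rule H.conv_determines[OF T_Lp[OF f] T0_Lp[OF f]])
  fix k :: "'h \<Rightarrow> complex" assume k: "k \<in> Cc"
  define \<kappa> where "\<kappa> x = \<gamma> x * k (- \<phi> x + 0)" for x
  have "\<kappa> \<in> Cc" unfolding \<kappa>_def by (rule kernel_Cc[OF k])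
  then have \<kappa>: "(\<lambda>x. \<kappa> (- x)) \<in> Cc" by (rule Cc_uminus)
  \<comment> \<open>Rewriting the value as a convolution on the first group makes its dependence on
    u an instance of \<open>conv_Cc_bound\<close> there.\<close>
  have e0: "conv M2 (T0 u) k 0 = conv M1 u (\<lambda>x. \<kappa> (- x)) 0" if "u \<in> G.Lp" for u
    unfolding conv_T0[OF G.Lp_meas[OF that] k] by (simp add: conv_def \<kappa>_def)
  obtain C1 where C1: "0 < C1" "\<forall>f\<in>G.Lp. norm (conv M1 f (\<lambda>x. \<kappa> (- x)) 0) \<le> C1 * G.pn f powr (1/p)"
    using G.conv_Cc_bound[OF \<kappa>] by blast
  obtain C2 where C2: "0 < C2" "\<forall>f\<in>H.Lp. norm (conv M2 f k 0) \<le> C2 * H.pn f powr (1/p)"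
    using H.conv_Cc_bound[OF k] by blast
  obtain C where C: "0 < C" "\<forall>f\<in>G.Lp. H.pn (T f) \<le> C * G.pn f" using T_bd by blast
  have "\<exists>l\<in>Cc. G.pn (\<lambda>x. f x - l x) < 1 / real (Suc n)" for n by (rule G.dense_Cc[OF f]) simp
  then obtain l where l: "\<And>n. l n \<in> Cc" "\<And>n. G.pn (\<lambda>x. f x - l n x) < 1 / real (Suc n)" by metis
  have lim0: "(\<lambda>n. G.pn (\<lambda>x. f x - l n x)) \<longlonglongrightarrow> 0"
  proof (rule tendsto_sandwich[OF always_eventually always_eventually tendsto_const LIMSEQ_Suc[OF lim_inverse_n']])
    show "\<forall>n. 0 \<le> G.pn (\<lambda>x. f x - l n x)" using G.pn_nonneg by blast
    show "\<forall>n. G.pn (\<lambda>x. f x - l n x) \<le> 1 / real (Suc n)" using l(2) less_imp_le by blast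
  qed
  have bound: "norm (conv M2 (T f) k 0 - conv M2 (T0 f) k 0) \<le> C2 * (C * G.pn (\<lambda>x. f x - l n x)) powr (1/p) + C1 * G.pn (\<lambda>x. f x - l n x) powr (1/p)" for n
  proof -
    have lL: "l n \<in> G.Lp" by (rule G.Lp_Cc[OF l(1)])
    have D: "(\<lambda>x. f x - l n x) \<in> G.Lp" by (rule G.Lp_diff(1)[OF f lL])
    have D2: "(\<lambda>y. T f y - T (l n) y) \<in> H.Lp" by (rule H.Lp_diff(1)[OF T_Lp[OF f] T_Lp[OF lL]])
    have "H.pn (\<lambda>y. T f y - T (l n) y) = H.pn (T (\<lambda>x. f x - l n x))"
      by (rule H.pn_cong_AE[symmetric, OF H.Lp_meas[OF T_Lp[OF D]] H.Lp_meas[OF D2] T_diff[OF f lL]])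
    also have "\<dots> \<le> C * G.pn (\<lambda>x. f x - l n x)" using C D by blast
    finally have pT: "H.pn (\<lambda>y. T f y - T (l n) y) \<le> C * G.pn (\<lambda>x. f x - l n x)" .
    have "norm (conv M2 (\<lambda>y. T f y - T (l n) y) k 0) \<le> C2 * H.pn (\<lambda>y. T f y - T (l n) y) powr (1/p)" using C2 D2 by blast
    also have "\<dots> \<le> C2 * (C * G.pn (\<lambda>x. f x - l n x)) powr (1/p)"
      using pT C2 G.p H.pn_nonneg by (intro mult_left_mono powr_mono2) auto
    finally have 1: "norm (conv M2 (T f) k 0 - conv M2 (T (l n)) k 0) \<le> C2 * (C * G.pn (\<lambda>x. f x - l n x)) powr (1/p)"
      using H.conv_diff_left[OF T_Lp[OF f] T_Lp[OF lL] k] by simp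
    have "norm (conv M1 (\<lambda>x. f x - l n x) (\<lambda>x. \<kappa> (- x)) 0) \<le> C1 * G.pn (\<lambda>x. f x - l n x) powr (1/p)" using C1 D by blast
    then have 2: "norm (conv M2 (T0 f) k 0 - conv M2 (T0 (l n)) k 0) \<le> C1 * G.pn (\<lambda>x. f x - l n x) powr (1/p)"
      using G.conv_diff_left[OF f lL \<kappa>] by (simp add: e0 f lL)
    have 3: "conv M2 (T (l n)) k 0 = conv M2 (T0 (l n)) k 0" using conv_T_Cc[OF l(1) k] by simp
    have "conv M2 (T f) k 0 - conv M2 (T0 f) k 0 = (conv M2 (T f) k 0 - conv M2 (T (l n)) k 0) - (conv M2 (T0 f) k 0 - conv M2 (T0 (l n)) k 0)"
      using 3 by simp
    then have "norm (conv M2 (T f) k 0 - conv M2 (T0 f) k 0) \<le> norm (conv M2 (T f) k 0 - conv M2 (T (l n)) k 0) + norm (conv M2 (T0 f) k 0 - conv M2 (T0 (l n)) k 0)"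
      by (metis norm_triangle_ineq4)
    then show ?thesis using 1 2 by linarith
  qed
  have "(\<lambda>n. C2 * (C * G.pn (\<lambda>x. f x - l n x)) powr (1/p) + C1 * G.pn (\<lambda>x. f x - l n x) powr (1/p)) \<longlonglongrightarrow> C2 * 0 + C1 * 0"
  proof (intro tendsto_add tendsto_mult tendsto_const)
    have "(\<lambda>n. C * G.pn (\<lambda>x. f x - l n x)) \<longlonglongrightarrow> 0" using lim0 by (rule tendsto_mult_right_zero)
    then show "(\<lambda>n. (C * G.pn (\<lambda>x. f x - l n x)) powr (1/p)) \<longlonglongrightarrow> 0"
      using G.p C G.pn_nonneg by (intro tendsto_zero_powrI[OF _ tendsto_const]) auto
    show "(\<lambda>n. G.pn (\<lambda>x. f x - l n x) powr (1/p)) \<longlonglongrightarrow> 0"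
      using G.p G.pn_nonneg by (intro tendsto_zero_powrI[OF lim0 tendsto_const]) auto
  qed
  then have "norm (conv M2 (T f) k 0 - conv M2 (T0 f) k 0) \<le> C2 * 0 + C1 * 0"
    by (rule LIMSEQ_le_const) (use bound in blast)
  then show "conv M2 (T f) k 0 = conv M2 (T0 f) k 0" by simp
qed

end

lemma (in weighted_iso) standard_form:
  "\<exists>\<gamma> \<phi>. standard_iso \<omega>1 \<omega>2 \<gamma> \<phi> \<and> (\<exists>c>0. haar_const M1 M2 \<phi> c \<and> (\<forall>f\<in>G.Lp. ae_eq M2 (T f) (T_std c \<gamma> \<phi> f)))"
proof -
  obtain \<gamma> \<phi> where I: "intertwined M1 \<omega>1 M2 \<omega>2 p T \<gamma> \<phi>" using intertwined_exists by blast
  interpret I: intertwined M1 \<omega>1 M2 \<omega>2 p T \<gamma> \<phi> by (rule I)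
  interpret V: weighted_iso M2 \<omega>2 M1 \<omega>1 p Tinv by (rule weighted_iso_Tinv)
  obtain \<delta> \<psi> where J: "intertwined M2 \<omega>2 M1 \<omega>1 p Tinv \<delta> \<psi>" using V.intertwined_exists by blast
  interpret J: intertwined M2 \<omega>2 M1 \<omega>1 p Tinv \<delta> \<psi> by (rule J)
  note inv = I.inverse_intertwiner[OF J]
  interpret K: intertwined_homeo M1 \<omega>1 M2 \<omega>2 p T \<gamma> \<phi> \<psi>
    by unfold_locales (use inv J.\<phi>_cont in auto)
  obtain c where c: "0 < c" "\<And>A. A \<in> sets borel \<Longrightarrow> emeasure (distr M1 borel \<phi>) A = ennreal c * emeasure M2 A"
    using H.haar_unique[OF K.haar_image] by metis
  interpret S: scaled_intertwined M1 \<omega>1 M2 \<omega>2 p T \<gamma> \<phi> \<psi> c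
    by unfold_locales (use c in auto)
  obtain R where R: "0 < R" "\<And>x. norm (\<gamma> x) * \<omega>2 (\<phi> x) / \<omega>1 x \<le> R" using I.ratio_bounded by blast
  obtain R' where R': "0 < R'" "\<And>y. norm (\<delta> y) * \<omega>1 (\<psi> y) / \<omega>2 y \<le> R'" using J.ratio_bounded by blast
  \<comment> \<open>This is the upper bound R' for the pair of \<open>Tinv\<close> at \<phi> x,
    rewritten by \<gamma> x * \<delta> (\<phi> x) = 1.\<close>
  have low: "1 / R' \<le> norm (\<gamma> x) * \<omega>2 (\<phi> x) / \<omega>1 x" for x
  proof -
    have "\<gamma> x * \<delta> (\<phi> x) = 1" using inv(3)[of "\<phi> x"] inv(2) by simp
    then have "norm (\<gamma> x) * norm (\<delta> (\<phi> x)) = 1" by (metis norm_mult norm_one)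
    then have d: "norm (\<delta> (\<phi> x)) = 1 / norm (\<gamma> x)" using I.\<gamma>_nz[of x] by (simp add: field_simps)
    have "1 / norm (\<gamma> x) * \<omega>1 x / \<omega>2 (\<phi> x) \<le> R'" using R'(2)[of "\<phi> x"] unfolding d inv(2) .
    then show ?thesis using R'(1) I.\<gamma>_nz[of x] G.w_pos[of x] H.w_pos[of "\<phi> x"] by (simp add: field_simps)
  qed
  have "0 < 1 / R'" using R' by simp
  also have "\<dots> \<le> (INF x. norm (\<gamma> x) * \<omega>2 (\<phi> x) / \<omega>1 x)" by (rule cINF_greatest) (use low in auto)
  finally have inf: "0 < (INF x. norm (\<gamma> x) * \<omega>2 (\<phi> x) / \<omega>1 x)" .
  have bdd: "bdd_above (range (\<lambda>x. norm (\<gamma> x) * \<omega>2 (\<phi> x) / \<omega>1 x))" by (rule bdd_aboveI[of _ R]) (use R(2) in auto)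
  have "standard_iso \<omega>1 \<omega>2 \<gamma> \<phi>"
    unfolding standard_iso_def
    using K.bij_\<phi> I.\<phi>_cont J.\<phi>_cont K.inv_\<phi> I.hom I.\<gamma>_cont I.\<gamma>_nz I.char inf bdd by simp
  moreover have "\<forall>f\<in>G.Lp. ae_eq M2 (T f) (T_std c \<gamma> \<phi> f)" using S.T_eq_T0 by (simp add: ae_eq_def)
  ultimately show ?thesis using S.haar_const c(1) by blast
qed

text \<open>The constant in \<open>bicontinuous\<close> may have any sign; |C| + 1 replaces it by a
  positive one before taking p-th powers.\<close>

lemma pnorm_le_of_Lp_norm_le:
  assumes p: "1 \<le> p" and le: "Lp_norm M \<omega> p f \<le> C * Lp_norm N \<theta> p g"
  shows "pnorm M \<omega> p f \<le> (\<bar>C\<bar> + 1) powr p * pnorm N \<theta> p g"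
proof -
  have nn: "0 \<le> pnorm M \<omega> p f" "0 \<le> pnorm N \<theta> p g" by (auto simp: pnorm_def intro!: Bochner_Integration.integral_nonneg)
  have e: "Lp_norm M \<omega> p f = pnorm M \<omega> p f powr (1/p)" "Lp_norm N \<theta> p g = pnorm N \<theta> p g powr (1/p)"
    by (auto simp: Lp_norm_def pnorm_def)
  have "pnorm M \<omega> p f powr (1/p) \<le> (\<bar>C\<bar> + 1) * pnorm N \<theta> p g powr (1/p)"
    using le unfolding e by (rule order_trans[OF _ mult_right_mono]) auto
  then have "(pnorm M \<omega> p f powr (1/p)) powr p \<le> ((\<bar>C\<bar> + 1) * pnorm N \<theta> p g powr (1/p)) powr p"
    using p by (intro powr_mono2) auto
  then show ?thesis using p nn by (simp add: powr_mult powr_powr)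
qed

theorem theorem2p5:
  fixes M1 :: "'g::{topological_group_add,t2_space} measure"
    and M2 :: "'h::{topological_group_add,t2_space} measure"
    and \<omega>1 :: "'g \<Rightarrow> real" and \<omega>2 :: "'h \<Rightarrow> real"
    and p :: real
    and T :: "('g \<Rightarrow> complex) \<Rightarrow> ('h \<Rightarrow> complex)"
  assumes "lc_group TYPE('g)" and "lc_group TYPE('h)"
    and "haar_measure M1" and "haar_measure M2"
    and "weight \<omega>1" and "weight \<omega>2"
    and "1 \<le> p"
    and "conv_algebra M1 \<omega>1 p" and "conv_algebra M2 \<omega>2 p"
    and "alg_iso M1 \<omega>1 M2 \<omega>2 p T"
    and "bicontinuous M1 \<omega>1 M2 \<omega>2 p T"
    and "biseparating M1 \<omega>1 M2 \<omega>2 p T"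
  shows "\<exists>\<gamma> \<phi>. standard_iso \<omega>1 \<omega>2 \<gamma> \<phi> \<and>
           (\<exists>c>0. haar_const M1 M2 \<phi> c \<and>
              (\<forall>f\<in>Lp_w M1 \<omega>1 p. ae_eq M2 (T f) (T_std c \<gamma> \<phi> f)))"
proof -
  interpret G: weighted_group M1 \<omega>1 p using assms by unfold_locales
  interpret H: weighted_group M2 \<omega>2 p using assms by unfold_locales
  have bd: "\<exists>C>0. \<forall>f\<in>G.Lp. H.pn (T f) \<le> C * G.pn f"
  proof -
    obtain C where "\<forall>f\<in>G.Lp. Lp_norm M2 \<omega>2 p (T f) \<le> C * Lp_norm M1 \<omega>1 p f"
      using assms(11) unfolding bicontinuous_def by blast
    then have "\<forall>f\<in>G.Lp. H.pn (T f) \<le> (\<bar>C\<bar> + 1) powr p * G.pn f"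
      using pnorm_le_of_Lp_norm_le[OF assms(7)] by blast
    moreover have "0 < (\<bar>C\<bar> + 1) powr p" by simp
    ultimately show ?thesis by blast
  qed
  have bd': "\<exists>C>0. \<forall>f\<in>G.Lp. G.pn f \<le> C * H.pn (T f)"
  proof -
    obtain C where "\<forall>f\<in>G.Lp. Lp_norm M1 \<omega>1 p f \<le> C * Lp_norm M2 \<omega>2 p (T f)"
      using assms(11) unfolding bicontinuous_def by blast
    then have "\<forall>f\<in>G.Lp. G.pn f \<le> (\<bar>C\<bar> + 1) powr p * H.pn (T f)"
      using pnorm_le_of_Lp_norm_le[OF assms(7)] by blast
    moreover have "0 < (\<bar>C\<bar> + 1) powr p" by simp
    ultimately show ?thesis by blast
  qed
  interpret weighted_iso M1 \<omega>1 M2 \<omega>2 p T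
    using assms(10,12) bd bd' unfolding alg_iso_def biseparating_def ae_eq_def
    by unfold_locales simp_all
  show ?thesis by (rule standard_form)
qed

end
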